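(* Let $B\subset\mathbb{R}^2$ be the open unit ball centered at the origin and let $p>1$. Let $0\le\alpha\le\beta$ and let $u_\alpha$ and $u_\beta$ be radial solutions of $$-\Delta u=|x|^{\alpha}|u|^{p-1}u\ \text{ in }B,\quad u=0\ \text{ on }\partial B,\qquad\text{and}\qquad -\Delta u=|x|^{\beta}|u|^{p-1}u\ \text{ in }B,\quad u=0\ \text{ on }\partial B,$$ respectively, with the same number $n\ge1$ of nodal sets. Then $m(u_\alpha)\le m(u_\beta)$ and $m_{rad}(u_\alpha)=m_{rad}(u_\beta)=n$.
   Context: The number of nodal sets of a continuous function $u:B\to\mathbb{R}$ is the number of connected components of $\{x\in B:u(x)\neq0\}$. For a solution $u$ of $-\Delta u=|x|^{\alpha}|u|^{p-1}u$ in $B$, $u=0$ on $\partial B$, the Morse index $m(u)$ is the maximal dimension of a subspace of $H^1_0(B)$ on which the quadratic form $Q_u(w)=\int_B|\nabla w|^2\,dx-p\int_B|x|^{\alpha}|u|^{p-1}w^2\,dx$ is negative definite. If $u$ is radial, the radial Morse index $m_{rad}(u)$ is the maximal dimension of a subspace of $H^1_{0,rad}(B)$ (the radial functions in $H^1_0(B)$) on which $Q_u$ is negative definite. The same definitions apply with $\beta$ in place of $\alpha$. *)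

theory Defs
  imports "HOL-Analysis.Analysis" "HOL-Library.Function_Algebras" "HOL-Library.Extended_Nat"
begin

abbreviation unit_disc :: "(real^2) set" where
  "unit_disc \<equiv> ball 0 1"

definition partial_deriv :: "2 \<Rightarrow> (real^2 \<Rightarrow> real) \<Rightarrow> real^2 \<Rightarrow> real" where
  "partial_deriv i f x = frechet_derivative f (at x) (axis i 1)"

(* intended for open S *)
fun Ck_on :: "nat \<Rightarrow> (real^2 \<Rightarrow> real) \<Rightarrow> (real^2) set \<Rightarrow> bool" where
  "Ck_on 0 f S = continuous_on S f"
| "Ck_on (Suc k) f S =
    ((\<forall>x\<in>S. f differentiable (at x)) \<and> (\<forall>i. Ck_on k (partial_deriv i f) S))"

definition laplacian :: "(real^2 \<Rightarrow> real) \<Rightarrow> real^2 \<Rightarrow> real" where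
  "laplacian f x = (\<Sum>i\<in>UNIV. partial_deriv i (partial_deriv i f) x)"

(* The weight |x|^a. The case distinction is needed because 0 powr 0 = 0, whereas |x|^0 = 1
   also at the origin. *)
definition henon_weight :: "real \<Rightarrow> real^2 \<Rightarrow> real" where
  "henon_weight a x = (if a = 0 then 1 else norm x powr a)"

(* Classical solutions: u in C^2(B) and continuous up to the boundary. Values of u outside the
   closed disc are irrelevant. *)
definition henon_solution :: "real \<Rightarrow> real \<Rightarrow> (real^2 \<Rightarrow> real) \<Rightarrow> bool" where
  "henon_solution p a u \<longleftrightarrow>
     Ck_on 2 u unit_disc \<and> continuous_on (closure unit_disc) u \<and>
     (\<forall>x\<in>unit_disc. - laplacian u x = henon_weight a x * \<bar>u x\<bar> powr (p - 1) * u x) \<and>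
     (\<forall>x\<in>frontier unit_disc. u x = 0)"

definition radial :: "(real^2 \<Rightarrow> real) \<Rightarrow> bool" where
  "radial u \<longleftrightarrow> (\<forall>x\<in>unit_disc. \<forall>y\<in>unit_disc. norm x = norm y \<longrightarrow> u x = u y)"

(* Value 0 if there are infinitely many components (or none). *)
definition num_nodal_sets :: "(real^2 \<Rightarrow> real) \<Rightarrow> nat" where
  "num_nodal_sets u = card (components {x\<in>unit_disc. u x \<noteq> 0})"

definition test_function :: "(real^2 \<Rightarrow> real) \<Rightarrow> bool" where
  "test_function \<phi> \<longleftrightarrow>
     (\<forall>k. Ck_on k \<phi> UNIV) \<and>
     compact (closure {x. \<phi> x \<noteq> 0}) \<and> closure {x. \<phi> x \<noteq> 0} \<subseteq> unit_disc"

definition in_L2 :: "(real^2 \<Rightarrow> real) \<Rightarrow> bool" where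
  "in_L2 w \<longleftrightarrow> w \<in> borel_measurable (lebesgue_on unit_disc) \<and>
     integrable (lebesgue_on unit_disc) (\<lambda>x. (w x)\<^sup>2)"

definition has_weak_gradient :: "(real^2 \<Rightarrow> real) \<Rightarrow> (real^2 \<Rightarrow> real^2) \<Rightarrow> bool" where
  "has_weak_gradient w g \<longleftrightarrow>
     (\<forall>i. in_L2 (\<lambda>x. g x $ i)) \<and>
     (\<forall>\<phi> i. test_function \<phi> \<longrightarrow>
        (LINT x|lebesgue_on unit_disc. w x * partial_deriv i \<phi> x) =
        - (LINT x|lebesgue_on unit_disc. g x $ i * \<phi> x))"

(* Sobolev functions are represented by functions defined everywhere, not by classes modulo null
   sets. *)
definition H1 :: "(real^2 \<Rightarrow> real) set" where
  "H1 = {w. in_L2 w \<and> (\<exists>g. has_weak_gradient w g)}"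

(* Determined only up to a null set in the disc; it is used only under integrals over the disc. *)
definition weak_gradient :: "(real^2 \<Rightarrow> real) \<Rightarrow> real^2 \<Rightarrow> real^2" where
  "weak_gradient w = (SOME g. has_weak_gradient w g)"

definition H1_norm :: "(real^2 \<Rightarrow> real) \<Rightarrow> real" where
  "H1_norm w = sqrt ((LINT x|lebesgue_on unit_disc. (w x)\<^sup>2) +
                     (LINT x|lebesgue_on unit_disc. (norm (weak_gradient w x))\<^sup>2))"

(* The closure of the test functions in H1. *)
definition H10 :: "(real^2 \<Rightarrow> real) set" where
  "H10 = {w\<in>H1. \<forall>e>0. \<exists>\<phi>. test_function \<phi> \<and> H1_norm (\<lambda>x. w x - \<phi> x) < e}"

definition H10_rad :: "(real^2 \<Rightarrow> real) set" where
  "H10_rad = {w\<in>H10. radial w}"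

definition henon_form :: "real \<Rightarrow> real \<Rightarrow> (real^2 \<Rightarrow> real) \<Rightarrow> (real^2 \<Rightarrow> real) \<Rightarrow> real" where
  "henon_form p a u w =
     (LINT x|lebesgue_on unit_disc. (norm (weak_gradient w x))\<^sup>2)
     - p * (LINT x|lebesgue_on unit_disc. henon_weight a x * \<bar>u x\<bar> powr (p - 1) * (w x)\<^sup>2)"

interpretation real_fun: vector_space "\<lambda>(c::real) (f::real^2 \<Rightarrow> real) x. c * f x"
  by unfold_locales (auto simp: fun_eq_iff algebra_simps)

(* Working with representatives does not change the dimensions: the form vanishes on functions
   that are a.e. 0 in the disc, so a subspace V of representatives on which it is negative
   definite contains no such function other than 0 and hence embeds into the quotient.
   Conversely, a basis of a finite-dimensional subspace of the quotient lifts to representatives,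
   which can be chosen radial if the classes are. *)
definition neg_def_subspace ::
  "((real^2 \<Rightarrow> real) \<Rightarrow> real) \<Rightarrow> (real^2 \<Rightarrow> real) set \<Rightarrow> (real^2 \<Rightarrow> real) set \<Rightarrow> bool" where
  "neg_def_subspace Q X V \<longleftrightarrow>
     real_fun.subspace V \<and> V \<subseteq> X \<and> (\<forall>w\<in>V. w \<noteq> 0 \<longrightarrow> Q w < 0)"

(* The library's dim is 0 on infinite-dimensional V, but all finite-dimensional subspaces of such
   a V are included as well, so the supremum is infinite if dimensions are unbounded. *)
definition max_neg_dim :: "((real^2 \<Rightarrow> real) \<Rightarrow> real) \<Rightarrow> (real^2 \<Rightarrow> real) set \<Rightarrow> enat" where
  "max_neg_dim Q X = (SUP V \<in> {V. neg_def_subspace Q X V}. enat (real_fun.dim V))"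

definition morse_index :: "real \<Rightarrow> real \<Rightarrow> (real^2 \<Rightarrow> real) \<Rightarrow> enat" where
  "morse_index p a u = max_neg_dim (henon_form p a u) H10"

definition radial_morse_index :: "real \<Rightarrow> real \<Rightarrow> (real^2 \<Rightarrow> real) \<Rightarrow> enat" where
  "radial_morse_index p a u = max_neg_dim (henon_form p a u) H10_rad"

end

theory Submission
  imports Defs
begin

text \<open>Write \<open>W = |x|^a |u|^(p-1)\<close> for the potential of the linearisation, so that the quadratic form
  is \<open>Q(w) = \<integral> |grad w|^2 - p W w^2\<close>. The weight \<open>|x|^a\<close> disappears in dimension
  two: the map \<open>x \<mapsto> |x|^(k-1) x\<close> with \<open>k = (b+2)/(a+2)\<close> turns radial solutions for the
  exponent \<open>a\<close> into radial solutions for the exponent \<open>b\<close>, up to a constant factor.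

  The comparison of Morse indices. In the radial variable, a radial solution solves an ordinary
  differential equation and is determined by its value at the origin. The equation is invariant
  under scaling, and counting nodal sets fixes the scaling factor. Hence \<open>u_b(x) = K
  u_a(|x|^(k-1) x)\<close> with \<open>|K|^(p-1) = k^2\<close> (\<open>radial_solutions_related\<close>). The pull-back of a
  test function \<open>f\<close> under this map satisfies \<open>Q_b(f \<circ> \<Phi>) \<le> k Q_a(f)\<close>: radial
  derivatives and the potential scale by exactly the factor \<open>k\<close>, whereas angular derivatives
  scale by the smaller factor \<open>1/k\<close> (\<open>pull_form_le\<close>). So the pull-back carries subspaces on
  which \<open>Q_a\<close> is negative definite to such subspaces for \<open>Q_b\<close>, without loss of dimension.

  The radial Morse index is at least \<open>n\<close> because the restrictions of \<open>u\<close> to its \<open>n\<close> nodal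
  sets, slightly truncated, have disjoint supports, and \<open>Q\<close> is close to \<open>(1-p) \<integral> W
  u^2 < 0\<close> on each of them (\<open>trunc_sol_negative\<close>). It is at most \<open>n\<close> by a Sturm argument with
  an explicit solution of the linearised equation: \<open>z = x \<cdot> grad u + c u\<close> with \<open>c =
  (2+a)/(p-1)\<close>, the derivative of \<open>u\<close> along the scaling. On a nodal set, the logarithmic
  derivative \<open>r u'/u\<close> is strictly decreasing, so \<open>z\<close> vanishes on at most one circle per nodal
  set (\<open>card_lin_zeros\<close>). A radial function that vanishes on these circles has \<open>Q \<ge> 0\<close> by
  Picone's identity (\<open>form_nonneg\<close>); these are at most \<open>n\<close> linear conditions.

  All integral identities are proved in the plane, for functions of class \<open>C^1\<close> with compact
  support in the disc; the divergence theorem for them follows from translation invariance of the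
  integral (\<open>int_partial_zero\<close>). Two results connect them with the Sobolev space: such functions
  belong to \<open>H10\<close>, by mollification (\<open>c1c_H10\<close>); and a finite-dimensional negative definite
  subspace can be replaced by one spanned by test functions, because the form is coercive on it
  (\<open>approx_neg_def\<close>). If the subspace consists of radial functions, averaging over rotations
  makes the test functions radial without increasing the form by more than the approximation error
  (\<open>radial_approx_neg_def\<close>).\<close>

section \<open>Continuously differentiable functions with compact support in the disc\<close>

definition c1c :: "(real^2 \<Rightarrow> real) \<Rightarrow> (real^2 \<Rightarrow> real^2) \<Rightarrow> bool" where
  "c1c f g \<longleftrightarrow> (\<forall>x. (f has_derivative (\<lambda>h. g x \<bullet> h)) (at x)) \<and> continuous_on UNIV g \<and>
     (\<exists>\<rho><1. \<forall>x. \<rho> \<le> norm x \<longrightarrow> f x = 0)"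

abbreviation disc :: "(real^2) measure" where "disc \<equiv> lebesgue_on unit_disc"

lemma partial_deriv_eq:
  assumes "(f has_derivative (\<lambda>h. g \<bullet> h)) (at x)"
  shows "partial_deriv i f x = g $ i"
  unfolding partial_deriv_def using frechet_derivative_at[OF assms, symmetric]
  by (simp add: inner_axis)

lemma c1c_cont: "c1c f g \<Longrightarrow> continuous_on UNIV f"
  unfolding c1c_def by (auto intro!: continuous_at_imp_continuous_on has_derivative_continuous)

text \<open>Away from the support the derivative is that of a constant. The radius is enlarged so that the
  gradient vanishes on the closed set as well.\<close>
lemma c1c_support:
  assumes "c1c f g"
  obtains \<rho> where "0 < \<rho>" "\<rho> < 1" "\<And>x. \<rho> \<le> norm x \<Longrightarrow> f x = 0" "\<And>x. \<rho> \<le> norm x \<Longrightarrow> g x = 0"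
proof -
  obtain r where r: "r < 1" "\<And>x. r \<le> norm x \<Longrightarrow> f x = 0" using assms unfolding c1c_def by blast
  define \<rho> where "\<rho> = (max r 0 + 1) / 2"
  have \<rho>: "0 < \<rho>" "\<rho> < 1" "r < \<rho>" using r unfolding \<rho>_def by auto
  have "g x = 0" if "\<rho> \<le> norm x" for x
  proof -
    have o: "open {y::real^2. r < norm y}" by (intro open_Collect_less continuous_intros)
    have "((\<lambda>y. 0) has_derivative (\<lambda>h. g x \<bullet> h)) (at x)"
      by (rule has_derivative_transform_within_open[OF _ o, of f])
        (use assms \<rho> that r in \<open>auto simp: c1c_def\<close>)
    then have "(\<lambda>h. g x \<bullet> h) = (\<lambda>h. 0)"
      by (rule has_derivative_unique) (rule has_derivative_const)
    then have "g x \<bullet> g x = 0" by (rule fun_cong)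
    then show ?thesis by simp
  qed
  then show ?thesis using that[of \<rho>] \<rho> r by force
qed

lemma c1cI:
  assumes "\<And>x. (f has_derivative (\<lambda>h. g x \<bullet> h)) (at x)" "continuous_on UNIV g"
    "\<rho> < 1" "\<And>x. \<rho> \<le> norm x \<Longrightarrow> f x = 0"
  shows "c1c f g"
  using assms unfolding c1c_def by blast

lemma c1c_sum:
  assumes "\<And>j. j \<in> J \<Longrightarrow> c1c (f j) (g j)" "finite J"
  shows "c1c (\<lambda>x. \<Sum>j\<in>J. c j * f j x) (\<lambda>x. \<Sum>j\<in>J. c j *\<^sub>R g j x)"
proof -
  have "\<forall>j\<in>J. \<exists>\<rho><1. \<forall>x. \<rho> \<le> norm x \<longrightarrow> f j x = 0" using assms(1) unfolding c1c_def by blast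
  then obtain r where r: "\<And>j. j \<in> J \<Longrightarrow> r j < 1 \<and> (\<forall>x. r j \<le> norm x \<longrightarrow> f j x = 0)" by metis
  define \<rho> where "\<rho> = Max (insert 0 (r ` J))"
  have "\<rho> < 1" using r assms(2) unfolding \<rho>_def by (subst Max_less_iff) auto
  have le: "r j \<le> \<rho>" if "j \<in> J" for j using that assms(2) unfolding \<rho>_def by (intro Max_ge) auto
  show ?thesis
  proof (rule c1cI[OF _ _ \<open>\<rho> < 1\<close>])
    show "((\<lambda>x. \<Sum>j\<in>J. c j * f j x) has_derivative (\<lambda>h. (\<Sum>j\<in>J. c j *\<^sub>R g j x) \<bullet> h)) (at x)" for x
      unfolding inner_sum_left inner_scaleR_left
      by (intro has_derivative_sum has_derivative_mult_right) (use assms in \<open>auto simp: c1c_def\<close>)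
    show "continuous_on UNIV (\<lambda>x. \<Sum>j\<in>J. c j *\<^sub>R g j x)"
      by (intro continuous_intros) (use assms in \<open>auto simp: c1c_def\<close>)
    show "(\<Sum>j\<in>J. c j * f j x) = 0" if "\<rho> \<le> norm x" for x
      using r le that by (intro sum.neutral) fastforce
  qed
qed

lemma c1c_diff:
  assumes "c1c f g" "c1c f' g'"
  shows "c1c (\<lambda>x. f x - f' x) (\<lambda>x. g x - g' x)"
  using c1c_sum[of "UNIV::bool set" "\<lambda>b. if b then f else f'" "\<lambda>b. if b then g else g'" "\<lambda>b. if b then 1 else -1"] assms
  by (simp add: UNIV_bool)

lemma c1c_mult:
  assumes f: "c1c f g" and p: "\<And>x. (p has_derivative (\<lambda>h. q x \<bullet> h)) (at x)" "continuous_on UNIV q"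
  shows "c1c (\<lambda>x. f x * p x) (\<lambda>x. f x *\<^sub>R q x + p x *\<^sub>R g x)"
proof -
  obtain r where r: "r < 1" "\<And>x. r \<le> norm x \<Longrightarrow> f x = 0" using f unfolding c1c_def by blast
  have pc: "continuous_on UNIV p" by (intro continuous_at_imp_continuous_on ballI has_derivative_continuous[OF p(1)])
  show ?thesis
  proof (rule c1cI[OF _ _ r(1)])
    show "((\<lambda>x. f x * p x) has_derivative (\<lambda>h. (f x *\<^sub>R q x + p x *\<^sub>R g x) \<bullet> h)) (at x)" for x
      by (rule has_derivative_eq_rhs[OF has_derivative_mult])
        (use f p(1)[of x] in \<open>auto simp: c1c_def inner_add_left mult.commute\<close>)
    show "continuous_on UNIV (\<lambda>x. f x *\<^sub>R q x + p x *\<^sub>R g x)"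
      by (intro continuous_intros c1c_cont[OF f] pc p(2)) (use f in \<open>auto simp: c1c_def\<close>)
  qed (use r in auto)
qed

lemma disc_sets [simp]: "unit_disc \<in> sets lebesgue" by simp

lemma disc_sub: "unit_disc \<subseteq> cbox (-r *\<^sub>R One) (r *\<^sub>R One :: real^2)" if "1 \<le> r" for r
proof
  fix x :: "real^2" assume "x \<in> unit_disc"
  then have "norm x < 1" by simp
  have "\<bar>x \<bullet> i\<bar> \<le> r" if "i \<in> Basis" for i
    using Basis_le_norm[OF that, of x] \<open>1 \<le> r\<close> \<open>norm x < 1\<close> by linarith
  then show "x \<in> cbox (-r *\<^sub>R One) (r *\<^sub>R One)"
    unfolding mem_box by (auto simp: abs_le_iff minus_le_iff)
qed

lemma mem_shifted_cbox:
  fixes x e :: "real^2"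
  assumes "norm x < 1" "norm e < 1"
  shows "x \<in> cbox (- 2 *\<^sub>R One + e) (2 *\<^sub>R One + e)"
proof -
  have "\<bar>x \<bullet> j\<bar> < 1 \<and> \<bar>e \<bullet> j\<bar> < 1" if j: "j \<in> Basis" for j
    using Basis_le_norm[OF j, of x] Basis_le_norm[OF j, of e] assms by auto
  then show ?thesis unfolding mem_box by (fastforce simp: inner_add_left inner_diff_left)
qed

lemma finite_measure_disc: "finite_measure disc"
  by (rule finite_measure_lebesgue_on) (simp add: lmeasurable_ball)

lemma meas_disc:
  assumes "continuous_on unit_disc F"
  shows "(F::real^2\<Rightarrow>real) \<in> borel_measurable disc"
  by (rule continuous_imp_measurable_on_sets_lebesgue) (use assms in auto)

lemma integrable_disc_bounded:
  assumes "(F::real^2\<Rightarrow>real) \<in> borel_measurable disc" "\<And>x. x \<in> unit_disc \<Longrightarrow> \<bar>F x\<bar> \<le> B"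
  shows "integrable disc F"
  by (rule finite_measure.integrable_const_bound[OF finite_measure_disc, of _ B])
    (use assms in \<open>auto simp: space_restrict_space\<close>)

lemma integrable_disc:
  assumes "continuous_on UNIV (F::real^2\<Rightarrow>real)"
  shows "integrable disc F"
proof -
  have "compact (F ` cball 0 1)" by (intro compact_continuous_image continuous_on_subset[OF assms]) auto
  then obtain B where "\<And>x. x \<in> cball 0 1 \<Longrightarrow> \<bar>F x\<bar> \<le> B"
    by (metis bounded_iff compact_imp_bounded image_eqI real_norm_def)
  then show ?thesis
    by (intro integrable_disc_bounded[of _ B] meas_disc continuous_on_subset[OF assms]) auto
qed

lemma lint_disc_eq:
  assumes "continuous_on UNIV (F::real^2\<Rightarrow>real)" "\<And>x. 1 \<le> norm x \<Longrightarrow> F x = 0" "unit_disc \<subseteq> S"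
  shows "(LINT x|disc. F x) = integral S F"
proof -
  have "(LINT x|disc. F x) = integral unit_disc F"
    by (rule lebesgue_integral_eq_integral[OF integrable_disc[OF assms(1)]]) simp
  also have "\<dots> = integral UNIV (\<lambda>x. if x \<in> unit_disc then F x else 0)" by (rule integral_restrict_UNIV[symmetric])
  also have "(\<lambda>x. if x \<in> unit_disc then F x else 0) = (\<lambda>x. if x \<in> S then F x else 0)"
    using assms(2,3) by (force simp: fun_eq_iff)
  also have "integral UNIV \<dots> = integral S F" by (rule integral_restrict_UNIV)
  finally show ?thesis .
qed

text \<open>The integral of \<open>f\<close> does not change if \<open>f\<close> is translated; differentiating under the integral
  with respect to the translation gives the claim. It takes the place of the divergence theorem.\<close>
lemma int_partial_zero:
  assumes "c1c f g"
  shows "(LINT x|disc. g x $ i) = 0"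
proof -
  obtain \<rho> where \<rho>: "0 < \<rho>" "\<rho> < 1" "\<And>x. \<rho> \<le> norm x \<Longrightarrow> f x = 0" "\<And>x. \<rho> \<le> norm x \<Longrightarrow> g x = 0"
    using c1c_support[OF assms] by blast
  have gc: "continuous_on UNIV g" and fd: "\<And>x. (f has_derivative (\<lambda>h. g x \<bullet> h)) (at x)"
    using assms unfolding c1c_def by auto
  let ?e = "axis i 1 :: real^2"
  let ?K = "cbox (- 2 *\<^sub>R One) (2 *\<^sub>R One) :: (real^2) set"
  let ?H = "\<lambda>t. integral ?K (\<lambda>x. f (x + t *\<^sub>R ?e))"
  \<comment> \<open>Both the box of side 4 and its translate contain the support of \<open>f\<close>.\<close>
  have H: "?H t = integral UNIV f" if t: "\<bar>t\<bar> < 1" for t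
  proof -
    have "?H t = integral (cbox (- 2 *\<^sub>R One + t *\<^sub>R ?e) (2 *\<^sub>R One + t *\<^sub>R ?e)) f"
      using integral_shift_cbox_plus[of "- 2 *\<^sub>R One" "2 *\<^sub>R One" f "t *\<^sub>R ?e"]
      by (simp add: o_def add.commute)
    also have "\<dots> = integral UNIV (\<lambda>x. if x \<in> cbox (- 2 *\<^sub>R One + t *\<^sub>R ?e) (2 *\<^sub>R One + t *\<^sub>R ?e) then f x else 0)"
      by (rule integral_restrict_UNIV[symmetric])
    also have "(\<lambda>x. if x \<in> cbox (- 2 *\<^sub>R One + t *\<^sub>R ?e) (2 *\<^sub>R One + t *\<^sub>R ?e) then f x else 0) = f"
    proof
      fix x :: "real^2"
      show "(if x \<in> cbox (- 2 *\<^sub>R One + t *\<^sub>R ?e) (2 *\<^sub>R One + t *\<^sub>R ?e) then f x else 0) = f x"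
      proof (cases "norm x < 1")
        case True
        have "x \<in> cbox (- 2 *\<^sub>R One + t *\<^sub>R ?e) (2 *\<^sub>R One + t *\<^sub>R ?e)"
          by (rule mem_shifted_cbox) (use True t in \<open>auto simp: norm_axis_1\<close>)
        then show ?thesis by simp
      qed (use \<rho> in auto)
    qed
    finally show ?thesis .
  qed
  have "(?H has_field_derivative integral ?K (\<lambda>x. g (x + 0 *\<^sub>R ?e) \<bullet> ?e)) (at 0 within UNIV)"
  proof (rule leibniz_rule_field_derivative[where fx="\<lambda>t x. g (x + t *\<^sub>R ?e) \<bullet> ?e"])
    show "((\<lambda>t. f (x + t *\<^sub>R ?e)) has_field_derivative g (x + t *\<^sub>R ?e) \<bullet> ?e) (at t within UNIV)" for t x
    proof -
      have "((\<lambda>t. x + t *\<^sub>R ?e) has_derivative (\<lambda>s. s *\<^sub>R ?e)) (at t)"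
        by (auto intro!: derivative_eq_intros)
      from has_derivative_compose[OF this fd] show ?thesis
        unfolding has_field_derivative_def by (simp add: mult_commute_abs)
    qed
    show "(\<lambda>x. f (x + t *\<^sub>R ?e)) integrable_on ?K" for t
      by (intro integrable_continuous continuous_on_compose2[OF c1c_cont[OF assms]] continuous_intros) auto
    show "continuous_on (UNIV \<times> ?K) (\<lambda>(t, x). g (x + t *\<^sub>R ?e) \<bullet> ?e)"
      unfolding split_beta by (intro continuous_intros continuous_on_compose2[OF gc]) auto
  qed auto
  moreover have "(?H has_field_derivative 0) (at 0)"
    by (rule has_field_derivative_transform_within_open[of "\<lambda>_. integral UNIV f" _ _ "{-1<..<1}"])
      (use H in auto)
  ultimately have "integral ?K (\<lambda>x. g (x + 0 *\<^sub>R ?e) \<bullet> ?e) = 0"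
    using DERIV_unique by blast
  then have "integral ?K (\<lambda>x. g x $ i) = 0" by (simp add: inner_axis)
  moreover have "(LINT x|disc. g x $ i) = integral ?K (\<lambda>x. g x $ i)"
    by (rule lint_disc_eq) (use \<rho> disc_sub[of 2] in \<open>auto intro!: continuous_intros gc\<close>)
  ultimately show ?thesis by simp
qed

lemma int_by_parts:
  assumes f: "c1c f g" and p: "\<And>x. (p has_derivative (\<lambda>h. q x \<bullet> h)) (at x)" "continuous_on UNIV q"
  shows "(LINT x|disc. f x * q x $ i) = - (LINT x|disc. g x $ i * p x)"
proof -
  have pc: "continuous_on UNIV p" by (intro continuous_at_imp_continuous_on ballI has_derivative_continuous[OF p(1)])
  have gc: "continuous_on UNIV g" using f by (simp add: c1c_def)
  have "0 = (LINT x|disc. f x * q x $ i + g x $ i * p x)"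
    using int_partial_zero[OF c1c_mult[OF f p], of i] by (simp add: algebra_simps)
  also have "\<dots> = (LINT x|disc. f x * q x $ i) + (LINT x|disc. g x $ i * p x)"
    by (intro Bochner_Integration.integral_add integrable_disc continuous_intros c1c_cont[OF f] pc gc p(2))
  finally show ?thesis by simp
qed

section \<open>Test functions and mollification\<close>

definition smooth :: "(real^2 \<Rightarrow> real) \<Rightarrow> bool" where "smooth f \<longleftrightarrow> (\<forall>k. Ck_on k f UNIV)"

lemma Ck_on_SucD: "Ck_on (Suc k) f S \<Longrightarrow> Ck_on k f S"
proof (induction k arbitrary: f)
  case 0
  then show ?case
    by (auto intro!: continuous_at_imp_continuous_on differentiable_imp_continuous_within)
next
  case (Suc k)
  then show ?case by auto
qed

lemma Ck_on_SucI:
  assumes "\<And>x. (f has_derivative (\<lambda>h. g x \<bullet> h)) (at x)" "\<And>i. Ck_on k (\<lambda>x. g x $ i) UNIV"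
  shows "Ck_on (Suc k) f UNIV"
proof -
  have "partial_deriv i f = (\<lambda>x. g x $ i)" for i using partial_deriv_eq[OF assms(1)] by auto
  then show ?thesis using assms by (auto simp: differentiable_def)
qed

text \<open>The classical gradient. It equals \<open>g\<close> in every fact of the form \<open>(f has_derivative
  (\<lambda>h. g \<bullet> h)) (at x)\<close>.\<close>
definition gradient :: "(real^2 \<Rightarrow> real) \<Rightarrow> real^2 \<Rightarrow> real^2" where
  "gradient f x = (\<chi> i. partial_deriv i f x)"

lemma gradient_nth [simp]: "gradient f x $ i = partial_deriv i f x" by (simp add: gradient_def)

lemma has_derivative_gradient:
  assumes "f differentiable (at x)"
  shows "(f has_derivative (\<lambda>h. gradient f x \<bullet> h)) (at x)"
proof -
  let ?D = "frechet_derivative f (at x)"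
  have D: "(f has_derivative ?D) (at x)" using assms by (simp add: frechet_derivative_works)
  then interpret linear ?D by (simp add: has_derivative_linear)
  have "?D h = gradient f x \<bullet> h" for h
  proof -
    have "?D h = ?D (\<Sum>i\<in>UNIV. (h $ i) *\<^sub>R axis i 1)" using basis_expansion[of h] by (simp add: scalar_mult_eq_scaleR)
    also have "\<dots> = (\<Sum>i\<in>UNIV. h $ i * partial_deriv i f x)"
      by (simp add: sum scale partial_deriv_def)
    finally show ?thesis by (simp add: inner_vec_def mult.commute)
  qed
  then have "?D = (\<lambda>h. gradient f x \<bullet> h)" by auto
  with D show ?thesis by simp
qed

lemma Ck_on_const: "Ck_on k (\<lambda>x. c) UNIV"
proof (induction k arbitrary: c)
  case (Suc k)
  show ?case by (rule Ck_on_SucI[of _ "\<lambda>x. 0"]) (use Suc in auto)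
qed auto

lemma Ck_on_add:
  "Ck_on k f UNIV \<Longrightarrow> Ck_on k g UNIV \<Longrightarrow> Ck_on k (\<lambda>x. f x + g x) UNIV"
proof (induction k arbitrary: f g)
  case 0
  then show ?case by (auto intro: continuous_on_add)
next
  case (Suc k)
  show ?case
  proof (rule Ck_on_SucI[of _ "\<lambda>x. gradient f x + gradient g x"])
    show "((\<lambda>x. f x + g x) has_derivative (\<lambda>h. (gradient f x + gradient g x) \<bullet> h)) (at x)" for x
      unfolding inner_add_left
      by (intro has_derivative_add has_derivative_gradient) (use Suc.prems in auto)
    show "Ck_on k (\<lambda>x. (gradient f x + gradient g x) $ i) UNIV" for i
      using Suc.IH[of "partial_deriv i f" "partial_deriv i g"] Suc.prems by simp
  qed
qed

lemma Ck_on_mult: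
  "Ck_on k f UNIV \<Longrightarrow> Ck_on k g UNIV \<Longrightarrow> Ck_on k (\<lambda>x. f x * g x) UNIV"
proof (induction k arbitrary: f g)
  case 0
  then show ?case by (auto intro: continuous_on_mult)
next
  case (Suc k)
  show ?case
  proof (rule Ck_on_SucI[of _ "\<lambda>x. f x *\<^sub>R gradient g x + g x *\<^sub>R gradient f x"])
    show "((\<lambda>x. f x * g x) has_derivative (\<lambda>h. (f x *\<^sub>R gradient g x + g x *\<^sub>R gradient f x) \<bullet> h)) (at x)" for x
      by (rule has_derivative_eq_rhs[OF has_derivative_mult[OF has_derivative_gradient has_derivative_gradient]])
        (use Suc.prems in \<open>auto simp: inner_add_left mult.commute\<close>)
    have "Ck_on k (\<lambda>x. f x * partial_deriv i g x + g x * partial_deriv i f x) UNIV" for i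
      using Suc.prems by (intro Ck_on_add Suc.IH) (auto simp del: Ck_on.simps intro: Ck_on_SucD simp: Ck_on.simps(2))
    then show "Ck_on k (\<lambda>x. (f x *\<^sub>R gradient g x + g x *\<^sub>R gradient f x) $ i) UNIV" for i
      by simp
  qed
qed

text \<open>The functions \<open>exp (-1/t) / t^n\<close> for positive \<open>t\<close>, extended by zero. The exponent \<open>n\<close>
  makes the span of the family closed under differentiation, which gives smoothness by induction.\<close>
definition flat :: "nat \<Rightarrow> real \<Rightarrow> real" where
  "flat n t = (if 0 < t then exp (- inverse t) * inverse t ^ n else 0)"

lemma flat_tendsto: "(flat n \<longlongrightarrow> 0) (at 0)"
proof -
  have "((\<lambda>t. inverse t ^ n / exp (inverse t)) \<longlongrightarrow> (0::real)) (at_right 0)"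
    by (rule filterlim_compose[OF tendsto_power_div_exp_0 filterlim_inverse_at_top_right])
  then have "(flat n \<longlongrightarrow> 0) (at_right 0)"
    by (rule Lim_transform_eventually)
      (auto simp: eventually_at_right_less flat_def exp_minus field_simps intro!: eventually_mono[OF eventually_at_right_less])
  moreover have "(flat n \<longlongrightarrow> 0) (at_left 0)"
    by (rule tendsto_eventually) (auto simp: eventually_at_filter flat_def)
  ultimately show ?thesis by (simp add: filterlim_at_split)
qed

lemma flat_deriv: "(flat n has_real_derivative (flat (n+2) t - real n * flat (n+1) t)) (at t)"
proof -
  consider "t < 0" | "t = 0" | "0 < t" by linarith
  then show ?thesis
  proof cases
    case 1
    have "((\<lambda>t. 0) has_real_derivative 0) (at t)" by simp
    then have "(flat n has_real_derivative 0) (at t)"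
      by (rule has_field_derivative_transform_within_open[of _ _ _ "{..<0}"]) (use 1 in \<open>auto simp: flat_def\<close>)
    then show ?thesis using 1 by (simp add: flat_def)
  next
    case 2
    have "((\<lambda>h. (flat n (0 + h) - flat n 0) / h) \<longlongrightarrow> 0) (at 0)"
      by (rule Lim_transform_eventually[OF flat_tendsto[of "n+1"]])
        (auto simp: flat_def eventually_at_filter field_simps)
    then show ?thesis using 2 by (simp add: DERIV_def flat_def)
  next
    case 3
    have "((\<lambda>t. exp (- inverse t) * inverse t ^ n) has_real_derivative (flat (n+2) t - real n * flat (n+1) t)) (at t)"
    proof -
      have "((\<lambda>t. inverse t ^ n) has_real_derivative - real n * inverse t ^ (n + 1)) (at t)"
      proof (cases n)
        case (Suc m)
        have "((\<lambda>t. inverse t ^ Suc m) has_real_derivative real (Suc m) * (- (inverse t ^ Suc (Suc 0)) * inverse t ^ (Suc m - Suc 0))) (at t)"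
          using DERIV_power[OF DERIV_inverse[of t], where n="Suc m" and s=UNIV] 3 by simp
        then show ?thesis unfolding Suc
          by (rule DERIV_cong) (simp add: algebra_simps)
      qed simp
      moreover have "((\<lambda>t. exp (- inverse t)) has_real_derivative exp (- inverse t) * inverse t ^ 2) (at t)"
        using 3 by (auto intro!: derivative_eq_intros simp: power2_eq_square)
      ultimately show ?thesis
        by (rule DERIV_cong[OF DERIV_mult'[rotated]])
          (use 3 in \<open>simp add: flat_def power_add power2_eq_square algebra_simps\<close>)
    qed
    then show ?thesis
      by (rule has_field_derivative_transform_within_open[of _ _ _ "{0<..}"]) (use 3 in \<open>auto simp: flat_def\<close>)
  qed
qed

lemma Ck_on_flat:
  assumes L: "smooth L"
  shows "Ck_on k (\<lambda>x. flat n (L x)) UNIV"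
proof (induction k arbitrary: n)
  case 0
  have "continuous_on UNIV (flat n)" by (meson DERIV_continuous_on has_field_derivative_at_within flat_deriv)
  moreover have "continuous_on UNIV L" using L Ck_on.simps(1) unfolding smooth_def by blast
  ultimately show ?case by (simp add: continuous_on_compose2)
next
  case (Suc k)
  have Ld: "L differentiable (at x)" for x using L Ck_on.simps(2) unfolding smooth_def by blast
  have Lk: "Ck_on k (partial_deriv i L) UNIV" for i using L Ck_on.simps(2) unfolding smooth_def by blast
  show ?case
  proof (rule Ck_on_SucI[of _ "\<lambda>x. (flat (n+2) (L x) + (- real n) * flat (n+1) (L x)) *\<^sub>R gradient L x"])
    show "((\<lambda>x. flat n (L x)) has_derivative
       (\<lambda>h. ((flat (n+2) (L x) + (- real n) * flat (n+1) (L x)) *\<^sub>R gradient L x) \<bullet> h)) (at x)" for x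
      using has_derivative_compose[OF has_derivative_gradient[OF Ld] flat_deriv[THEN has_field_derivative_imp_has_derivative]]
      by simp
    show "Ck_on k (\<lambda>x. ((flat (n+2) (L x) + (- real n) * flat (n+1) (L x)) *\<^sub>R gradient L x) $ i) UNIV" for i
      unfolding vector_scaleR_component gradient_nth real_scaleR_def
      by (intro Ck_on_mult Ck_on_add Suc.IH Lk Ck_on_const)
  qed
qed

lemma Ck_on_coord: "Ck_on k (\<lambda>x. x $ i) UNIV"
proof (cases k)
  case (Suc m)
  have "Ck_on (Suc m) (\<lambda>x. x $ i) UNIV"
    by (rule Ck_on_SucI[of _ "\<lambda>x. axis i 1"])
      (auto simp: inner_axis' Ck_on_const intro!: bounded_linear_imp_has_derivative bounded_linear_vec_nth)
  with Suc show ?thesis by simp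
qed (auto intro!: continuous_intros)

lemma smooth_quadratic: "smooth (\<lambda>x. c - x \<bullet> x)"
proof -
  have "Ck_on k (\<lambda>x. c - x \<bullet> x) UNIV" for k
  proof (cases k)
    case (Suc m)
    have "Ck_on (Suc m) (\<lambda>x. c - x \<bullet> x) UNIV"
    proof (rule Ck_on_SucI[of _ "\<lambda>x. (- 2) *\<^sub>R x"])
      show "((\<lambda>x. c - x \<bullet> x) has_derivative (\<lambda>h. ((- 2) *\<^sub>R x) \<bullet> h)) (at x)" for x :: "real^2"
        by (auto intro!: derivative_eq_intros simp: inner_commute)
      show "Ck_on m (\<lambda>x. ((- 2) *\<^sub>R x) $ i) UNIV" for i
        using Ck_on_mult[OF Ck_on_const[of m "-2"] Ck_on_coord[of m i]] by simp
    qed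
    with Suc show ?thesis by simp
  qed (auto intro!: continuous_intros)
  then show ?thesis by (simp add: smooth_def)
qed

definition bump :: "real \<Rightarrow> real^2 \<Rightarrow> real" where "bump e x = flat 0 (e^2 - x \<bullet> x)"

lemma smooth_bump: "smooth (bump e)"
  unfolding smooth_def bump_def using Ck_on_flat[OF smooth_quadratic] by blast

lemma bump_pos: "norm x < e \<Longrightarrow> 0 < bump e x"
  by (simp add: bump_def flat_def power2_norm_eq_inner[symmetric] abs_square_less_1 power_strict_mono)

lemma bump_nonneg: "0 \<le> bump e x" by (simp add: bump_def flat_def)

lemma bump_zero: "0 \<le> e \<Longrightarrow> e \<le> norm x \<Longrightarrow> bump e x = 0"
  by (simp add: bump_def flat_def power2_norm_eq_inner[symmetric] power_mono not_less)

lemma bump_minus: "bump e (- x) = bump e x" by (simp add: bump_def)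

lemma smoothD: "smooth f \<Longrightarrow> (f has_derivative (\<lambda>h. gradient f x \<bullet> h)) (at x)"
  "smooth f \<Longrightarrow> smooth (partial_deriv i f)" "smooth f \<Longrightarrow> continuous_on UNIV f"
  "smooth f \<Longrightarrow> continuous_on UNIV (gradient f)"
proof -
  show 2: "smooth (partial_deriv i f)" if "smooth f" for f i
    using that Ck_on.simps(2) unfolding smooth_def by blast
  show 1: "(f has_derivative (\<lambda>h. gradient f x \<bullet> h)) (at x)" if "smooth f" for f x
    using that Ck_on.simps(2) has_derivative_gradient unfolding smooth_def by blast
  show 3: "continuous_on UNIV f" if "smooth f" for f
    using that Ck_on.simps(1) unfolding smooth_def by blast
  show "continuous_on UNIV (gradient f)" if "smooth f"
    unfolding gradient_def using 3[OF 2[OF that]] by (intro continuous_on_vec_lambda) 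
qed

text \<open>Differentiation under the integral sign for gradients; it serves both convolutions and averages
  over rotations.\<close>
lemma leibniz_gradient:
  fixes F :: "real^2 \<Rightarrow> 'b::euclidean_space \<Rightarrow> real" and G :: "real^2 \<Rightarrow> 'b \<Rightarrow> real^2"
  assumes F: "\<And>x t. ((\<lambda>x. F x t) has_derivative (\<lambda>h. G x t \<bullet> h)) (at x)"
    and Fc: "\<And>x. continuous_on (cbox a b) (F x)"
    and Gc: "continuous_on (UNIV \<times> cbox a b) (\<lambda>(x,t). G x t)"
  shows "((\<lambda>x. integral (cbox a b) (F x)) has_derivative (\<lambda>h. integral (cbox a b) (G x) \<bullet> h)) (at x)"
    and "continuous_on UNIV (\<lambda>x. integral (cbox a b) (G x))"
proof -
  show "continuous_on UNIV (\<lambda>x. integral (cbox a b) (G x))"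
    by (rule integral_continuous_on_param[OF Gc])
  have Gi: "G x integrable_on cbox a b"
    by (intro integrable_continuous continuous_on_compose2[OF Gc, of _ "Pair x", simplified]) (auto intro!: continuous_intros)
  have bl: "bounded_linear (blinfun_inner_right :: real^2 \<Rightarrow> _)"
    by (rule bounded_linear_blinfun_inner_right)
  have "((\<lambda>x. integral (cbox a b) (F x)) has_derivative integral (cbox a b) (\<lambda>t. blinfun_inner_right (G x t))) (at x within UNIV)"
  proof (rule leibniz_rule)
    show "continuous_on (UNIV \<times> cbox a b) (\<lambda>(x, t). blinfun_inner_right (G x t))"
      using bounded_linear.continuous_on[OF bl Gc] by (simp add: split_beta)
  qed (use F Fc in \<open>auto intro!: integrable_continuous\<close>)
  moreover have "integral (cbox a b) (\<lambda>t. blinfun_inner_right (G x t)) = blinfun_inner_right (integral (cbox a b) (G x))"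
    using integral_linear[OF Gi bl] by (simp add: o_def)
  ultimately show "((\<lambda>x. integral (cbox a b) (F x)) has_derivative (\<lambda>h. integral (cbox a b) (G x) \<bullet> h)) (at x)"
    by simp
qed

text \<open>Derivatives fall on the smooth factor, so the convolution inherits smoothness by induction on
  the order.\<close>
lemma smooth_convolution:
  assumes f: "c1c f g"
  shows "smooth \<eta> \<Longrightarrow> Ck_on k (\<lambda>x. integral (cbox a b) (\<lambda>z. f z * \<eta> (x - z))) UNIV"
    and "smooth \<eta> \<Longrightarrow> partial_deriv i (\<lambda>x. integral (cbox a b) (\<lambda>z. f z * \<eta> (x - z))) x =
      integral (cbox a b) (\<lambda>z. f z * partial_deriv i \<eta> (x - z))"
proof -
  have *: "((\<lambda>x. integral (cbox a b) (\<lambda>z. f z * \<eta> (x - z))) has_derivative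
        (\<lambda>h. integral (cbox a b) (\<lambda>z. f z *\<^sub>R gradient \<eta> (x - z)) \<bullet> h)) (at x)"
    if eta: "smooth \<eta>" for \<eta> x
  proof (rule leibniz_gradient(1))
    show "((\<lambda>x. f z * \<eta> (x - z)) has_derivative (\<lambda>h. (f z *\<^sub>R gradient \<eta> (x - z)) \<bullet> h)) (at x)" for x z
    proof -
      have "((\<lambda>x. x - z) has_derivative (\<lambda>h. h)) (at x)" by (auto intro!: derivative_eq_intros)
      from has_derivative_compose[OF this smoothD(1)[OF eta]]
      show ?thesis unfolding inner_scaleR_left by (intro has_derivative_mult_right)
    qed
    show "continuous_on (cbox a b) (\<lambda>z. f z * \<eta> (x - z))" for x
      by (intro continuous_intros continuous_on_subset[OF c1c_cont[OF f]]
          continuous_on_compose2[OF smoothD(3)[OF eta]]) auto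
    show "continuous_on (UNIV \<times> cbox a b) (\<lambda>(x, z). f z *\<^sub>R gradient \<eta> (x - z))"
      unfolding split_beta
      by (intro continuous_intros continuous_on_compose2[OF c1c_cont[OF f]]
          continuous_on_compose2[OF smoothD(4)[OF eta]]) auto
  qed
  have comp: "integral (cbox a b) (\<lambda>z. f z *\<^sub>R gradient \<eta> (x - z)) $ i =
      integral (cbox a b) (\<lambda>z. f z * partial_deriv i \<eta> (x - z))" if eta: "smooth \<eta>" for \<eta> x i
  proof -
    have "(\<lambda>z. f z *\<^sub>R gradient \<eta> (x - z)) integrable_on cbox a b"
      by (intro integrable_continuous continuous_intros continuous_on_subset[OF c1c_cont[OF f]]
          continuous_on_compose2[OF smoothD(4)[OF eta]]) auto
    from integral_linear[OF this bounded_linear_vec_nth[of i]] show ?thesis by (simp add: o_def)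
  qed
  show "smooth \<eta> \<Longrightarrow> Ck_on k (\<lambda>x. integral (cbox a b) (\<lambda>z. f z * \<eta> (x - z))) UNIV"
  proof (induction k arbitrary: \<eta>)
    case 0
    show ?case using *[OF 0]
      by (auto intro!: continuous_at_imp_continuous_on has_derivative_continuous)
  next
    case (Suc k)
    show ?case
      by (rule Ck_on_SucI[OF *[OF Suc.prems]]) (simp only: comp[OF Suc.prems] Suc.IH smoothD(2)[OF Suc.prems])
  qed
  show "partial_deriv i (\<lambda>x. integral (cbox a b) (\<lambda>z. f z * \<eta> (x - z))) x =
      integral (cbox a b) (\<lambda>z. f z * partial_deriv i \<eta> (x - z))" if "smooth \<eta>"
    using partial_deriv_eq[OF *[OF that]] comp[OF that] by simp
qed

lemma unif_cont_disc:
  fixes h :: "real^2 \<Rightarrow> 'a::metric_space"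
  assumes "continuous_on UNIV h" "0 < e"
  obtains d where "0 < d" "\<And>x z. norm x < 1 \<Longrightarrow> dist z x < d \<Longrightarrow> dist (h z) (h x) < e"
proof -
  have "uniformly_continuous_on (cball 0 2) h"
    by (rule compact_uniformly_continuous[OF continuous_on_subset[OF assms(1)]]) auto
  then obtain d where d: "0 < d" "\<And>x z. x \<in> cball 0 2 \<Longrightarrow> z \<in> cball 0 2 \<Longrightarrow> dist z x < d \<Longrightarrow> dist (h z) (h x) < e"
    unfolding uniformly_continuous_on_def using assms(2) by metis
  show ?thesis
  proof (rule that[of "min d 1"])
    show "dist (h z) (h x) < e" if "norm x < 1" "dist z x < min d 1" for x z
    proof (rule d(2))
      have "norm z \<le> norm x + dist z x" unfolding dist_norm by norm
      then show "z \<in> cball 0 2" using that by auto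
    qed (use that in auto)
  qed (use d in auto)
qed

text \<open>Convolution of \<open>f\<close> with a bump of small support. The derivative of the convolution falls on
  the bump, and integration by parts moves it to \<open>f\<close>; hence uniform continuity of \<open>f\<close> and of
  \<open>g\<close> controls both errors.\<close>
lemma approx_test_function:
  assumes f: "c1c f g" and e: "0 < e"
  obtains \<phi> where "test_function \<phi>" "\<And>x. norm x < 1 \<Longrightarrow> \<bar>\<phi> x - f x\<bar> \<le> e"
    "\<And>x i. norm x < 1 \<Longrightarrow> \<bar>partial_deriv i \<phi> x - g x $ i\<bar> \<le> e"
proof -
  obtain \<rho> where \<rho>: "0 < \<rho>" "\<rho> < 1" "\<And>x. \<rho> \<le> norm x \<Longrightarrow> f x = 0" "\<And>x. \<rho> \<le> norm x \<Longrightarrow> g x = 0"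
    using c1c_support[OF f] by blast
  have gc: "continuous_on UNIV g" using f by (simp add: c1c_def)
  obtain d1 where d1: "0 < d1" "\<And>x z. norm x < 1 \<Longrightarrow> dist z x < d1 \<Longrightarrow> dist (f z) (f x) < e"
    using unif_cont_disc[OF c1c_cont[OF f] e] by blast
  obtain d2 where d2: "0 < d2" "\<And>x z. norm x < 1 \<Longrightarrow> dist z x < d2 \<Longrightarrow> dist (g z) (g x) < e"
    using unif_cont_disc[OF gc e] by blast
  define d where "d = min ((1 - \<rho>) / 2) (min d1 d2)"
  have d: "0 < d" "d \<le> (1 - \<rho>) / 2" "d \<le> d1" "d \<le> d2" "d < 1" using d1(1) d2(1) \<rho>(1,2) by (auto simp: d_def min_def)
  let ?K = "cbox (- 2 *\<^sub>R One) (2 *\<^sub>R One) :: (real^2) set"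
  have bc: "continuous_on UNIV (bump d)" by (rule smoothD(3)[OF smooth_bump])
  \<comment> \<open>Normalising by this integral avoids computing the mass of the bump.\<close>
  define I where "I = (LINT x|disc. bump d x)"
  have shifted: "integral ?K (\<lambda>z. bump d (x - z)) = I" if "norm x < 1" for x
  proof -
    have "integral ?K (\<lambda>z. bump d (x - z)) = integral ?K (bump d \<circ> ((+) (- x)))"
      using bump_minus[of d] by (simp add: o_def) (metis minus_diff_eq)
    also have "\<dots> = integral (cbox (- 2 *\<^sub>R One + - x) (2 *\<^sub>R One + - x)) (bump d)"
      by (rule integral_shift_cbox_plus)
    also have "\<dots> = I" unfolding I_def
    proof (rule lint_disc_eq[symmetric, OF bc])
      show "unit_disc \<subseteq> cbox (- 2 *\<^sub>R One + - x) (2 *\<^sub>R One + - x)"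
      proof
        fix y :: "real^2" assume "y \<in> unit_disc"
        then show "y \<in> cbox (- 2 *\<^sub>R One + - x) (2 *\<^sub>R One + - x)"
          by (intro mem_shifted_cbox) (use that in auto)
      qed
    qed (use d bump_zero[of d] in auto)
    finally show ?thesis .
  qed
  have I: "0 < I"
  proof -
    have "I = integral ?K (bump d)" using shifted[of 0] bump_minus[of d] by simp
    moreover have "integral ?K (bump d) \<noteq> 0"
    proof
      assume "integral ?K (bump d) = 0"
      then have "\<forall>x\<in>?K. bump d x = 0"
        by (subst (asm) integral_cbox_eq_0_iff)
          (auto simp: bump_nonneg box_ne_empty intro: continuous_on_subset[OF bc])
      then have "bump d 0 = 0" using disc_sub[of 2] by force
      then show False using bump_pos[of 0 d] d by simp
    qed
    moreover have "0 \<le> integral ?K (bump d)"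
      by (intro integral_nonneg integrable_continuous continuous_on_subset[OF bc]) (auto simp: bump_nonneg)
    ultimately show ?thesis by simp
  qed
  define \<eta> where "\<eta> x = (1 / I) * bump d x" for x
  have eta: "smooth \<eta>" unfolding smooth_def \<eta>_def
    using smooth_bump[of d] unfolding smooth_def by (intro allI Ck_on_mult Ck_on_const) blast
  have etac: "continuous_on UNIV \<eta>" by (rule smoothD(3)[OF eta])
  have eta0: "\<eta> x = 0" if "d \<le> norm x" for x using bump_zero[OF _ that] d by (simp add: \<eta>_def)
  have eta1: "integral ?K (\<lambda>z. \<eta> (x - z)) = 1" if "norm x < 1" for x
    using shifted[OF that] I by (simp add: \<eta>_def)
  have approx: "\<bar>integral ?K (\<lambda>z. h z * \<eta> (x - z)) - h x\<bar> \<le> e"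
    if h: "continuous_on UNIV h" "\<And>z. dist z x < d \<Longrightarrow> \<bar>h z - h x\<bar> \<le> e" and x: "norm x < 1" for h :: "real^2 \<Rightarrow> real" and x
  proof -
    have ec: "continuous_on ?K (\<lambda>z. \<eta> (x - z))" by (intro continuous_on_compose2[OF etac] continuous_intros) auto
    have hc: "continuous_on ?K h" by (rule continuous_on_subset[OF h(1)]) simp
    have "integral ?K (\<lambda>z. h z * \<eta> (x - z)) - h x = integral ?K (\<lambda>z. h z * \<eta> (x - z)) - integral ?K (\<lambda>z. h x * \<eta> (x - z))"
      using eta1[OF x] by simp
    also have "\<dots> = integral ?K (\<lambda>z. h z * \<eta> (x - z) - h x * \<eta> (x - z))"
      by (intro integral_diff[symmetric] integrable_continuous continuous_intros ec hc)
    also have "\<bar>\<dots>\<bar> \<le> integral ?K (\<lambda>z. e * \<eta> (x - z))"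
      unfolding real_norm_def[symmetric]
    proof (rule Henstock_Kurzweil_Integration.integral_norm_bound_integral)
      fix z
      have "0 \<le> \<eta> (x - z)" using I bump_nonneg by (simp add: \<eta>_def)
      moreover have "\<bar>h z - h x\<bar> \<le> e \<or> \<eta> (x - z) = 0"
        using h(2)[of z] eta0[of "x - z"] by (cases "d \<le> norm (x - z)") (auto simp: dist_norm norm_minus_commute not_le)
      ultimately show "norm (h z * \<eta> (x - z) - h x * \<eta> (x - z)) \<le> e * \<eta> (x - z)"
        by (auto simp: left_diff_distrib[symmetric] abs_mult intro: mult_right_mono)
    qed (intro integrable_continuous continuous_intros ec hc)+
    also have "\<dots> = e" using eta1[OF x] by simp
    finally show ?thesis .
  qed
  define \<phi> where "\<phi> x = integral ?K (\<lambda>z. f z * \<eta> (x - z))" for x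
  have Ck: "Ck_on k \<phi> UNIV" for k
    unfolding \<phi>_def by (rule smooth_convolution(1)[OF f eta])
  have supp: "\<phi> x = 0" if "(1 + \<rho>) / 2 \<le> norm x" for x
  proof -
    have "f z * \<eta> (x - z) = 0" for z
    proof (cases "\<rho> \<le> norm z")
      case False
      have "norm x \<le> norm z + norm (x - z)" by norm
      then have "d \<le> norm (x - z)" using False that d(2) by (simp add: field_simps)
      then show ?thesis by (simp add: eta0)
    qed (simp add: \<rho>)
    then have "(\<lambda>z. f z * \<eta> (x - z)) = (\<lambda>z. 0)" by (rule ext)
    then show ?thesis unfolding \<phi>_def by simp
  qed
  have cl: "closure {x. \<phi> x \<noteq> 0} \<subseteq> cball 0 ((1 + \<rho>) / 2)"
  proof (rule closure_minimal)
    show "{x. \<phi> x \<noteq> 0} \<subseteq> cball 0 ((1 + \<rho>) / 2)"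
    proof
      fix x assume "x \<in> {x. \<phi> x \<noteq> 0}"
      then have "\<not> (1 + \<rho>) / 2 \<le> norm x" using supp by blast
      then show "x \<in> cball 0 ((1 + \<rho>) / 2)" by (simp add: not_le less_imp_le)
    qed
  qed auto
  have test: "test_function \<phi>"
    unfolding test_function_def
  proof (intro conjI allI Ck)
    show "compact (closure {x. \<phi> x \<noteq> 0})" unfolding compact_eq_bounded_closed
      using bounded_subset[OF bounded_cball cl] closed_closure by blast
    show "closure {x. \<phi> x \<noteq> 0} \<subseteq> unit_disc" using cl \<rho> by (auto dest!: subsetD)
  qed
  \<comment> \<open>Integration by parts moves the derivative from the mollifier to \<open>f\<close>.\<close>
  have pd: "partial_deriv i \<phi> x = integral ?K (\<lambda>z. g z $ i * \<eta> (x - z))" for i x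
  proof -
    have gec: "continuous_on UNIV (\<lambda>z. gradient \<eta> (x - z))"
      by (intro continuous_on_compose2[OF smoothD(4)[OF eta]] continuous_intros) auto
    have "((\<lambda>z. \<eta> (x - z)) has_derivative (\<lambda>h. (- gradient \<eta> (x - z)) \<bullet> h)) (at z)" for z
    proof -
      have "((\<lambda>z. x - z) has_derivative (\<lambda>h. - h)) (at z)" by (auto intro!: derivative_eq_intros)
      from has_derivative_compose[OF this smoothD(1)[OF eta]] show ?thesis by simp
    qed
    then have "(LINT z|disc. f z * (- gradient \<eta> (x - z)) $ i) = - (LINT z|disc. g z $ i * \<eta> (x - z))"
      by (rule int_by_parts[OF f]) (intro continuous_intros gec)
    also have "(LINT z|disc. f z * (- gradient \<eta> (x - z)) $ i) = integral ?K (\<lambda>z. f z * (- gradient \<eta> (x - z)) $ i)"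
      by (rule lint_disc_eq) (use \<rho> disc_sub[of 2] in \<open>auto intro!: continuous_intros c1c_cont[OF f] gec simp del: gradient_nth\<close>)
    also have "(LINT z|disc. g z $ i * \<eta> (x - z)) = integral ?K (\<lambda>z. g z $ i * \<eta> (x - z))"
      by (rule lint_disc_eq) (use \<rho> disc_sub[of 2] in \<open>auto intro!: continuous_intros gc continuous_on_compose2[OF etac]\<close>)
    finally show ?thesis
      using smooth_convolution(2)[OF f eta, of i] unfolding \<phi>_def by simp
  qed
  show ?thesis
  proof (rule that[OF test])
    show "\<bar>\<phi> x - f x\<bar> \<le> e" if "norm x < 1" for x
      unfolding \<phi>_def
    proof (rule approx[OF c1c_cont[OF f] _ that])
      show "\<bar>f z - f x\<bar> \<le> e" if "dist z x < d" for z
        using d1(2)[OF \<open>norm x < 1\<close>, of z] that d(3) by (simp add: dist_real_def)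
    qed
    show "\<bar>partial_deriv i \<phi> x - g x $ i\<bar> \<le> e" if "norm x < 1" for x i
      unfolding pd
    proof (rule approx[OF _ _ that])
      show "\<bar>g z $ i - g x $ i\<bar> \<le> e" if "dist z x < d" for z
        using d2(2)[OF \<open>norm x < 1\<close>, of z] that d component_le_norm_cart[of "g z - g x" i]
        by (simp add: dist_norm)
    qed (intro continuous_intros gc)
  qed
qed

lemma test_function_c1c:
  assumes "test_function \<phi>"
  shows "c1c \<phi> (gradient \<phi>)"
proof -
  have s: "smooth \<phi>" using assms by (auto simp: test_function_def smooth_def)
  let ?S = "closure {x. \<phi> x \<noteq> 0}"
  have S: "compact ?S" "?S \<subseteq> unit_disc" using assms by (auto simp: test_function_def)
  have "\<exists>\<rho><1. \<forall>x\<in>?S. norm x \<le> \<rho>"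
  proof (cases "?S = {}")
    case False
    obtain y where "y \<in> ?S" "\<And>x. x \<in> ?S \<Longrightarrow> norm x \<le> norm y"
      using continuous_attains_sup[OF S(1) False continuous_on_norm_id] by blast
    then show ?thesis using S(2) by (intro exI[of _ "norm y"]) auto
  qed (auto intro: exI[of _ 0])
  then obtain \<rho> where \<rho>: "\<rho> < 1" "\<And>x. x \<in> ?S \<Longrightarrow> norm x \<le> \<rho>" by blast
  show ?thesis
  proof (rule c1cI[OF smoothD(1)[OF s] smoothD(4)[OF s], of "(1 + \<rho>) / 2"])
    show "\<phi> x = 0" if "(1 + \<rho>) / 2 \<le> norm x" for x
      using \<rho> that closure_subset[of "{x. \<phi> x \<noteq> 0}"] by fastforce
  qed (use \<rho> in auto)
qed

section \<open>Weak gradients and the space H10\<close>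

lemma norm2_sq: "(norm (v::real^2))\<^sup>2 = (v $ 1)\<^sup>2 + (v $ 2)\<^sup>2"
  by (simp only: power2_norm_eq_inner inner_vec_def sum_2) (simp add: power2_eq_square)

lemma in_L2_measurable [measurable_dest]: "in_L2 f \<Longrightarrow> f \<in> borel_measurable disc"
  by (simp add: in_L2_def)

lemma in_L2_integrable_mult:
  assumes "in_L2 f" "in_L2 g"
  shows "integrable disc (\<lambda>x. f x * g x)"
proof (rule Bochner_Integration.integrable_bound)
  show "integrable disc (\<lambda>x. (f x)\<^sup>2 + (g x)\<^sup>2)"
    using assms by (simp add: in_L2_def)
  show "(\<lambda>x. f x * g x) \<in> borel_measurable disc"
    using assms by (auto simp: in_L2_def)
  have "\<bar>a * b\<bar> \<le> a\<^sup>2 + b\<^sup>2" for a b :: real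
    using sum_squares_bound[of "\<bar>a\<bar>" "\<bar>b\<bar>"] mult_nonneg_nonneg[of "\<bar>a\<bar>" "\<bar>b\<bar>"]
    unfolding abs_mult by (simp only: power2_abs) linarith
  then show "AE x in disc. norm (f x * g x) \<le> norm ((f x)\<^sup>2 + (g x)\<^sup>2)"
    by (auto simp: abs_mult)
qed

lemma in_L2_cmult: "in_L2 f \<Longrightarrow> in_L2 (\<lambda>x. c * f x)"
  by (auto simp: in_L2_def power_mult_distrib)

lemma in_L2_add:
  assumes "in_L2 f" "in_L2 g"
  shows "in_L2 (\<lambda>x. f x + g x)"
  unfolding in_L2_def power2_sum
  using assms in_L2_integrable_mult[OF assms] by (auto simp: in_L2_def mult.assoc)

lemma in_L2_zero: "in_L2 (\<lambda>x. 0)" by (simp add: in_L2_def)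

lemma in_L2_sum: "(\<And>j. j \<in> J \<Longrightarrow> in_L2 (f j)) \<Longrightarrow> in_L2 (\<lambda>x. \<Sum>j\<in>J. c j * f j x)"
proof (induction J rule: infinite_finite_induct)
  case (insert a J)
  then show ?case using in_L2_add[OF in_L2_cmult] by simp
qed (auto simp: in_L2_zero)

lemma in_L2_diff: "in_L2 f \<Longrightarrow> in_L2 g \<Longrightarrow> in_L2 (\<lambda>x. f x - g x)"
  using in_L2_add[of f "\<lambda>x. - 1 * g x"] in_L2_cmult[of g "-1"] by simp

lemma in_L2_continuous: "continuous_on UNIV f \<Longrightarrow> in_L2 f"
  unfolding in_L2_def
  by (auto intro!: meas_disc integrable_disc continuous_intros continuous_on_subset[of UNIV f])

lemma in_L2_integrable: "in_L2 f \<Longrightarrow> integrable disc f"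
  using in_L2_integrable_mult[of f "\<lambda>x. 1"] in_L2_continuous[of "\<lambda>x. 1"] by simp

text \<open>As \<open>k\<close> tends to infinity, these test functions increase to the indicator of the open box
  between \<open>c\<close> and \<open>d\<close>.\<close>
definition box_bump :: "real^2 \<Rightarrow> real^2 \<Rightarrow> real \<Rightarrow> real^2 \<Rightarrow> real" where
  "box_bump c d k x = (flat 0 (k * (x $ 1 - c $ 1)) * flat 0 (k * (d $ 1 - x $ 1))) *
     (flat 0 (k * (x $ 2 - c $ 2)) * flat 0 (k * (d $ 2 - x $ 2)))"

lemma flat_bounds: "0 \<le> flat 0 t" "flat 0 t \<le> 1"
  by (auto simp: flat_def)

lemma box_bump_bounds: "0 \<le> box_bump c d k x" "box_bump c d k x \<le> 1"
  unfolding box_bump_def by (auto intro!: mult_nonneg_nonneg mult_le_one flat_bounds)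

lemma smooth_box_bump: "smooth (box_bump c d k)"
proof -
  have "smooth (\<lambda>x. k * (x $ i + - b))" "smooth (\<lambda>x. k * (b + (- 1) * x $ i))" for b i
    unfolding smooth_def by (intro allI Ck_on_mult Ck_on_add Ck_on_const Ck_on_coord)+
  then have "Ck_on m (\<lambda>x. flat 0 (k * (x $ i - b))) UNIV" "Ck_on m (\<lambda>x. flat 0 (k * (b - x $ i))) UNIV" for m b i
    using Ck_on_flat by simp_all
  then show ?thesis unfolding smooth_def box_bump_def by (intro allI Ck_on_mult)
qed

lemma box_bump_zero: "0 < k \<Longrightarrow> x \<notin> box c d \<Longrightarrow> box_bump c d k x = 0"
  by (auto simp: box_bump_def flat_def mem_box_cart forall_2 zero_less_mult_iff)

lemma test_box_bump:
  assumes "cbox c d \<subseteq> unit_disc" "0 < k"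
  shows "test_function (box_bump c d k)"
proof -
  have "{x. box_bump c d k x \<noteq> 0} \<subseteq> cbox c d"
    using box_bump_zero[OF assms(2)] box_subset_cbox by blast
  then have cl: "closure {x. box_bump c d k x \<noteq> 0} \<subseteq> cbox c d" by (intro closure_minimal) auto
  then have "compact (closure {x. box_bump c d k x \<noteq> 0})"
    unfolding compact_eq_bounded_closed using bounded_subset[OF bounded_cbox cl] closed_closure by blast
  then show ?thesis
    using cl assms smooth_box_bump unfolding test_function_def smooth_def by blast
qed

lemma flat_tendsto_1: "0 < t \<Longrightarrow> (\<lambda>n. flat 0 (real (Suc n) * t)) \<longlonglongrightarrow> 1"
proof -
  assume t: "0 < t"
  have "(\<lambda>n. exp (- (inverse (real (Suc n)) * inverse t))) \<longlonglongrightarrow> exp (- (0 * inverse t))"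
    by (intro tendsto_intros LIMSEQ_inverse_real_of_nat)
  then show ?thesis using t by (simp add: flat_def)
qed

lemma box_bump_tendsto:
  "(\<lambda>n. box_bump c d (real (Suc n)) x) \<longlonglongrightarrow> indicator (box c d) x"
proof (cases "x \<in> box c d")
  case True
  then have "0 < x $ i - c $ i" "0 < d $ i - x $ i" for i by (auto simp: mem_box_cart)
  then have "(\<lambda>n. box_bump c d (real (Suc n)) x) \<longlonglongrightarrow> (1 * 1) * (1 * 1)"
    unfolding box_bump_def by (intro tendsto_mult flat_tendsto_1)
  with True show ?thesis by simp
next
  case False
  then have "box_bump c d (real (Suc n)) x = 0" for n by (intro box_bump_zero) auto
  with False show ?thesis by simp
qed

text \<open>The fundamental lemma of the calculus of variations. Testing with \<open>box_bump\<close> shows that the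
  integral of \<open>h\<close> over every box in the disc vanishes; by Lebesgue's differentiation theorem
  \<open>h\<close> vanishes almost everywhere.\<close>
lemma weak_zero:
  assumes h: "in_L2 h" and z: "\<And>\<phi>. test_function \<phi> \<Longrightarrow> (LINT x|disc. h x * \<phi> x) = 0"
  shows "AE x in disc. h x = 0"
proof -
  define H where "H x = (if x \<in> unit_disc then h x else 0)" for x
  have ih: "integrable disc h" by (rule in_L2_integrable[OF h])
  have "integrable lebesgue (\<lambda>x. indicator unit_disc x *\<^sub>R h x)"
    using ih by (simp add: integrable_restrict_space)
  moreover have "(\<lambda>x. indicator unit_disc x *\<^sub>R h x) = H" by (auto simp: H_def indicator_def)
  ultimately have iH: "integrable lebesgue H" by simp
  then have "H absolutely_integrable_on UNIV" by (simp add: set_integrable_def)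
  then have iHc: "H integrable_on cbox a b" for a b
    by (meson absolutely_integrable_on_def absolutely_integrable_on_subcbox subset_UNIV set_lebesgue_integral_eq_integral(1))
  have box0: "integral (cbox c d) H = 0" if cd: "cbox c d \<subseteq> unit_disc" for c d
  proof -
    have "(\<lambda>n. LINT x|disc. h x * box_bump c d (real (Suc n)) x) \<longlonglongrightarrow> (LINT x|disc. h x * indicator (box c d) x)"
    proof (rule integral_dominated_convergence[where w="\<lambda>x. \<bar>h x\<bar>"])
      show "(\<lambda>x. h x * indicator (box c d) x) \<in> borel_measurable disc"
      proof (rule borel_measurable_times[OF in_L2_measurable[OF h]])
        have "indicator (box c d) \<in> borel_measurable (lebesgue :: (real^2) measure)"
          by (rule borel_measurable_indicator) simp
        then show "indicator (box c d) \<in> borel_measurable disc" by (rule measurable_restrict_space1)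
      qed
      show "(\<lambda>x. h x * box_bump c d (real (Suc n)) x) \<in> borel_measurable disc" for n
        by (rule borel_measurable_times[OF in_L2_measurable[OF h]
              meas_disc[OF continuous_on_subset[OF smoothD(3)[OF smooth_box_bump] subset_UNIV]]])
      show "integrable disc (\<lambda>x. \<bar>h x\<bar>)" using ih by simp
      show "AE x in disc. (\<lambda>n. h x * box_bump c d (real (Suc n)) x) \<longlonglongrightarrow> h x * indicator (box c d) x"
        by (intro AE_I2 tendsto_mult_left box_bump_tendsto)
      show "AE x in disc. norm (h x * box_bump c d (real (Suc n)) x) \<le> \<bar>h x\<bar>" for n
        using box_bump_bounds by (auto simp: abs_mult mult_left_le)
    qed
    moreover have "(LINT x|disc. h x * box_bump c d (real (Suc n)) x) = 0" for n
      by (rule z[OF test_box_bump[OF cd]]) simp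
    ultimately have 0: "(LINT x|disc. h x * indicator (box c d) x) = 0"
      by (simp only: LIMSEQ_const_iff)
    have "(LINT x|disc. h x * indicator (box c d) x) = (LINT x|lebesgue. indicator unit_disc x *\<^sub>R (h x * indicator (box c d) x))"
      by (rule integral_restrict_space) simp
    also have "\<dots> = (LINT x:box c d|lebesgue. H x)"
      unfolding set_lebesgue_integral_def
      by (rule Bochner_Integration.integral_cong) (auto simp: H_def indicator_def)
    also have "\<dots> = integral (box c d) H"
      by (rule set_lebesgue_integral_eq_integral)
        (rule set_integrable_subset[of _ UNIV], use iH in \<open>auto simp: set_integrable_def\<close>)
    also have "\<dots> = integral (cbox c d) H" by (rule integral_open_interval)
    finally show ?thesis using 0 by simp
  qed
  obtain N where N: "negligible N" "\<And>x e. \<lbrakk>x \<notin> N; 0 < e\<rbrakk> \<Longrightarrow> \<exists>d>0. \<forall>h. 0 < h \<and> h < d \<longrightarrow>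
      norm (integral (cbox x (x + h *\<^sub>R One)) H /\<^sub>R h ^ DIM(real^2) - H x) < e"
    using integrable_ccontinuous_explicit[OF iHc] by blast
  have "h x = 0" if x: "x \<in> unit_disc" "x \<notin> N" for x
  proof (rule ccontr)
    assume "h x \<noteq> 0"
    then have "0 < \<bar>H x\<bar>" using x by (simp add: H_def)
    from N(2)[OF x(2) this] obtain d where d: "d > 0"
      "\<And>t. 0 < t \<Longrightarrow> t < d \<Longrightarrow> norm (integral (cbox x (x + t *\<^sub>R One)) H /\<^sub>R t ^ DIM(real^2) - H x) < \<bar>H x\<bar>"
      by blast
    \<comment> \<open>A side length for which the box at \<open>x\<close> stays in the disc.\<close>
    define t where "t = min (d / 2) ((1 - norm x) / 4)"
    have t: "0 < t" "t < d" "2 * t < 1 - norm x" using d(1) x(1) by (auto simp: t_def min_def)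
    have "cbox x (x + t *\<^sub>R One) \<subseteq> unit_disc"
    proof
      fix y assume "y \<in> cbox x (x + t *\<^sub>R One)"
      then have "\<bar>(y - x) \<bullet> b\<bar> \<le> t" if "b \<in> Basis" for b
        using that by (auto simp: mem_box inner_diff_left inner_add_left)
      then have "norm (y - x) \<le> (\<Sum>b\<in>(Basis::(real^2) set). t)"
        by (intro order_trans[OF norm_le_l1] sum_mono) auto
      then have "norm (y - x) \<le> 2 * t" by simp
      moreover have "norm y \<le> norm x + norm (y - x)" by norm
      ultimately show "y \<in> unit_disc" using t by simp
    qed
    from box0[OF this] d(2)[OF t(1,2)] show False by simp
  qed
  moreover have "N \<in> null_sets lebesgue" using N(1) negligible_iff_null_sets by blast
  ultimately show ?thesis
    by (subst AE_restrict_space_iff) (auto intro!: AE_I'[of N])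
qed

lemma weak_gradient_unique:
  assumes "has_weak_gradient w g" "has_weak_gradient w g'"
  shows "AE x in disc. g x = g' x"
proof -
  have "AE x in disc. g x $ i - g' x $ i = 0" for i
  proof (rule weak_zero)
    have L: "in_L2 (\<lambda>x. g x $ i)" "in_L2 (\<lambda>x. g' x $ i)" using assms by (auto simp: has_weak_gradient_def)
    then show "in_L2 (\<lambda>x. g x $ i - g' x $ i)" by (rule in_L2_diff)
    fix \<phi> assume \<phi>: "test_function \<phi>"
    then have "in_L2 \<phi>" by (intro in_L2_continuous c1c_cont[OF test_function_c1c])
    then show "(LINT x|disc. (g x $ i - g' x $ i) * \<phi> x) = 0"
      using assms \<phi> L in_L2_integrable_mult unfolding has_weak_gradient_def
      by (simp add: left_diff_distrib)
  qed
  then have "AE x in disc. \<forall>i\<in>UNIV. g x $ i - g' x $ i = 0" by (subst AE_finite_all) auto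
  then show ?thesis by (rule AE_mp) (auto simp: vec_eq_iff)
qed

lemma c1c_weak_gradient:
  assumes f: "c1c f g"
  shows "has_weak_gradient f g"
  unfolding has_weak_gradient_def
proof (intro conjI allI impI)
  show "in_L2 (\<lambda>x. g x $ i)" for i
    using f by (intro in_L2_continuous continuous_intros) (simp add: c1c_def)
  fix \<phi> i assume "test_function \<phi>"
  then have \<phi>: "c1c \<phi> (gradient \<phi>)" by (rule test_function_c1c)
  show "(LINT x|disc. f x * partial_deriv i \<phi> x) = - (LINT x|disc. g x $ i * \<phi> x)"
    using int_by_parts[OF f, of \<phi> "gradient \<phi>"] \<phi> by (simp add: c1c_def)
qed

lemma c1c_in_L2: "c1c f g \<Longrightarrow> in_L2 f" "c1c f g \<Longrightarrow> in_L2 (\<lambda>x. g x $ i)"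
  using c1c_weak_gradient in_L2_continuous[OF c1c_cont] by (auto simp: has_weak_gradient_def)

lemma c1c_H1: "c1c f g \<Longrightarrow> f \<in> H1"
  unfolding H1_def using c1c_weak_gradient in_L2_continuous c1c_cont by blast

text \<open>The chosen weak gradient is one, so the preceding uniqueness makes integrals independent of the
  choice.\<close>
lemma has_weak_gradient_some: "has_weak_gradient w g \<Longrightarrow> has_weak_gradient w (weak_gradient w)"
  unfolding weak_gradient_def by (rule someI[of "has_weak_gradient w"])

lemma H1_weak_gradient: "w \<in> H1 \<Longrightarrow> has_weak_gradient w (weak_gradient w)"
  unfolding H1_def by (auto intro: has_weak_gradient_some)

lemma weak_gradient_eqI: "has_weak_gradient w g \<Longrightarrow> AE x in disc. weak_gradient w x = g x"
  by (rule weak_gradient_unique[OF has_weak_gradient_some])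

lemma has_weak_gradient_sum:
  assumes "finite J" "\<And>j. j \<in> J \<Longrightarrow> in_L2 (w j)" "\<And>j. j \<in> J \<Longrightarrow> has_weak_gradient (w j) (g j)"
  shows "has_weak_gradient (\<lambda>x. \<Sum>j\<in>J. c j * w j x) (\<lambda>x. \<Sum>j\<in>J. c j *\<^sub>R g j x)"
  unfolding has_weak_gradient_def
proof (intro conjI allI impI)
  show "in_L2 (\<lambda>x. (\<Sum>j\<in>J. c j *\<^sub>R g j x) $ i)" for i
    using assms(3) by (simp add: has_weak_gradient_def in_L2_sum)
  fix \<phi> i assume t: "test_function \<phi>"
  have \<phi>: "c1c \<phi> (gradient \<phi>)" by (rule test_function_c1c[OF t])
  have L: "in_L2 \<phi>" "in_L2 (partial_deriv i \<phi>)"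
  proof -
    show "in_L2 \<phi>" by (intro in_L2_continuous c1c_cont[OF \<phi>])
    have "in_L2 (\<lambda>x. gradient \<phi> x $ i)"
      using \<phi> by (intro in_L2_continuous continuous_intros) (simp add: c1c_def)
    then show "in_L2 (partial_deriv i \<phi>)" by (simp add: eta_contract_eq)
  qed
  have "(LINT x|disc. (\<Sum>j\<in>J. c j * w j x) * partial_deriv i \<phi> x) = (\<Sum>j\<in>J. c j * (LINT x|disc. w j x * partial_deriv i \<phi> x))"
    unfolding sum_distrib_right mult.assoc
    by (subst Bochner_Integration.integral_sum)
      (auto intro!: in_L2_integrable_mult assms L)
  also have "\<dots> = (\<Sum>j\<in>J. c j * - (LINT x|disc. g j x $ i * \<phi> x))"
    by (intro sum.cong) (use assms(3) t in \<open>auto simp: has_weak_gradient_def\<close>)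
  also have "\<dots> = - (LINT x|disc. (\<Sum>j\<in>J. c j * (g j x $ i)) * \<phi> x)"
    unfolding sum_distrib_right mult.assoc
    by (subst Bochner_Integration.integral_sum)
      (use assms(3) L in \<open>auto intro!: in_L2_integrable_mult simp: has_weak_gradient_def sum_negf\<close>)
  finally show "(LINT x|disc. (\<Sum>j\<in>J. c j * w j x) * partial_deriv i \<phi> x) = - (LINT x|disc. (\<Sum>j\<in>J. c j *\<^sub>R g j x) $ i * \<phi> x)"
    by simp
qed

lemma int_sq_norm_cong:
  assumes "AE x in disc. g x = g' x" "\<And>i. in_L2 (\<lambda>x. g x $ i)" "\<And>i. in_L2 (\<lambda>x. g' x $ i)"
  shows "(LINT x|disc. (norm (g x))\<^sup>2) = (LINT x|disc. (norm ((g' x)::real^2))\<^sup>2)"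
proof (rule integral_cong_AE)
  show "(\<lambda>x. (norm (g x))\<^sup>2) \<in> borel_measurable disc" "(\<lambda>x. (norm (g' x))\<^sup>2) \<in> borel_measurable disc"
    using assms(2,3)[THEN in_L2_measurable] unfolding norm2_sq by measurable
qed (use assms(1) in auto)

lemma int_weak_gradient:
  assumes "has_weak_gradient w g"
  shows "(LINT x|disc. (norm (weak_gradient w x))\<^sup>2) = (LINT x|disc. (norm (g x))\<^sup>2)"
proof (rule int_sq_norm_cong[OF weak_gradient_eqI[OF assms]])
  have "has_weak_gradient w (weak_gradient w)" by (rule has_weak_gradient_some[OF assms])
  then show "in_L2 (\<lambda>x. weak_gradient w x $ i)" for i by (simp add: has_weak_gradient_def)
  show "in_L2 (\<lambda>x. g x $ i)" for i using assms by (simp add: has_weak_gradient_def)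
qed

lemma henon_form_eq:
  assumes "has_weak_gradient w g"
  shows "henon_form p a u w = (LINT x|disc. (norm (g x))\<^sup>2)
     - p * (LINT x|disc. henon_weight a x * \<bar>u x\<bar> powr (p - 1) * (w x)\<^sup>2)"
  unfolding henon_form_def int_weak_gradient[OF assms] ..

text \<open>Mollification approximates a function uniformly together with its gradient, and the disc has
  finite measure.\<close>
lemma c1c_H10:
  assumes f: "c1c f g"
  shows "f \<in> H10"
  unfolding H10_def
proof (intro CollectI conjI allI impI c1c_H1[OF f])
  fix e :: real assume e: "0 < e"
  define A where "A = measure disc (space disc)"
  \<comment> \<open>The function and the two components of its gradient contribute at most \<open>A * d^2\<close> each.\<close>
  define d where "d = e / sqrt (3 * A + 1)"
  have A: "0 \<le> A" by (simp add: A_def)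
  have d: "0 < d" using e A by (simp add: d_def)
  obtain \<phi> where \<phi>: "test_function \<phi>" "\<And>x. norm x < 1 \<Longrightarrow> \<bar>\<phi> x - f x\<bar> \<le> d"
    "\<And>x i. norm x < 1 \<Longrightarrow> \<bar>partial_deriv i \<phi> x - g x $ i\<bar> \<le> d"
    using approx_test_function[OF f d] by blast
  have D: "c1c (\<lambda>x. f x - \<phi> x) (\<lambda>x. g x - gradient \<phi> x)"
    by (rule c1c_diff[OF f test_function_c1c[OF \<phi>(1)]])
  have fm: "finite_measure disc" by (rule finite_measure_disc)
  have const: "integrable disc (\<lambda>x. c::real)" "(LINT x|disc. c) = c * A" for c
    using finite_measure.integrable_const[OF fm] by (auto simp: A_def)
  have sq: "y\<^sup>2 \<le> d\<^sup>2" if "\<bar>y\<bar> \<le> d" for y :: real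
    using that power_mono[of "\<bar>y\<bar>" d 2] by simp
  have 1: "(LINT x|disc. (f x - \<phi> x)\<^sup>2) \<le> d\<^sup>2 * A"
    unfolding const(2)[symmetric]
  proof (rule integral_mono)
    show "integrable disc (\<lambda>x. (f x - \<phi> x)\<^sup>2)"
      using in_L2_continuous[OF c1c_cont[OF D]] by (simp add: in_L2_def)
  qed (use \<phi>(2) in \<open>auto intro!: sq const simp: abs_minus_commute\<close>)
  have gL: "in_L2 (\<lambda>x. (g x - gradient \<phi> x) $ i)" for i
    using c1c_weak_gradient[OF D] by (simp add: has_weak_gradient_def del: vector_minus_component)
  have 2: "(LINT x|disc. (norm (g x - gradient \<phi> x))\<^sup>2) \<le> (2 * d\<^sup>2) * A"
    unfolding const(2)[symmetric]
  proof (rule integral_mono)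
    show "integrable disc (\<lambda>x. (norm (g x - gradient \<phi> x))\<^sup>2)"
      unfolding norm2_sq using gL by (simp add: in_L2_def del: vector_minus_component)
    fix x assume "x \<in> space disc"
    then have "\<bar>(g x - gradient \<phi> x) $ i\<bar> \<le> d" for i using \<phi>(3)[of x i] by (simp add: abs_minus_commute)
    from sq[OF this[of 1]] sq[OF this[of 2]] show "(norm (g x - gradient \<phi> x))\<^sup>2 \<le> 2 * d\<^sup>2"
      unfolding norm2_sq by simp
  qed (rule const)
  have "(LINT x|disc. (f x - \<phi> x)\<^sup>2) + (LINT x|disc. (norm (g x - gradient \<phi> x))\<^sup>2) \<le> 3 * A * d\<^sup>2"
    using 1 2 by (simp add: algebra_simps)
  also have "\<dots> < (3 * A + 1) * d\<^sup>2" using d by (simp add: algebra_simps)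
  also have "\<dots> = e\<^sup>2" using A by (simp add: d_def power_divide)
  finally have "H1_norm (\<lambda>x. f x - \<phi> x) < e"
    unfolding H1_norm_def int_weak_gradient[OF c1c_weak_gradient[OF D]]
    using e by (simp add: real_less_lsqrt)
  then show "\<exists>\<phi>. test_function \<phi> \<and> H1_norm (\<lambda>x. f x - \<phi> x) < e" using \<phi>(1) by blast
qed

section \<open>Negative definite subspaces\<close>

lemma sum_fun_apply: "(\<Sum>j\<in>J. F j) x = (\<Sum>j\<in>J. F j (x::'a) :: real)"
  by (induction J rule: infinite_finite_induct) (auto simp: zero_fun_def plus_fun_def)

text \<open>The quadratic form with an explicitly given gradient \<open>g\<close> of \<open>f\<close> and a general weight \<open>W\<close>,
  free of the choice of a weak gradient.\<close>
definition qform :: "real \<Rightarrow> (real^2 \<Rightarrow> real) \<Rightarrow> (real^2 \<Rightarrow> real) \<Rightarrow> (real^2 \<Rightarrow> real^2) \<Rightarrow> real" where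
  "qform p W f g = (LINT x|disc. (norm (g x))\<^sup>2) - p * (LINT x|disc. W x * (f x)\<^sup>2)"

definition potential :: "real \<Rightarrow> real \<Rightarrow> (real^2 \<Rightarrow> real) \<Rightarrow> real^2 \<Rightarrow> real" where
  "potential p a u x = henon_weight a x * \<bar>u x\<bar> powr (p - 1)"

lemma henon_form_qform: "has_weak_gradient w g \<Longrightarrow> henon_form p a u w = qform p (potential p a u) w g"
  by (simp add: henon_form_eq qform_def potential_def)

text \<open>Functions on whose linear combinations the form is negative are linearly independent, because
  the form vanishes at \<open>0\<close>.\<close>
lemma neg_def_lower:
  assumes f: "\<And>j. j < d \<Longrightarrow> c1c (f j) (g j)" and X: "\<And>c. (\<lambda>x. \<Sum>j<d. c j * f j x) \<in> X"
    and neg: "\<And>c. \<exists>j<d. c j \<noteq> 0 \<Longrightarrow>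
      qform p (potential p a u) (\<lambda>x. \<Sum>j<d. c j * f j x) (\<lambda>x. \<Sum>j<d. c j *\<^sub>R g j x) < 0"
  shows "enat d \<le> max_neg_dim (henon_form p a u) X"
proof -
  let ?F = "\<lambda>c x. \<Sum>j<d. c j * f j x"
  let ?Q = "henon_form p a u"
  have Q: "?Q (?F c) < 0" if "\<exists>j<d. c j \<noteq> 0" for c
    using henon_form_qform[OF c1c_weak_gradient[OF c1c_sum[of "{..<d}" f g c]]] f neg[OF that] by simp
  have Q0: "?Q (\<lambda>x. 0) = 0"
  proof -
    have "c1c (\<lambda>x. 0) (\<lambda>x. 0)" by (rule c1cI[of _ _ 0]) auto
    from henon_form_qform[OF c1c_weak_gradient[OF this]] show ?thesis by (simp add: qform_def)
  qed
  have nz: "?F c \<noteq> (\<lambda>x. 0)" if "\<exists>j<d. c j \<noteq> 0" for c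
    using Q[OF that] Q0 by force
  have inj: "inj_on f {..<d}"
  proof (rule inj_onI, rule ccontr)
    fix i j assume ij: "i \<in> {..<d}" "j \<in> {..<d}" "f i = f j" "i \<noteq> j"
    let ?c = "\<lambda>k. (if k = i then 1 else 0) - (if k = j then 1 else (0::real))"
    have "?F ?c = (\<lambda>x. 0)" using ij by (simp add: left_diff_distrib sum_subtractf if_distrib[of "\<lambda>t. t * _"] cong: if_cong)
    moreover have "\<exists>k<d. ?c k \<noteq> 0" using ij by (intro exI[of _ i]) auto
    ultimately show False using nz[of ?c] by (rule_tac notE) blast+
  qed
  define V where "V = range ?F"
  have sub: "real_fun.subspace V"
  proof (rule real_fun.subspaceI)
    show "0 \<in> V" unfolding V_def by (rule range_eqI[of _ _ "\<lambda>j. 0"]) (auto simp: zero_fun_def)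
    show "x + y \<in> V" if xy: "x \<in> V" "y \<in> V" for x y
    proof -
      obtain c where "x = ?F c" using xy(1) unfolding V_def by blast
      moreover obtain c' where "y = ?F c'" using xy(2) unfolding V_def by blast
      ultimately have "x = ?F c" "y = ?F c'" by auto
      then show ?thesis unfolding V_def
        by (intro range_eqI[of _ _ "\<lambda>j. c j + c' j"]) (auto simp: plus_fun_def sum.distrib algebra_simps)
    qed
    show "(\<lambda>y. t * x y) \<in> V" if xV: "x \<in> V" for t x
    proof -
      obtain c where "x = ?F c" using xV unfolding V_def by blast
      then show ?thesis unfolding V_def
        by (intro range_eqI[of _ _ "\<lambda>j. t * c j"]) (auto simp: sum_distrib_left mult.assoc)
    qed
  qed
  have "neg_def_subspace ?Q X V"
    unfolding neg_def_subspace_def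
  proof (intro conjI ballI impI sub)
    show "V \<subseteq> X" using X by (auto simp: V_def)
    fix w assume "w \<in> V" "w \<noteq> 0"
    then obtain c where c: "w = ?F c" unfolding V_def by blast
    have "\<exists>j<d. c j \<noteq> 0"
    proof (rule ccontr)
      assume "\<not> (\<exists>j<d. c j \<noteq> 0)"
      then have "w = 0" unfolding c by (auto simp: zero_fun_def)
      with \<open>w \<noteq> 0\<close> show False ..
    qed
    from Q[OF this] show "?Q w < 0" by (simp add: c)
  qed
  moreover have "real_fun.dim V = d"
  proof (rule real_fun.dim_unique)
    let ?B = "f ` {..<d}"
    have rep: "(\<Sum>v\<in>?B. (\<lambda>x. r v * v x)) = ?F (r \<circ> f)" for r
      by (rule ext) (simp add: sum_fun_apply sum.reindex[OF inj])
    show "?B \<subseteq> V"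
    proof
      fix v assume "v \<in> ?B"
      then obtain i where i: "i < d" "v = f i" by auto
      have "v = ?F (\<lambda>j. if j = i then 1 else 0)"
        using i by (simp add: if_distrib[of "\<lambda>t. t * _"] cong: if_cong)
      then show "v \<in> V" unfolding V_def by (rule range_eqI[of v ?F "\<lambda>j. if j = i then 1 else 0"])
    qed
    show "V \<subseteq> real_fun.span ?B"
    proof
      fix v assume "v \<in> V"
      then obtain c where c: "v = ?F c" unfolding V_def by blast
      have "?F c = (\<Sum>j<d. (\<lambda>x. c j * f j x))" by (rule ext) (simp add: sum_fun_apply)
      also have "\<dots> \<in> real_fun.span ?B"
        by (intro real_fun.span_sum real_fun.span_scale real_fun.span_base) auto
      finally show "v \<in> real_fun.span ?B" using c by simp
    qed
    show "real_fun.independent ?B"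
    proof (rule real_fun.independent_if_scalars_zero)
      fix r v assume s: "(\<Sum>v\<in>?B. (\<lambda>x. r v * v x)) = 0" and v: "v \<in> ?B"
      show "r v = 0"
      proof (rule ccontr)
        assume "r v \<noteq> 0"
        then have "\<exists>j<d. (r \<circ> f) j \<noteq> 0" using v by auto
        from nz[OF this] s show False unfolding rep by (simp add: zero_fun_def)
      qed
    qed simp
    show "card ?B = d" using inj by (simp add: card_image)
  qed
  ultimately show ?thesis
    unfolding max_neg_dim_def by (intro SUP_upper2[of V]) auto
qed

text \<open>Compactness of the unit sphere, here in the product topology: coefficient vectors are functions
  on the naturals that vanish from \<open>d\<close> on.\<close>
lemma neg_def_coercive:
  fixes b :: "nat \<Rightarrow> nat \<Rightarrow> real"
  assumes neg: "\<And>c. \<exists>j<d. c j \<noteq> 0 \<Longrightarrow> (\<Sum>i<d. \<Sum>j<d. c i * c j * b i j) < 0"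
  obtains \<eta> where "0 < \<eta>" "\<And>c. (\<Sum>i<d. \<Sum>j<d. c i * c j * b i j) \<le> - \<eta> * (\<Sum>j<d. (c j)\<^sup>2)"
proof (cases "d = 0")
  case True
  then show ?thesis using that[of 1] by simp
next
  case False
  let ?q = "\<lambda>c. \<Sum>i<d. \<Sum>j<d. c i * c j * b i j"
  let ?n = "\<lambda>c. \<Sum>j<d. (c j)\<^sup>2 :: real"
  define S where "S = {c :: nat \<Rightarrow> real. (\<forall>j\<in>{d..}. c j = 0) \<and> ?n c = 1}"
  have cq: "continuous_on UNIV ?q" and cn: "continuous_on UNIV ?n"
    by (intro continuous_intros continuous_on_product_coordinates)+
  have "closed S"
  proof -
    have "S = (\<Inter>j\<in>{d..}. {c. c j = 0}) \<inter> {c. ?n c = 1}" by (auto simp: S_def)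
    moreover have "closed {c :: nat \<Rightarrow> real. c j = 0}" for j
      by (intro closed_Collect_eq continuous_intros continuous_on_product_coordinates)
    moreover have "closed {c. ?n c = 1}" by (intro closed_Collect_eq cn continuous_intros)
    ultimately show ?thesis by auto
  qed
  moreover have "compact (PiE UNIV (\<lambda>j::nat. {-1..1::real}))"
  proof -
    have "compactin (product_topology (\<lambda>j::nat. euclidean) UNIV) (PiE UNIV (\<lambda>j::nat. {-1..1::real}))"
      unfolding compactin_PiE by simp
    then show ?thesis by (simp add: euclidean_product_topology)
  qed
  moreover have "S \<subseteq> PiE UNIV (\<lambda>j::nat. {-1..1::real})"
  proof
    fix c assume c: "c \<in> S"
    have "\<bar>c j\<bar> \<le> 1" for j
    proof (cases "j < d")
      case True
      then have "(c j)\<^sup>2 \<le> ?n c" by (intro member_le_sum) auto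
      then show ?thesis using c by (simp add: S_def abs_square_le_1)
    qed (use c in \<open>auto simp: S_def\<close>)
    then show "c \<in> PiE UNIV (\<lambda>j::nat. {-1..1::real})" by (auto simp: abs_le_iff minus_le_iff)
  qed
  ultimately have "compact S" by (metis compact_Int_closed inf.absorb_iff2)
  moreover have "(\<lambda>j. if j = 0 then 1 else 0) \<in> S"
    using False by (auto simp: S_def if_distrib[of "\<lambda>t. t\<^sup>2"] cong: if_cong)
  ultimately obtain c0 where c0: "c0 \<in> S" "\<And>c. c \<in> S \<Longrightarrow> ?q c \<le> ?q c0"
    using continuous_attains_sup[of S ?q] continuous_on_subset[OF cq] by blast
  have "\<exists>j<d. c0 j \<noteq> 0"
  proof (rule ccontr)
    assume "\<not> ?thesis"
    then have "?n c0 = 0" by simp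
    then show False using c0 by (simp add: S_def)
  qed
  then have q0: "?q c0 < 0" by (rule neg)
  show ?thesis
  proof (rule that)
    show "0 < - ?q c0" using q0 by simp
    fix c
    show "?q c \<le> - (- ?q c0) * ?n c"
    proof (cases "?n c = 0")
      case True
      then have "c j = 0" if "j < d" for j
        using that by (simp add: sum_nonneg_eq_0_iff)
      then have "?q c = 0" by simp
      then show ?thesis using True by simp
    next
      case False
      define s where "s = sqrt (?n c)"
      have s: "0 < s" "s\<^sup>2 = ?n c" using False sum_nonneg[of "{..<d}" "\<lambda>j. (c j)\<^sup>2"] unfolding s_def by auto
      \<comment> \<open>Normalise and cut off to land on the sphere.\<close>
      define c' where "c' j = (if j < d then c j / s else 0)" for j
      have "?n c' = ?n c / s\<^sup>2" by (simp add: c'_def power_divide sum_divide_distrib)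
      then have "c' \<in> S" using s by (auto simp: S_def c'_def)
      moreover have "?q c' = ?q c / s\<^sup>2"
        by (simp add: c'_def sum_divide_distrib power2_eq_square)
      ultimately have "?q c / s\<^sup>2 \<le> ?q c0" using c0(2) by fastforce
      then have "?q c \<le> ?q c0 * s\<^sup>2" using s(1) by (simp add: pos_divide_le_eq)
      then show ?thesis unfolding s(2) by simp
    qed
  qed
qed

lemma sq_sum_bound: "(\<Sum>j<d. c j * y j)\<^sup>2 \<le> (\<Sum>j<d. (c j)\<^sup>2) * (\<Sum>j<d. (y j :: real)\<^sup>2)"
  using Cauchy_Schwarz_ineq_sum[of c y "{..<d}"] by simp

text \<open>Completing the square: the defects are \<open>(t x + (x - y))^2 / t\<close> and \<open>(t x - (x - y))^2 / t + 2
  (x - y)^2\<close>.\<close>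
lemma sq_perturb:
  fixes x y :: real
  assumes t: "0 < t" and a: "x\<^sup>2 \<le> a" and b: "(x - y)\<^sup>2 \<le> b"
  shows "y\<^sup>2 \<le> x\<^sup>2 + t * a + (1 + 1 / t) * b" "- y\<^sup>2 \<le> - x\<^sup>2 + t * a + (1 + 1 / t) * b"
proof -
  have m: "t * x\<^sup>2 \<le> t * a" "(1 + 1 / t) * (x - y)\<^sup>2 \<le> (1 + 1 / t) * b"
    using t a b by (auto intro!: mult_left_mono add_nonneg_nonneg)
  have "(1 + t) * x\<^sup>2 + (1 + 1 / t) * (x - y)\<^sup>2 - y\<^sup>2 = (t * x + (x - y))\<^sup>2 / t"
    using t by (simp add: field_simps power2_eq_square)
  moreover have "0 \<le> (t * x + (x - y))\<^sup>2 / t" using t by simp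
  ultimately have "y\<^sup>2 \<le> x\<^sup>2 + t * x\<^sup>2 + (1 + 1 / t) * (x - y)\<^sup>2" by (simp add: distrib_right)
  with m show "y\<^sup>2 \<le> x\<^sup>2 + t * a + (1 + 1 / t) * b" by linarith
  have "- x\<^sup>2 + t * x\<^sup>2 + (1 + 1 / t) * (x - y)\<^sup>2 + y\<^sup>2 = (t * x - (x - y))\<^sup>2 / t + 2 * (x - y)\<^sup>2"
    using t by (simp add: field_simps power2_eq_square)
  moreover have "0 \<le> (t * x - (x - y))\<^sup>2 / t" using t by simp
  ultimately have "- y\<^sup>2 \<le> - x\<^sup>2 + t * x\<^sup>2 + (1 + 1 / t) * (x - y)\<^sup>2"
    using zero_le_power2[of "x - y"] by linarith
  with m show "- y\<^sup>2 \<le> - x\<^sup>2 + t * a + (1 + 1 / t) * b" by linarith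
qed

lemma integrable_weight_mult:
  assumes W: "W \<in> borel_measurable disc" "\<And>x. x \<in> unit_disc \<Longrightarrow> \<bar>W x\<bar> \<le> M" and h: "integrable disc (h :: real^2 \<Rightarrow> real)"
  shows "integrable disc (\<lambda>x. W x * h x)"
proof (rule Bochner_Integration.integrable_bound)
  show "integrable disc (\<lambda>x. M * h x)" using h by simp
  show "(\<lambda>x. W x * h x) \<in> borel_measurable disc" using W(1) h by (intro borel_measurable_times) auto
  show "AE x in disc. norm (W x * h x) \<le> norm (M * h x)"
  proof (rule AE_I2)
    fix x assume "x \<in> space disc"
    then have "\<bar>W x\<bar> \<le> \<bar>M\<bar>" using W(2)[of x] by simp
    then show "norm (W x * h x) \<le> norm (M * h x)" by (simp add: abs_mult mult_right_mono)
  qed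
qed

lemma in_L2_sq_integrable: "in_L2 f \<Longrightarrow> integrable disc (\<lambda>x. (f x)\<^sup>2)"
  by (simp add: in_L2_def)

lemma int_sq_norm_integrable:
  assumes "\<And>i. in_L2 (\<lambda>x. g x $ i)"
  shows "integrable disc (\<lambda>x. (norm ((g x)::real^2))\<^sup>2)"
  unfolding norm2_sq using assms by (simp add: in_L2_def)

text \<open>Under a single integral the form can be estimated pointwise.\<close>
lemma qform_integral:
  assumes W: "W \<in> borel_measurable disc" "\<And>x. x \<in> unit_disc \<Longrightarrow> \<bar>W x\<bar> \<le> M"
    and f: "in_L2 f" and g: "\<And>i. in_L2 (\<lambda>x. g x $ i)"
  shows "qform p W f g = (LINT x|disc. (norm (g x))\<^sup>2 - p * (W x * (f x)\<^sup>2))"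
    and "integrable disc (\<lambda>x. (norm (g x))\<^sup>2 - p * (W x * (f x)\<^sup>2))"
  unfolding qform_def
  using int_sq_norm_integrable[of g, OF g] integrable_weight_mult[OF W in_L2_sq_integrable[OF f]] by auto

text \<open>Replacing a basis of the subspace by nearby test functions changes the form by little, relative
  to the square of the coefficient vector; coercivity absorbs the error. The closeness in mean
  square of the test functions to the old basis is recorded because averaging over rotations will
  need it.\<close>
lemma approx_neg_def:
  assumes V: "neg_def_subspace (henon_form p a u) H10 V" and d: "real_fun.dim V = d" "0 < d"
    and p: "0 < p"
    and W: "potential p a u \<in> borel_measurable disc"
       "\<And>x. x \<in> unit_disc \<Longrightarrow> 0 \<le> potential p a u x \<and> potential p a u x \<le> M"
  obtains w \<eta> where "\<And>j. j < d \<Longrightarrow> w j \<in> V" "0 < \<eta>"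
    "\<And>\<epsilon>. 0 < \<epsilon> \<Longrightarrow> \<exists>\<phi>. (\<forall>j<d. test_function (\<phi> j) \<and> (LINT x|disc. (w j x - \<phi> j x)\<^sup>2) \<le> \<epsilon>) \<and>
       (\<forall>c. qform p (potential p a u) (\<lambda>x. \<Sum>j<d. c j * \<phi> j x) (\<lambda>x. \<Sum>j<d. c j *\<^sub>R gradient (\<phi> j) x)
          \<le> - \<eta> * (\<Sum>j<d. (c j)\<^sup>2))"
proof -
  let ?W = "potential p a u"
  have sub: "real_fun.subspace V" and VH: "V \<subseteq> H10" and negV: "\<And>w. w \<in> V \<Longrightarrow> w \<noteq> 0 \<Longrightarrow> henon_form p a u w < 0"
    using V by (auto simp: neg_def_subspace_def)
  have Wb: "\<bar>?W x\<bar> \<le> M" if "x \<in> unit_disc" for x using W(2)[OF that] by auto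
  have M: "0 \<le> M" using W(2)[of 0] by auto
  obtain B where B: "B \<subseteq> V" "real_fun.independent B" "V \<subseteq> real_fun.span B" "card B = d"
    using real_fun.basis_exists[of V] d(1) by metis
  have finB: "finite B" using B(4) d(2) card_ge_0_finite by force
  obtain w where w: "bij_betw w {..<d} B"
    using ex_bij_betw_nat_finite[OF finB] B(4) by (auto simp: atLeast0LessThan)
  have wV: "w j \<in> V" if "j < d" for j using w that B(1) by (auto simp: bij_betw_def)
  have wH1: "w j \<in> H1" if "j < d" for j using wV[OF that] VH by (auto simp: H10_def)
  define G where "G j = weak_gradient (w j)" for j
  have wg: "has_weak_gradient (w j) (G j)" if "j < d" for j
    unfolding G_def by (rule H1_weak_gradient[OF wH1[OF that]])
  have wL: "in_L2 (w j)" if "j < d" for j using wH1[OF that] by (simp add: H1_def)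
  have GL: "in_L2 (\<lambda>x. G j x $ i)" if "j < d" for j i using wg[OF that] by (simp add: has_weak_gradient_def)
  define wc where "wc c x = (\<Sum>j<d. c j * w j x)" for c x
  define Gc where "Gc c x = (\<Sum>j<d. c j *\<^sub>R G j x)" for c x
  have wcL: "in_L2 (wc c)" for c unfolding wc_def by (rule in_L2_sum) (use wL in auto)
  have GcL: "in_L2 (\<lambda>x. Gc c x $ i)" for c i
    unfolding Gc_def by (simp, rule in_L2_sum) (use GL in auto)
  have wgc: "has_weak_gradient (wc c) (Gc c)" for c
    unfolding wc_def Gc_def by (rule has_weak_gradient_sum) (use wL wg in auto)
  have qi: "qform p ?W (wc c) (Gc c) = (LINT x|disc. (norm (Gc c x))\<^sup>2 - p * (?W x * (wc c x)\<^sup>2))"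
    "integrable disc (\<lambda>x. (norm (Gc c x))\<^sup>2 - p * (?W x * (wc c x)\<^sup>2))" for c
    by (rule qform_integral[OF W(1) Wb wcL], assumption, rule GcL)+
  have wcs: "wc c = (\<Sum>j<d. (\<lambda>x. c j * w j x))" for c
    by (rule ext) (simp add: wc_def sum_fun_apply)
  have wcV: "wc c \<in> V" for c
    unfolding wcs by (intro real_fun.subspace_sum real_fun.subspace_scale sub wV) auto
  have wc0: "wc c \<noteq> 0" if c: "\<exists>j<d. c j \<noteq> 0" for c
  proof
    assume "wc c = 0"
    define r where "r v = c (the_inv_into {..<d} w v)" for v
    have inj: "inj_on w {..<d}" and im: "w ` {..<d} = B" using w by (auto simp: bij_betw_def)
    have rw: "r (w j) = c j" if "j < d" for j using the_inv_into_f_f[OF inj] that by (simp add: r_def)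
    have "(\<Sum>v\<in>B. (\<lambda>x. r v * v x)) = (\<Sum>j<d. (\<lambda>x. c j * w j x))"
      unfolding im[symmetric] sum.reindex[OF inj] by (rule sum.cong) (auto simp: rw)
    then have s: "(\<Sum>v\<in>B. (\<lambda>x. r v * v x)) = 0" using \<open>wc c = 0\<close> by (simp add: wcs)
    obtain j where j: "j < d" "c j \<noteq> 0" using c by blast
    have "w j \<in> B" "r (w j) \<noteq> 0" using j rw im by auto
    with s have "real_fun.dependent B" unfolding real_fun.dependent_finite[OF finB] by blast
    then show False using B(2) by simp
  qed
  define b where "b i j = (LINT x|disc. (G i x $ 1 * G j x $ 1 + G i x $ 2 * G j x $ 2) - p * (?W x * (w i x * w j x)))" for i j
  have qb: "qform p ?W (wc c) (Gc c) = (\<Sum>i<d. \<Sum>j<d. c i * c j * b i j)" for c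
  proof -
    have sq: "(\<Sum>j<d. c j * y j)\<^sup>2 = (\<Sum>i<d. \<Sum>j<d. c i * c j * (y i * y j))" for y
      unfolding power2_eq_square sum_product by (intro sum.cong refl) (simp add: algebra_simps)
    have pt: "(norm (Gc c x))\<^sup>2 - p * (?W x * (wc c x)\<^sup>2) =
        (\<Sum>i<d. \<Sum>j<d. c i * c j * ((G i x $ 1 * G j x $ 1 + G i x $ 2 * G j x $ 2) - p * (?W x * (w i x * w j x))))" for x
    proof -
      have "Gc c x $ k = (\<Sum>j<d. c j * G j x $ k)" for k by (simp add: Gc_def)
      then have "(norm (Gc c x))\<^sup>2 - p * (?W x * (wc c x)\<^sup>2) =
         (\<Sum>i<d. \<Sum>j<d. c i * c j * (G i x $ 1 * G j x $ 1)) + (\<Sum>i<d. \<Sum>j<d. c i * c j * (G i x $ 2 * G j x $ 2))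
         - (p * ?W x) * (\<Sum>i<d. \<Sum>j<d. c i * c j * (w i x * w j x))"
        unfolding norm2_sq wc_def by (simp only: sq mult.assoc)
      also have "\<dots> = (\<Sum>i<d. \<Sum>j<d. c i * c j * (G i x $ 1 * G j x $ 1) + c i * c j * (G i x $ 2 * G j x $ 2)
         - (p * ?W x) * (c i * c j * (w i x * w j x)))"
        by (simp only: sum_distrib_left sum.distrib sum_subtractf)
      finally show ?thesis by (simp add: algebra_simps)
    qed
    have int: "integrable disc (\<lambda>x. (G i x $ 1 * G j x $ 1 + G i x $ 2 * G j x $ 2) - p * (?W x * (w i x * w j x)))"
      if "i < d" "j < d" for i j
      by (intro Bochner_Integration.integrable_diff Bochner_Integration.integrable_add
          Bochner_Integration.integrable_mult_right integrable_weight_mult[OF W(1) Wb] in_L2_integrable_mult GL wL that)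
    let ?K = "\<lambda>i j x. (G i x $ 1 * G j x $ 1 + G i x $ 2 * G j x $ 2) - p * (?W x * (w i x * w j x))"
    have K: "integrable disc (\<lambda>x. c i * c j * ?K i j x)" if "i < d" "j < d" for i j
      by (rule Bochner_Integration.integrable_mult_right) (rule int[OF that])
    have "qform p ?W (wc c) (Gc c) = (LINT x|disc. (\<Sum>i<d. \<Sum>j<d. c i * c j * ?K i j x))"
      unfolding qi(1) pt ..
    also have "\<dots> = (\<Sum>i<d. LINT x|disc. (\<Sum>j<d. c i * c j * ?K i j x))"
      by (rule Bochner_Integration.integral_sum, rule Bochner_Integration.integrable_sum) (use K in auto)
    also have "\<dots> = (\<Sum>i<d. \<Sum>j<d. LINT x|disc. c i * c j * ?K i j x)"
      by (rule sum.cong[OF refl], rule Bochner_Integration.integral_sum) (use K in auto)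
    also have "\<dots> = (\<Sum>i<d. \<Sum>j<d. c i * c j * b i j)"
      unfolding b_def by (simp only: Bochner_Integration.integral_mult_right_zero)
    finally show ?thesis .
  qed
  have "(\<Sum>i<d. \<Sum>j<d. c i * c j * b i j) < 0" if "\<exists>j<d. c j \<noteq> 0" for c
    using negV[OF wcV wc0[OF that]] henon_form_qform[OF wgc] qb by simp
  then obtain \<eta> where \<eta>: "0 < \<eta>" "\<And>c. (\<Sum>i<d. \<Sum>j<d. c i * c j * b i j) \<le> - \<eta> * (\<Sum>j<d. (c j)\<^sup>2)"
    using neg_def_coercive[of d b] by blast
  define E where "E = (\<Sum>j<d. LINT x|disc. (norm (G j x))\<^sup>2 + p * M * (w j x)\<^sup>2)"
  have E0: "0 \<le> E" unfolding E_def
    by (intro sum_nonneg Bochner_Integration.integral_nonneg) (use p M in auto)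
  \<comment> \<open>Weight in Young's inequality: the multiple of the old energy that it costs uses up a quarter of \<open>\<eta>\<close>.\<close>
  define t where "t = \<eta> / (4 * (E + 1))"
  have t: "0 < t" "t * E \<le> \<eta> / 4"
    using \<eta>(1) E0 by (auto simp: t_def field_simps)
  show ?thesis
  proof (rule that[of w "\<eta> / 2", OF wV])
    show "0 < \<eta> / 2" using \<eta> by simp
    fix \<epsilon> :: real assume \<epsilon>: "0 < \<epsilon>"
    \<comment> \<open>Bound for the squared approximation errors; the factor from Young's inequality is compensated here.\<close>
    define m where "m = min \<epsilon> (\<eta> / (4 * (1 + 1 / t) * (1 + p * M) * (d + 1)))"
    have m: "0 < m" "m \<le> \<epsilon>" "(1 + 1 / t) * (d * ((1 + p * M) * m)) \<le> \<eta> / 4"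
    proof -
      have P: "0 < (1 + 1 / t)" "0 < 1 + p * M" using t p M by (auto intro: add_pos_nonneg)
      then show "0 < m" using \<epsilon> \<eta> by (simp add: m_def)
      show "m \<le> \<epsilon>" by (simp add: m_def)
      have "m \<le> \<eta> / (4 * (1 + 1 / t) * (1 + p * M) * (d + 1))" by (simp add: m_def)
      then have "4 * (1 + 1 / t) * (1 + p * M) * (d + 1) * m \<le> \<eta>"
        using P by (subst (asm) pos_le_divide_eq) (auto simp: mult.commute mult.assoc)
      moreover define y where "y = (1 + 1 / t) * ((1 + p * M) * m)"
      have "4 * (1 + 1 / t) * (1 + p * M) * (d + 1) * m = 4 * (d * y) + 4 * y"
        unfolding y_def by (simp only: distrib_left distrib_right mult_ac mult_1 of_nat_add of_nat_1)
      moreover have "0 \<le> y" using P \<open>0 < m\<close> unfolding y_def by simp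
      moreover have "(1 + 1 / t) * (d * ((1 + p * M) * m)) = d * y" unfolding y_def by (simp only: mult_ac)
      ultimately show "(1 + 1 / t) * (d * ((1 + p * M) * m)) \<le> \<eta> / 4" by linarith
    qed
    have "\<exists>\<phi>. test_function \<phi> \<and> H1_norm (\<lambda>x. w j x - \<phi> x) < sqrt m" if "j < d" for j
      using wV[OF that] VH m(1) by (auto simp: H10_def)
    then obtain \<phi> where \<phi>: "\<And>j. j < d \<Longrightarrow> test_function (\<phi> j)"
      "\<And>j. j < d \<Longrightarrow> H1_norm (\<lambda>x. w j x - \<phi> j x) < sqrt m" by metis
    have \<phi>c: "c1c (\<phi> j) (gradient (\<phi> j))" if "j < d" for j by (rule test_function_c1c[OF \<phi>(1)[OF that]])
    note \<phi>L = c1c_in_L2(1)[OF \<phi>c] and \<phi>GL = c1c_in_L2(2)[OF \<phi>c]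
    define D where "D j x = (norm (G j x - gradient (\<phi> j) x))\<^sup>2 + p * M * (w j x - \<phi> j x)\<^sup>2" for j x
    have dL: "in_L2 (\<lambda>x. w j x - \<phi> j x)" "in_L2 (\<lambda>x. (G j x - gradient (\<phi> j) x) $ i)" if "j < d" for j i
      using in_L2_diff[OF wL \<phi>L] in_L2_diff[OF GL \<phi>GL] that by (simp_all del: gradient_nth)
    have small: "(LINT x|disc. (w j x - \<phi> j x)\<^sup>2) \<le> m" "(LINT x|disc. (norm (G j x - gradient (\<phi> j) x))\<^sup>2) \<le> m"
      if j: "j < d" for j
    proof -
      have "has_weak_gradient (\<lambda>x. w j x - \<phi> j x) (\<lambda>x. G j x - gradient (\<phi> j) x)"
        using has_weak_gradient_sum[of "UNIV::bool set" "\<lambda>b. if b then w j else \<phi> j"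
            "\<lambda>b. if b then G j else gradient (\<phi> j)" "\<lambda>b. if b then 1 else -1"]
          wL[OF j] \<phi>L[OF j] wg[OF j] c1c_weak_gradient[OF \<phi>c[OF j]] by (simp add: UNIV_bool)
      note gi = int_weak_gradient[OF this]
      have "(LINT x|disc. (w j x - \<phi> j x)\<^sup>2) + (LINT x|disc. (norm (G j x - gradient (\<phi> j) x))\<^sup>2) < m"
        using \<phi>(2)[OF j] unfolding H1_norm_def gi by simp
      moreover have "0 \<le> (LINT x|disc. (w j x - \<phi> j x)\<^sup>2)" "0 \<le> (LINT x|disc. (norm (G j x - gradient (\<phi> j) x))\<^sup>2)"
        by simp_all
      ultimately show "(LINT x|disc. (w j x - \<phi> j x)\<^sup>2) \<le> m" "(LINT x|disc. (norm (G j x - gradient (\<phi> j) x))\<^sup>2) \<le> m"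
        by linarith+
    qed
    have intD: "integrable disc (D j)" "(LINT x|disc. D j x) \<le> (1 + p * M) * m" if j: "j < d" for j
    proof -
      have i: "integrable disc (\<lambda>x. (norm (G j x - gradient (\<phi> j) x))\<^sup>2)" "integrable disc (\<lambda>x. (w j x - \<phi> j x)\<^sup>2)"
        using int_sq_norm_integrable[OF dL(2)[OF j]] in_L2_sq_integrable[OF dL(1)[OF j]] by auto
      then show "integrable disc (D j)" unfolding D_def by simp
      have "(LINT x|disc. D j x) = (LINT x|disc. (norm (G j x - gradient (\<phi> j) x))\<^sup>2) + p * M * (LINT x|disc. (w j x - \<phi> j x)\<^sup>2)"
        unfolding D_def using i by simp
      also have "\<dots> \<le> m + p * M * m" using small[OF j] p M by (intro add_mono mult_left_mono) auto
      finally show "(LINT x|disc. D j x) \<le> (1 + p * M) * m" by (simp add: algebra_simps)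
    qed
    have intE: "integrable disc (\<lambda>x. (norm (G j x))\<^sup>2 + p * M * (w j x)\<^sup>2)" if "j < d" for j
      using int_sq_norm_integrable[OF GL[OF that]] in_L2_sq_integrable[OF wL[OF that]] by simp
    show "\<exists>\<phi>. (\<forall>j<d. test_function (\<phi> j) \<and> (LINT x|disc. (w j x - \<phi> j x)\<^sup>2) \<le> \<epsilon>) \<and>
       (\<forall>c. qform p ?W (\<lambda>x. \<Sum>j<d. c j * \<phi> j x) (\<lambda>x. \<Sum>j<d. c j *\<^sub>R gradient (\<phi> j) x)
          \<le> - (\<eta> / 2) * (\<Sum>j<d. (c j)\<^sup>2))"
    proof (intro exI[of _ \<phi>] conjI allI impI \<phi>(1))
      show "(LINT x|disc. (w j x - \<phi> j x)\<^sup>2) \<le> \<epsilon>" if "j < d" for j using small(1)[OF that] m(2) by simp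
      fix c :: "nat \<Rightarrow> real"
      let ?n = "\<Sum>j<d. (c j)\<^sup>2"
      have n: "0 \<le> ?n" by (simp add: sum_nonneg)
      define fc where "fc x = (\<Sum>j<d. c j * \<phi> j x)" for x
      define gc where "gc x = (\<Sum>j<d. c j *\<^sub>R gradient (\<phi> j) x)" for x
      have fg: "c1c fc gc" unfolding fc_def gc_def by (rule c1c_sum) (use \<phi>c in auto)
      note fcL = c1c_in_L2(1)[OF fg] and gcL = c1c_in_L2(2)[OF fg]
      have fi: "qform p ?W fc gc = (LINT x|disc. (norm (gc x))\<^sup>2 - p * (?W x * (fc x)\<^sup>2))"
        "integrable disc (\<lambda>x. (norm (gc x))\<^sup>2 - p * (?W x * (fc x)\<^sup>2))"
        by (rule qform_integral[OF W(1) Wb fcL], assumption, rule gcL)+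
      let ?F = "\<lambda>x. (norm (Gc c x))\<^sup>2 - p * (?W x * (wc c x)\<^sup>2)"
      let ?R = "\<lambda>x. t * (\<Sum>j<d. (norm (G j x))\<^sup>2 + p * M * (w j x)\<^sup>2) + (1 + 1 / t) * (\<Sum>j<d. D j x)"
      have intR: "integrable disc ?R"
        by (intro Bochner_Integration.integrable_add Bochner_Integration.integrable_mult_right Bochner_Integration.integrable_sum intE intD(1)) auto
      \<comment> \<open>Young's inequality for each component of the gradient and for the function, then Cauchy-Schwarz in the coefficients.\<close>
      have pt: "(norm (gc x))\<^sup>2 - p * (?W x * (fc x)\<^sup>2) \<le> ?F x + ?n * ?R x" if x: "x \<in> unit_disc" for x
      proof -
        have WM: "0 \<le> p * ?W x" "p * ?W x \<le> p * M" using W(2)[OF x] p by (auto intro: mult_left_mono)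
        have k: "(gc x $ k)\<^sup>2 \<le> (Gc c x $ k)\<^sup>2 + t * (?n * (\<Sum>j<d. (G j x $ k)\<^sup>2))
             + (1 + 1 / t) * (?n * (\<Sum>j<d. ((G j x - gradient (\<phi> j) x) $ k)\<^sup>2))" for k
        proof -
          have "(Gc c x $ k)\<^sup>2 \<le> ?n * (\<Sum>j<d. (G j x $ k)\<^sup>2)"
            using sq_sum_bound[of c "\<lambda>j. G j x $ k" d] by (simp add: Gc_def)
          moreover have "(Gc c x $ k - gc x $ k)\<^sup>2 \<le> ?n * (\<Sum>j<d. ((G j x - gradient (\<phi> j) x) $ k)\<^sup>2)"
            using sq_sum_bound[of c "\<lambda>j. (G j x - gradient (\<phi> j) x) $ k" d]
            by (simp add: Gc_def gc_def sum_subtractf right_diff_distrib)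
          ultimately show ?thesis by (rule sq_perturb(1)[OF t(1)])
        qed
        have f1: "- (fc x)\<^sup>2 \<le> - (wc c x)\<^sup>2 + t * (?n * (\<Sum>j<d. (w j x)\<^sup>2)) + (1 + 1 / t) * (?n * (\<Sum>j<d. (w j x - \<phi> j x)\<^sup>2))"
        proof -
          have "(wc c x)\<^sup>2 \<le> ?n * (\<Sum>j<d. (w j x)\<^sup>2)"
            using sq_sum_bound[of c "\<lambda>j. w j x" d] by (simp add: wc_def)
          moreover have "(wc c x - fc x)\<^sup>2 \<le> ?n * (\<Sum>j<d. (w j x - \<phi> j x)\<^sup>2)"
            using sq_sum_bound[of c "\<lambda>j. w j x - \<phi> j x" d]
            by (simp add: wc_def fc_def sum_subtractf right_diff_distrib)
          ultimately show ?thesis by (rule sq_perturb(2)[OF t(1)])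
        qed
        let ?Z = "t * (?n * (\<Sum>j<d. (w j x)\<^sup>2)) + (1 + 1 / t) * (?n * (\<Sum>j<d. (w j x - \<phi> j x)\<^sup>2))"
        have Z: "0 \<le> ?Z" using t n by (intro add_nonneg_nonneg mult_nonneg_nonneg sum_nonneg) auto
        have "(p * ?W x) * - (fc x)\<^sup>2 \<le> (p * ?W x) * (- (wc c x)\<^sup>2 + ?Z)"
          using f1 WM(1) by (intro mult_left_mono) auto
        also have "\<dots> \<le> - (p * ?W x) * (wc c x)\<^sup>2 + (p * M) * ?Z"
          using mult_right_mono[OF WM(2) Z] by (simp add: algebra_simps)
        finally have f2: "- (p * (?W x * (fc x)\<^sup>2)) \<le> - (p * (?W x * (wc c x)\<^sup>2)) + (p * M) * ?Z"
          by (simp add: mult.assoc)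
        have R: "?n * ?R x = (t * (?n * (\<Sum>j<d. (G j x $ 1)\<^sup>2)) + (1 + 1 / t) * (?n * (\<Sum>j<d. ((G j x - gradient (\<phi> j) x) $ 1)\<^sup>2)))
           + (t * (?n * (\<Sum>j<d. (G j x $ 2)\<^sup>2)) + (1 + 1 / t) * (?n * (\<Sum>j<d. ((G j x - gradient (\<phi> j) x) $ 2)\<^sup>2)))
           + (p * M) * ?Z"
        proof -
          have e1: "(\<Sum>j<d. (norm (G j x))\<^sup>2 + p * M * (w j x)\<^sup>2) =
              (\<Sum>j<d. (G j x $ 1)\<^sup>2) + (\<Sum>j<d. (G j x $ 2)\<^sup>2) + p * M * (\<Sum>j<d. (w j x)\<^sup>2)"
            by (simp only: norm2_sq sum.distrib sum_distrib_left)
          have e2: "(\<Sum>j<d. D j x) = (\<Sum>j<d. ((G j x - gradient (\<phi> j) x) $ 1)\<^sup>2) + (\<Sum>j<d. ((G j x - gradient (\<phi> j) x) $ 2)\<^sup>2)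
              + p * M * (\<Sum>j<d. (w j x - \<phi> j x)\<^sup>2)"
            by (simp only: D_def norm2_sq sum.distrib sum_distrib_left)
          show ?thesis unfolding e1 e2 by (simp only: distrib_left distrib_right mult_ac add_ac)
        qed
        show ?thesis using k[of 1] k[of 2] f2 unfolding R norm2_sq[of "gc x"] norm2_sq[of "Gc c x"] by linarith
      qed
      have "qform p ?W fc gc \<le> (LINT x|disc. ?F x + ?n * ?R x)"
        unfolding fi(1)
      proof (rule integral_mono)
        show "integrable disc (\<lambda>x. (norm (gc x))\<^sup>2 - p * (?W x * (fc x)\<^sup>2))"
          by (rule fi(2))
        show "integrable disc (\<lambda>x. ?F x + ?n * ?R x)"
          by (intro Bochner_Integration.integrable_add Bochner_Integration.integrable_mult_right intR qi(2))
      qed (use pt in simp)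
      also have "\<dots> = qform p ?W (wc c) (Gc c) + ?n * (LINT x|disc. ?R x)"
        unfolding qi(1)
        using qi(2) intR by simp
      also have "(LINT x|disc. ?R x) = t * E + (1 + 1 / t) * (\<Sum>j<d. LINT x|disc. D j x)"
      proof -
        have "integrable disc (\<lambda>x. \<Sum>j<d. (norm (G j x))\<^sup>2 + p * M * (w j x)\<^sup>2)" "integrable disc (\<lambda>x. \<Sum>j<d. D j x)"
          using intE intD(1) by (auto intro!: Bochner_Integration.integrable_sum)
        moreover have "(LINT x|disc. (\<Sum>j<d. D j x)) = (\<Sum>j<d. LINT x|disc. D j x)"
          by (rule Bochner_Integration.integral_sum) (use intD in auto)
        moreover have "(LINT x|disc. (\<Sum>j<d. (norm (G j x))\<^sup>2 + p * M * (w j x)\<^sup>2)) = E"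
          unfolding E_def by (rule Bochner_Integration.integral_sum) (use intE in auto)
        ultimately show ?thesis by simp
      qed
      also have "(\<Sum>j<d. LINT x|disc. D j x) \<le> d * ((1 + p * M) * m)"
        using sum_bounded_above[of "{..<d}" "\<lambda>j. LINT x|disc. D j x" "(1 + p * M) * m"] intD(2) by simp
      also have "qform p ?W (wc c) (Gc c) \<le> - \<eta> * ?n" using qb \<eta>(2) by simp
      finally have "qform p ?W fc gc \<le> - \<eta> * ?n + ?n * (t * E + (1 + 1 / t) * (d * ((1 + p * M) * m)))"
        using t n by (auto simp: mult_left_mono)
      also have "?n * (t * E + (1 + 1 / t) * (d * ((1 + p * M) * m))) \<le> ?n * (\<eta> / 4 + \<eta> / 4)"
        using t(2) m(3) n by (intro mult_left_mono add_mono) auto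
      finally show "qform p ?W (\<lambda>x. \<Sum>j<d. c j * \<phi> j x) (\<lambda>x. \<Sum>j<d. c j *\<^sub>R gradient (\<phi> j) x) \<le> - (\<eta> / 2) * ?n"
        unfolding fc_def gc_def by (simp add: algebra_simps)
    qed
  qed
qed

section \<open>Radial solutions as solutions of an ordinary differential equation\<close>

definition pw :: "real \<Rightarrow> real \<Rightarrow> real" where "pw p s = \<bar>s\<bar> powr (p - 1) * s"

lemma pw_deriv:
  assumes p: "1 < p"
  shows "(pw p has_real_derivative p * \<bar>s\<bar> powr (p - 1)) (at s)"
proof -
  consider "s < 0" | "s = 0" | "0 < s" by linarith
  then show ?thesis
  proof cases
    case 1
    have d: "((\<lambda>s. - ((- s) powr p)) has_real_derivative p * \<bar>s\<bar> powr (p - 1)) (at s)"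
      using 1 by (auto intro!: derivative_eq_intros)
    have e: "- ((- t) powr p) = pw p t" if "t \<in> {..<0}" for t
    proof -
      have "pw p t = - ((- t) * (- t) powr (p - 1))" using that by (simp add: pw_def)
      then show ?thesis using that powr_mult_base[of "- t" "p - 1"] by simp
    qed
    show ?thesis
      by (rule has_field_derivative_transform_within_open[OF d, of "{..<0}"]) (use 1 e in auto)
  next
    case 2
    have "((\<lambda>h::real. \<bar>h\<bar> powr (p - 1)) \<longlongrightarrow> 0) (at 0)"
    proof -
      have "((\<lambda>h::real. \<bar>h\<bar>) \<longlongrightarrow> \<bar>0\<bar>) (at 0)" by (intro tendsto_intros)
      then have "((\<lambda>h::real. \<bar>h\<bar> powr (p - 1)) \<longlongrightarrow> \<bar>0\<bar> powr (p - 1)) (at 0)"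
        by (intro tendsto_powr2 tendsto_const) (use p in auto)
      then show ?thesis by simp
    qed
    then have "((\<lambda>h. (pw p (0 + h) - pw p 0) / h) \<longlongrightarrow> 0) (at 0)"
      by (rule Lim_transform_eventually) (auto simp: pw_def eventually_at_filter)
    then show ?thesis using 2 p by (simp add: DERIV_def)
  next
    case 3
    have d: "((\<lambda>s. s powr p) has_real_derivative p * \<bar>s\<bar> powr (p - 1)) (at s)"
      using 3 by (auto intro!: derivative_eq_intros)
    have e: "t powr p = pw p t" if "t \<in> {0<..}" for t
      using that powr_mult_base[of t "p - 1"] by (simp add: pw_def mult.commute)
    show ?thesis
      by (rule has_field_derivative_transform_within_open[OF d, of "{0<..}"]) (use 3 e in auto)
  qed
qed

lemma pw_lipschitz:
  assumes p: "1 < p" and "\<bar>s\<bar> \<le> M" "\<bar>t\<bar> \<le> M"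
  shows "\<bar>pw p s - pw p t\<bar> \<le> p * M powr (p - 1) * \<bar>s - t\<bar>"
proof -
  have "norm (pw p s - pw p t) \<le> (p * M powr (p - 1)) * norm (s - t)"
  proof (rule field_differentiable_bound[of "{-M..M}"])
    fix z assume "z \<in> {-M..M}"
    then have "\<bar>z\<bar> powr (p - 1) \<le> M powr (p - 1)" using p by (intro powr_mono2) auto
    then show "norm (p * \<bar>z\<bar> powr (p - 1)) \<le> p * M powr (p - 1)" using p by (simp add: abs_mult)
    show "(pw p has_field_derivative p * \<bar>z\<bar> powr (p - 1)) (at z within {-M..M})"
      by (rule has_field_derivative_at_within[OF pw_deriv[OF p]])
  qed (use assms in auto)
  then show ?thesis by simp
qed

text \<open>The radial form of the equation on \<open>(0, R)\<close> as a first-order system, with the behaviour at the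
  singular endpoint that a smooth radial function has: \<open>U\<close> is continuous there and its
  derivative tends to \<open>0\<close>.\<close>
definition emden :: "real \<Rightarrow> real \<Rightarrow> real \<Rightarrow> (real \<Rightarrow> real) \<Rightarrow> (real \<Rightarrow> real) \<Rightarrow> bool" where
  "emden p a R U U1 \<longleftrightarrow>
     (\<forall>r. 0 < r \<and> r < R \<longrightarrow> (U has_real_derivative U1 r) (at r) \<and>
        (U1 has_real_derivative (- U1 r / r - r powr a * pw p (U r))) (at r)) \<and>
     continuous_on {0..<R} U \<and> (U1 \<longlongrightarrow> 0) (at_right 0)"

lemma emden_bounded:
  assumes "emden p a R U U1" "s < R"
  obtains M where "\<And>r. 0 \<le> r \<Longrightarrow> r \<le> s \<Longrightarrow> \<bar>U r\<bar> \<le> M"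
proof -
  have "compact (U ` {0..s})"
    by (intro compact_continuous_image) (use assms in \<open>auto simp: emden_def intro: continuous_on_subset\<close>)
  then obtain M where "\<forall>y\<in>U ` {0..s}. norm y \<le> M" using compact_imp_bounded bounded_iff by metis
  then show ?thesis using that[of M] by auto
qed

text \<open>Energy method for the singular initial value problem. For the difference \<open>x\<close> of two solutions
  and the difference \<open>y\<close> of their derivatives, the singular term contributes \<open>- 2 y^2 / r \<le>
  0\<close> to the derivative of \<open>x^2 + y^2\<close>; therefore Gronwall's inequality holds up to the origin.\<close>
lemma emden_unique:
  assumes p: "1 < p" and a: "0 \<le> a" and R: "R \<le> 1"
    and U: "emden p a R U U1" and V: "emden p a R V V1" and UV: "U 0 = V 0" and s: "0 < s" "s < R"
  shows "U s = V s"
proof -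
  obtain MU where MU: "\<And>r. 0 \<le> r \<Longrightarrow> r \<le> s \<Longrightarrow> \<bar>U r\<bar> \<le> MU" using emden_bounded[OF U s(2)] by blast
  obtain MV where MV: "\<And>r. 0 \<le> r \<Longrightarrow> r \<le> s \<Longrightarrow> \<bar>V r\<bar> \<le> MV" using emden_bounded[OF V s(2)] by blast
  define L where "L = p * (max MU MV) powr (p - 1)"
  have L0: "0 \<le> L" using p by (simp add: L_def)
  have lip: "\<bar>pw p (U r) - pw p (V r)\<bar> \<le> L * \<bar>U r - V r\<bar>" if "0 \<le> r" "r \<le> s" for r
    unfolding L_def by (rule pw_lipschitz[OF p]) (use MU[OF that] MV[OF that] in auto)
  define x where "x r = U r - V r" for r
  define y where "y r = U1 r - V1 r" for r
  define E where "E r = (x r)\<^sup>2 + (y r)\<^sup>2" for r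
  \<comment> \<open>The integrating factor of Gronwall's inequality.\<close>
  define G where "G r = E r * exp (- (1 + L) * r)" for r
  have dG: "\<exists>D. (G has_real_derivative D) (at r) \<and> D \<le> 0" if r: "0 < r" "r \<le> s" for r
  proof -
    have r': "r < R" "r \<le> 1" using r s R by auto
    let ?F = "pw p (U r) - pw p (V r)"
    have dx: "(x has_real_derivative y r) (at r)"
      using U V r r' unfolding emden_def x_def y_def by (auto intro!: DERIV_diff)
    have dy: "(y has_real_derivative (- y r / r - r powr a * ?F)) (at r)"
      unfolding y_def
      by (rule DERIV_cong[OF DERIV_diff]) (use U V r r' in \<open>auto simp: emden_def field_simps\<close>)
    have dE: "(E has_real_derivative (2 * x r * y r + 2 * y r * (- y r / r - r powr a * ?F))) (at r)"
      unfolding E_def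
      by (rule DERIV_cong[OF DERIV_add[OF DERIV_power[OF dx] DERIV_power[OF dy]]]) simp
    let ?D = "(2 * x r * y r + 2 * y r * (- y r / r - r powr a * ?F))"
    have "(G has_real_derivative (?D - (1 + L) * E r) * exp (- (1 + L) * r)) (at r)"
      unfolding G_def by (auto intro!: derivative_eq_intros dE simp: algebra_simps)
    moreover have "?D \<le> (1 + L) * E r"
    proof -
      have "r powr a \<le> 1" using powr_mono2[OF a less_imp_le[OF r(1)] r'(2)] by simp
      moreover define b where "b = r powr a * ?F"
      ultimately have "\<bar>b\<bar> \<le> 1 * (L * \<bar>x r\<bar>)"
        unfolding b_def abs_mult x_def using lip[of r] r by (intro mult_mono) auto
      then have "\<bar>y r\<bar> * \<bar>b\<bar> \<le> \<bar>y r\<bar> * (L * \<bar>x r\<bar>)" by (intro mult_left_mono) auto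
      then have 1: "- (y r * b) \<le> L * (\<bar>x r\<bar> * \<bar>y r\<bar>)"
        using abs_ge_minus_self[of "y r * b"] by (simp add: abs_mult mult_ac)
      have 2: "2 * (\<bar>x r\<bar> * \<bar>y r\<bar>) \<le> E r"
        using sum_squares_bound[of "\<bar>x r\<bar>" "\<bar>y r\<bar>"] by (simp add: E_def mult.assoc)
      then have 3: "L * (2 * (\<bar>x r\<bar> * \<bar>y r\<bar>)) \<le> L * E r" by (rule mult_left_mono[OF _ L0])
      have 4: "0 \<le> y r * y r / r" using r by simp
      have 5: "2 * (x r * y r) \<le> 2 * (\<bar>x r\<bar> * \<bar>y r\<bar>)" using abs_ge_self[of "x r * y r"] by (simp add: abs_mult)
      have "?D = 2 * (x r * y r) - 2 * (y r * y r / r) + 2 * (- (y r * b))"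
        unfolding b_def[symmetric] by (simp add: algebra_simps)
      then show ?thesis using 1 2 3 4 5 by (simp add: distrib_right)
    qed
    ultimately show ?thesis by (intro exI[of _ "(?D - (1 + L) * E r) * exp (- (1 + L) * r)"]) (auto simp: mult_le_0_iff)
  qed
  have mono: "G s \<le> G t" if "0 < t" "t \<le> s" for t
    by (rule DERIV_nonpos_imp_nonincreasing[OF that(2)]) (use dG that in force)
  have "(U \<longlongrightarrow> U 0) (at_right 0)" "(V \<longlongrightarrow> V 0) (at_right 0)"
  proof -
    have "(f \<longlongrightarrow> f 0) (at_right 0)" if "continuous_on {0..<R} f" for f :: "real \<Rightarrow> real"
    proof -
      have "continuous_on {0..s} f" by (rule continuous_on_subset[OF that]) (use s in auto)
      then have "(f \<longlongrightarrow> f 0) (at 0 within {0..s})" using s by (auto simp: continuous_on_def)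
      then show ?thesis using s by (simp add: at_within_Icc_at_right)
    qed
    then show "(U \<longlongrightarrow> U 0) (at_right 0)" "(V \<longlongrightarrow> V 0) (at_right 0)" using U V by (auto simp: emden_def)
  qed
  then have "(G \<longlongrightarrow> ((U 0 - V 0)\<^sup>2 + (0 - 0)\<^sup>2) * exp (- (1 + L) * 0)) (at_right 0)"
    unfolding G_def E_def x_def y_def
    by (intro tendsto_intros) (use U V in \<open>auto simp: emden_def\<close>)
  then have "(G \<longlongrightarrow> 0) (at_right 0)" using UV by simp
  moreover have "eventually (\<lambda>t. G s \<le> G t) (at_right 0)"
    using eventually_at_right[of 0 "s"] s mono by (auto simp: eventually_at_right_field intro!: exI[of _ s])
  ultimately have "G s \<le> 0" by (intro tendsto_lowerbound) auto
  then have "E s \<le> 0" by (simp add: G_def mult_le_0_iff not_le[symmetric])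
  then have "x s = 0" unfolding E_def by (smt (verit) zero_le_power2 power2_eq_iff_nonneg power_zero_numeral zero_eq_power2)
  then show ?thesis by (simp add: x_def)
qed

text \<open>Towards the origin the singular term has the wrong sign, but away from the origin it is bounded,
  so Gronwall's inequality applies on every interval \<open>[t, s\<close>] with \<open>t > 0\<close>; the constant
  depends on \<open>t\<close>.\<close>
lemma emden_backward:
  assumes p: "1 < p" and a: "0 \<le> a" and R: "R \<le> 1" and U: "emden p a R U U1"
    and s: "0 < s" "s < R" "U s = 0" "U1 s = 0"
  shows "U 0 = 0"
proof -
  have z: "U t = 0" if t: "0 < t" "t \<le> s" for t
  proof -
    obtain M where M: "\<And>r. 0 \<le> r \<Longrightarrow> r \<le> s \<Longrightarrow> \<bar>U r\<bar> \<le> M" using emden_bounded[OF U s(2)] by blast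
    define L where "L = p * M powr (p - 1)"
    have L0: "0 \<le> L" using p by (simp add: L_def)
    have M0: "0 \<le> M" using M[of 0] s by auto
    define E where "E r = (U r)\<^sup>2 + (U1 r)\<^sup>2" for r
    \<comment> \<open>The summand \<open>2 / t\<close> pays for the singular term.\<close>
    define C where "C = 1 + L + 2 / t"
    define G where "G r = E r * exp (C * r)" for r
    have dG: "\<exists>D. (G has_real_derivative D) (at r) \<and> 0 \<le> D" if r: "t \<le> r" "r \<le> s" for r
    proof -
      have r': "0 < r" "r < R" "r \<le> 1" using r s R t by auto
      let ?F = "pw p (U r)"
      let ?D = "2 * U r * U1 r + 2 * U1 r * (- U1 r / r - r powr a * ?F)"
      have d: "(U has_real_derivative U1 r) (at r)" "(U1 has_real_derivative (- U1 r / r - r powr a * ?F)) (at r)"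
        using U r' by (auto simp: emden_def)
      have dE: "(E has_real_derivative ?D) (at r)"
        unfolding E_def by (rule DERIV_cong[OF DERIV_add[OF DERIV_power[OF d(1)] DERIV_power[OF d(2)]]]) simp
      have "(G has_real_derivative (?D + C * E r) * exp (C * r)) (at r)"
        unfolding G_def by (auto intro!: derivative_eq_intros dE simp: algebra_simps)
      moreover have "0 \<le> ?D + C * E r"
      proof -
        have "r powr a \<le> 1" using powr_mono2[OF a less_imp_le[OF r'(1)] r'(3)] by simp
        moreover have "\<bar>?F\<bar> \<le> L * \<bar>U r\<bar>"
          using pw_lipschitz[OF p M[of r], of 0] r r' M0 by (simp add: L_def pw_def)
        moreover define b where "b = r powr a * ?F"
        ultimately have "\<bar>b\<bar> \<le> 1 * (L * \<bar>U r\<bar>)"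
          unfolding b_def abs_mult by (intro mult_mono) auto
        then have "\<bar>U1 r\<bar> * \<bar>b\<bar> \<le> \<bar>U1 r\<bar> * (L * \<bar>U r\<bar>)" by (intro mult_left_mono) auto
        then have 1: "U1 r * b \<le> L * (\<bar>U r\<bar> * \<bar>U1 r\<bar>)"
          using abs_ge_self[of "U1 r * b"] by (simp add: abs_mult mult_ac)
        have 2: "2 * (\<bar>U r\<bar> * \<bar>U1 r\<bar>) \<le> E r"
          using sum_squares_bound[of "\<bar>U r\<bar>" "\<bar>U1 r\<bar>"] by (simp add: E_def mult.assoc)
        then have 3: "L * (2 * (\<bar>U r\<bar> * \<bar>U1 r\<bar>)) \<le> L * E r" by (rule mult_left_mono[OF _ L0])
        have "2 * (U1 r)\<^sup>2 / r \<le> 2 * (U1 r)\<^sup>2 / t" using r t by (intro divide_left_mono) auto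
        also have "\<dots> \<le> 2 * E r / t" using t by (intro divide_right_mono) (auto simp: E_def)
        finally have 4: "2 * (U1 r)\<^sup>2 / r \<le> 2 / t * E r" by simp
        have 5: "- (2 * (U r * U1 r)) \<le> 2 * (\<bar>U r\<bar> * \<bar>U1 r\<bar>)" using abs_ge_minus_self[of "U r * U1 r"] by (simp add: abs_mult)
        have "?D = 2 * (U r * U1 r) - 2 * (U1 r)\<^sup>2 / r - 2 * (U1 r * b)"
          unfolding b_def[symmetric] by (simp add: algebra_simps power2_eq_square)
        moreover have "C * E r = E r + L * E r + 2 / t * E r" by (simp add: C_def distrib_right)
        ultimately show ?thesis using 1 2 3 4 5 by linarith
      qed
      ultimately show ?thesis by (intro exI[of _ "(?D + C * E r) * exp (C * r)"]) auto
    qed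
    have "G t \<le> G s" by (rule DERIV_nonneg_imp_nondecreasing[OF t(2)]) (use dG in force)
    then have "E t * exp (C * t) \<le> 0" using s by (simp add: G_def E_def)
    then have "E t \<le> 0" by (simp add: mult_le_0_iff not_le[symmetric])
    then show "U t = 0" unfolding E_def by (smt (verit) zero_le_power2 zero_eq_power2)
  qed
  have "continuous_on {0..s} U" using U s by (auto simp: emden_def intro: continuous_on_subset)
  then have "(U \<longlongrightarrow> U 0) (at 0 within {0..s})" using s by (auto simp: continuous_on_def)
  then have "(U \<longlongrightarrow> U 0) (at_right 0)" using s by (simp add: at_within_Icc_at_right)
  moreover have "(U \<longlongrightarrow> 0) (at_right 0)"
    by (rule tendsto_eventually) (use z s in \<open>auto simp: eventually_at_right_field intro!: exI[of _ s]\<close>)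
  ultimately show ?thesis by (rule tendsto_unique[rotated]) simp
qed

definition profile :: "(real^2 \<Rightarrow> real) \<Rightarrow> real \<Rightarrow> real" where "profile u r = u (r *\<^sub>R axis 1 1)"
definition profile' :: "(real^2 \<Rightarrow> real) \<Rightarrow> real \<Rightarrow> real" where
  "profile' u r = partial_deriv 1 u (r *\<^sub>R axis 1 1)"

lemma norm_axis_scale [simp]: "norm (r *\<^sub>R axis i (1::real) :: real^2) = \<bar>r\<bar>" by simp

lemma solution_regularity:
  assumes "henon_solution p a u"
  shows "\<And>x. x \<in> unit_disc \<Longrightarrow> (u has_derivative (\<lambda>h. gradient u x \<bullet> h)) (at x)"
    and "\<And>x i. x \<in> unit_disc \<Longrightarrow> (partial_deriv i u has_derivative (\<lambda>h. gradient (partial_deriv i u) x \<bullet> h)) (at x)"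
    and "\<And>i j. continuous_on unit_disc (partial_deriv j (partial_deriv i u))"
    and "\<And>i. continuous_on unit_disc (partial_deriv i u)"
    and "continuous_on (cball 0 1) u"
    and "\<And>x. x \<in> unit_disc \<Longrightarrow> partial_deriv 1 (partial_deriv 1 u) x + partial_deriv 2 (partial_deriv 2 u) x
          = - henon_weight a x * pw p (u x)"
    and "\<And>x. norm x = 1 \<Longrightarrow> u x = 0"
proof -
  have C: "Ck_on (Suc (Suc 0)) u unit_disc" using assms by (simp add: henon_solution_def numeral_2_eq_2)
  then show 1: "(u has_derivative (\<lambda>h. gradient u x \<bullet> h)) (at x)" if "x \<in> unit_disc" for x
    using that by (intro has_derivative_gradient) auto
  show 2: "(partial_deriv i u has_derivative (\<lambda>h. gradient (partial_deriv i u) x \<bullet> h)) (at x)" if "x \<in> unit_disc" for x i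
    using that C by (intro has_derivative_gradient) auto
  show "continuous_on unit_disc (partial_deriv j (partial_deriv i u))" for i j using C by auto
  show "continuous_on unit_disc (partial_deriv i u)" for i
    using Ck_on_SucD[of 0 "partial_deriv i u"] C by auto
  show "continuous_on (cball 0 1) u" using assms by (simp add: henon_solution_def)
  show "partial_deriv 1 (partial_deriv 1 u) x + partial_deriv 2 (partial_deriv 2 u) x
          = - henon_weight a x * pw p (u x)" if "x \<in> unit_disc" for x
  proof -
    have "- laplacian u x = henon_weight a x * \<bar>u x\<bar> powr (p - 1) * u x" using assms that by (simp add: henon_solution_def)
    then show ?thesis by (simp add: laplacian_def sum_2 pw_def)
  qed
  show "u x = 0" if "norm x = 1" for x using assms that by (simp add: henon_solution_def frontier_ball)
qed

lemma henon_weight_axis: "0 < r \<Longrightarrow> henon_weight a x = norm x powr a" if "norm x = r"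
  using that by (auto simp: henon_weight_def)

context
  fixes p a :: real and u :: "real^2 \<Rightarrow> real"
  assumes sol: "henon_solution p a u" and rad: "radial u"
begin

lemma radial_profile: "x \<in> unit_disc \<Longrightarrow> u x = profile u (norm x)"
  using rad unfolding radial_def profile_def by (metis abs_norm_cancel mem_ball_0 norm_axis_scale)

lemma profile_deriv:
  assumes "\<bar>r\<bar> < 1"
  shows "(profile u has_real_derivative profile' u r) (at r)"
proof -
  have "((\<lambda>t. t *\<^sub>R axis 1 1 :: real^2) has_derivative (\<lambda>s. s *\<^sub>R axis 1 1)) (at r)"
    by (auto intro!: derivative_eq_intros)
  from has_derivative_compose[OF this solution_regularity(1)[OF sol]] assms
  show ?thesis unfolding profile_def profile'_def has_field_derivative_def
    by (simp add: inner_axis mult_commute_abs)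
qed

lemma profile'_deriv:
  assumes "\<bar>r\<bar> < 1"
  shows "(profile' u has_real_derivative partial_deriv 1 (partial_deriv 1 u) (r *\<^sub>R axis 1 1)) (at r)"
proof -
  have "((\<lambda>t. t *\<^sub>R axis 1 1 :: real^2) has_derivative (\<lambda>s. s *\<^sub>R axis 1 1)) (at r)"
    by (auto intro!: derivative_eq_intros)
  from has_derivative_compose[OF this solution_regularity(2)[OF sol, of _ 1]] assms
  show ?thesis unfolding profile'_def has_field_derivative_def
    by (simp add: inner_axis mult_commute_abs)
qed

lemma gradient_radial:
  assumes x: "x \<in> unit_disc" "x \<noteq> 0"
  shows "gradient u x = (profile' u (norm x) / norm x) *\<^sub>R x"
proof -
  have n: "(norm has_derivative (\<lambda>h. h \<bullet> sgn x)) (at x)" by (rule has_derivative_norm[OF x(2)])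
  have "((\<lambda>y. profile u (norm y)) has_derivative (\<lambda>h. (h \<bullet> sgn x) * profile' u (norm x))) (at x)"
    using has_derivative_compose[OF n profile_deriv[THEN has_field_derivative_imp_has_derivative]] x
    by (simp add: mult.commute)
  then have "(u has_derivative (\<lambda>h. (h \<bullet> sgn x) * profile' u (norm x))) (at x)"
    by (rule has_derivative_transform_within_open[of _ _ _ _ unit_disc]) (use x radial_profile in auto)
  from fun_cong[OF has_derivative_unique[OF this solution_regularity(1)[OF sol x(1)]]]
  have "gradient u x \<bullet> h = (h \<bullet> sgn x) * profile' u (norm x)" for h by (rule sym)
  then have "gradient u x \<bullet> h = ((profile' u (norm x) / norm x) *\<^sub>R x) \<bullet> h" for h
    by (simp add: sgn_div_norm inner_commute divide_inverse mult_ac)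
  then show ?thesis by (metis inner_commute vector_eq_ldot)
qed

text \<open>A radial function is even, so its gradient at the origin equals its own negative.\<close>
lemma gradient_zero: "gradient u 0 = 0"
proof -
  have d: "(u has_derivative (\<lambda>h. gradient u 0 \<bullet> h)) (at 0)" using solution_regularity(1)[OF sol, of 0] by simp
  have "((\<lambda>y::real^2. - y) has_derivative (\<lambda>h. - h)) (at 0)" by (auto intro!: derivative_eq_intros)
  from has_derivative_compose[OF this, of u "\<lambda>h. gradient u 0 \<bullet> h"] d
  have "((\<lambda>y. u (- y)) has_derivative (\<lambda>h. gradient u 0 \<bullet> (- h))) (at 0)" by simp
  then have "(u has_derivative (\<lambda>h. gradient u 0 \<bullet> (- h))) (at 0)"
    by (rule has_derivative_transform_within_open[of _ _ _ _ unit_disc]) (use radial_profile in auto)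
  from has_derivative_unique[OF this d] have "gradient u 0 \<bullet> (- gradient u 0) = gradient u 0 \<bullet> gradient u 0"
    by (rule fun_cong)
  then show ?thesis by simp
qed

text \<open>The second derivative in the angular direction. Along the perpendicular to the first axis the
  partial derivative is \<open>(U'(\<rho>) / \<rho>) s\<close> with \<open>\<rho>\<close> the distance from the origin,
  and its difference quotient at \<open>s = 0\<close> is explicit.\<close>
lemma partial2_radial:
  assumes r: "0 < r" "r < 1"
  shows "partial_deriv 2 (partial_deriv 2 u) (r *\<^sub>R axis 1 1) = profile' u r / r"
proof -
  let ?y = "\<lambda>s. r *\<^sub>R axis 1 1 + s *\<^sub>R axis 2 1 :: real^2"
  let ?f = "\<lambda>s. partial_deriv 2 u (?y s)"
  have "(?y has_derivative (\<lambda>s. s *\<^sub>R axis 2 1)) (at 0)" by (auto intro!: derivative_eq_intros)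
  from has_derivative_compose[OF this, of "partial_deriv 2 u" "\<lambda>h. gradient (partial_deriv 2 u) (?y 0) \<bullet> h"] solution_regularity(2)[OF sol, of "?y 0" 2] r
  have "(?f has_real_derivative partial_deriv 2 (partial_deriv 2 u) (r *\<^sub>R axis 1 1)) (at 0)"
    unfolding has_field_derivative_def by (simp add: inner_axis mult_commute_abs)
  then have 1: "((\<lambda>h. (?f h - ?f 0) / h) \<longlongrightarrow> partial_deriv 2 (partial_deriv 2 u) (r *\<^sub>R axis 1 1)) (at 0)"
    by (simp add: DERIV_def)
  have nt: "((\<lambda>s. norm (?y s)) \<longlongrightarrow> norm (?y 0)) (at 0)" by (intro tendsto_intros)
  have ny0: "norm (?y 0) = r" using r by simp
  have "isCont (profile' u) r" using profile'_deriv[of r] r DERIV_isCont by force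
  then have "((\<lambda>s. profile' u (norm (?y s))) \<longlongrightarrow> profile' u r) (at 0)"
    using isCont_tendsto_compose nt unfolding ny0 by blast
  then have "((\<lambda>s. profile' u (norm (?y s)) / norm (?y s)) \<longlongrightarrow> profile' u r / r) (at 0)"
    using nt r unfolding ny0 by (intro tendsto_divide) auto
  moreover have "eventually (\<lambda>s. norm (?y s) < 1) (at 0)" using order_tendstoD(2)[OF nt, of 1] r by simp
  then have "eventually (\<lambda>s. profile' u (norm (?y s)) / norm (?y s) = (?f s - ?f 0) / s) (at 0)"
    using eventually_neq_at_within[of 0 0 UNIV]
  proof eventually_elim
    case (elim s)
    have c: "?y s $ 2 = s" "?y s $ 1 = r" for s by (auto simp: axis_def)
    have "?y s \<noteq> 0" for s using c(2)[of s] r by (metis less_irrefl zero_index)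
    then have "?f s' = profile' u (norm (?y s')) / norm (?y s') * s'" if "norm (?y s') < 1" for s'
      using gradient_radial[of "?y s'"] that c(1)[of s'] by (metis gradient_nth mem_ball_0 real_scaleR_def vector_scaleR_component)
    from this[of s] this[of 0] elim r show ?case
      by auto
  qed
  ultimately have "((\<lambda>h. (?f h - ?f 0) / h) \<longlongrightarrow> profile' u r / r) (at 0)" by (rule Lim_transform_eventually)
  with 1 show ?thesis using LIM_unique by blast
qed

lemma profile_ode:
  assumes r: "0 < r" "r < 1"
  shows "(profile' u has_real_derivative (- profile' u r / r - r powr a * pw p (profile u r))) (at r)"
proof -
  have "partial_deriv 1 (partial_deriv 1 u) (r *\<^sub>R axis 1 1) + profile' u r / r = - (r powr a) * pw p (profile u r)"
    using solution_regularity(6)[OF sol, of "r *\<^sub>R axis 1 1"] partial2_radial[OF r] henon_weight_axis[of "r *\<^sub>R axis 1 1" r a] r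
    by (simp add: profile_def)
  then have "partial_deriv 1 (partial_deriv 1 u) (r *\<^sub>R axis 1 1) = - profile' u r / r - r powr a * pw p (profile u r)"
    by simp
  then show ?thesis using profile'_deriv[of r] r by simp
qed

lemma profile_cont: "continuous_on {0..1} (profile u)"
  unfolding profile_def
  by (rule continuous_on_compose2[OF solution_regularity(5)[OF sol]]) (auto intro!: continuous_intros)

lemma profile_emden: "emden p a 1 (profile u) (profile' u)"
  unfolding emden_def
proof (intro conjI allI impI)
  show "continuous_on {0..<1} (profile u)" by (rule continuous_on_subset[OF profile_cont]) auto
  have "isCont (profile' u) 0" using profile'_deriv[of 0] DERIV_isCont by force
  then have "(profile' u \<longlongrightarrow> profile' u 0) (at 0)" by (simp add: isCont_def)
  moreover have "profile' u 0 = 0" using gradient_zero unfolding profile'_def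
    by (metis gradient_nth scale_zero_left zero_index)
  ultimately show "(profile' u \<longlongrightarrow> 0) (at_right 0)" by (simp add: filterlim_at_split)
qed (use profile_deriv profile_ode in auto)

end

section \<open>Lower bound for the radial Morse index\<close>

text \<open>A continuously differentiable approximation of the identity that vanishes on \<open>[-e, e\<close>]. For
  \<open>|s| \<ge> e\<close> its derivative is \<open>1 - e^2 / s^2\<close>, which lies between \<open>0\<close> and \<open>1\<close> and
  vanishes at the two ends of the interval. The maximum in \<open>trunc'\<close> covers all cases by one
  formula.\<close>
definition trunc :: "real \<Rightarrow> real \<Rightarrow> real" where
  "trunc e s = (if \<bar>s\<bar> \<le> e then 0 else (\<bar>s\<bar> - e)\<^sup>2 / s)"

definition trunc' :: "real \<Rightarrow> real \<Rightarrow> real" where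
  "trunc' e s = 1 - e\<^sup>2 / (max \<bar>s\<bar> e)\<^sup>2"

lemma trunc'_bounds: "0 < e \<Longrightarrow> 0 \<le> trunc' e s" "0 < e \<Longrightarrow> trunc' e s \<le> 1"
proof -
  assume e: "0 < e"
  have "e\<^sup>2 \<le> (max \<bar>s\<bar> e)\<^sup>2" "0 < (max \<bar>s\<bar> e)\<^sup>2" using e by (auto intro!: power_mono)
  then show "0 \<le> trunc' e s" "trunc' e s \<le> 1" by (auto simp: trunc'_def divide_le_eq_1)
qed

lemma trunc'_zero: "0 < e \<Longrightarrow> \<bar>s\<bar> \<le> e \<Longrightarrow> trunc' e s = 0"
  by (simp add: trunc'_def max_def)

lemma trunc'_cont: "0 < e \<Longrightarrow> continuous_on S (trunc' e)"
  unfolding trunc'_def by (intro continuous_intros) auto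

lemma trunc_minus: "trunc e (- s) = - trunc e s"
  by (simp add: trunc_def)

lemma trunc'_minus: "trunc' e (- s) = trunc' e s"
  by (simp add: trunc'_def)

lemma trunc_bound:
  assumes e: "0 < e"
  shows "0 \<le> s * trunc e s" "s * trunc e s \<le> s\<^sup>2" "s\<^sup>2 - 4 * e * \<bar>s\<bar> \<le> (trunc e s)\<^sup>2" "\<bar>s - trunc e s\<bar> \<le> 2 * e"
    "\<bar>trunc e s\<bar> \<le> \<bar>s\<bar>"
proof -
  have *: "0 \<le> s * trunc e s \<and> s * trunc e s \<le> s\<^sup>2 \<and> s\<^sup>2 - 4 * e * \<bar>s\<bar> \<le> (trunc e s)\<^sup>2 \<and> \<bar>s - trunc e s\<bar> \<le> 2 * e \<and> \<bar>trunc e s\<bar> \<le> \<bar>s\<bar>"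
    if s: "0 \<le> s" for s
  proof (cases "s \<le> e")
    case True
    have "s * s \<le> e * s" using True s by (intro mult_right_mono) auto
    moreover have "0 \<le> e * s" using e s by simp
    ultimately have "s * s \<le> 4 * (e * s)" by linarith
    then show ?thesis using True s e by (simp add: trunc_def power2_eq_square mult.assoc)
  next
    case False
    then have "0 < s" using e by linarith
    then have t: "trunc e s = s - 2 * e + e\<^sup>2 / s" using False by (simp add: trunc_def field_simps power2_eq_square)
    have "e\<^sup>2 / s \<le> e" using False e s by (simp add: divide_le_eq power2_eq_square)
    moreover have "0 \<le> e\<^sup>2 / s" using s by simp
    ultimately have b: "s - 2 * e \<le> trunc e s" "trunc e s \<le> s" using t e by auto
    have p: "0 \<le> trunc e s" using s False by (simp add: trunc_def)
    have "s\<^sup>2 - 4 * e * s \<le> (trunc e s)\<^sup>2"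
    proof (cases "2 * e \<le> s")
      case True
      have "(s - 2 * e)\<^sup>2 \<le> (trunc e s)\<^sup>2" using b True by (intro power_mono) auto
      moreover have "(s - 2 * e)\<^sup>2 = s\<^sup>2 - 4 * e * s + 4 * e\<^sup>2" by (simp add: power2_eq_square algebra_simps)
      ultimately show ?thesis using zero_le_power2[of e] by linarith
    next
      case False
      have "s * s \<le> (4 * e) * s" using False s e by (intro mult_right_mono) auto
      then show ?thesis using zero_le_power2[of "trunc e s"] unfolding power2_eq_square[of s] by linarith
    qed
    moreover have "0 \<le> s * trunc e s" "s * trunc e s \<le> s * s" using p b s by (auto intro: mult_left_mono)
    ultimately show ?thesis using b p s by (auto simp: power2_eq_square)
  qed
  consider "0 \<le> s" | "0 \<le> - s" by linarith
  then show "0 \<le> s * trunc e s" "s * trunc e s \<le> s\<^sup>2" "s\<^sup>2 - 4 * e * \<bar>s\<bar> \<le> (trunc e s)\<^sup>2" "\<bar>s - trunc e s\<bar> \<le> 2 * e"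
     "\<bar>trunc e s\<bar> \<le> \<bar>s\<bar>"
    by (cases; use *[of s] *[of "- s"] in \<open>auto simp: trunc_minus\<close>)+
qed

text \<open>At \<open>s = e\<close> the difference quotient is \<open>0\<close> on one side and \<open>h / (e + h)\<close> on the other.
  Oddness reduces negative \<open>s\<close> to positive ones.\<close>
lemma trunc_deriv:
  assumes e: "0 < e"
  shows "(trunc e has_real_derivative trunc' e s) (at s)"
proof -
  have pos: "(trunc e has_real_derivative trunc' e s) (at s)" if s: "0 \<le> s" for s
  proof -
    consider "s < e" | "s = e" | "e < s" by linarith
    then show ?thesis
    proof cases
      case 1
      have "((\<lambda>_. 0) has_real_derivative trunc' e s) (at s)" using 1 s e by (simp add: trunc'_zero)
      then show ?thesis
        by (rule has_field_derivative_transform_within_open[of _ _ _ "{-e<..<e}"]) (use 1 s e in \<open>auto simp: trunc_def\<close>)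
    next
      case 2
      have "((\<lambda>h. (trunc e (e + h) - trunc e e) / h) \<longlongrightarrow> 0) (at 0)"
      proof (rule Lim_null_comparison)
        show "((\<lambda>h. \<bar>h\<bar> / e) \<longlongrightarrow> 0) (at 0)" by (auto intro!: tendsto_eq_intros simp: e less_imp_neq[OF e, symmetric])
        have "norm ((trunc e (e + h) - trunc e e) / h) \<le> \<bar>h\<bar> / e" if h: "- e < h" "h \<noteq> 0" for h
        proof (cases "h \<le> 0")
          case True
          then show ?thesis using h e by (simp add: trunc_def divide_nonpos_pos)
        next
          case False
          then have "(trunc e (e + h) - trunc e e) / h = h / (e + h)" using e by (simp add: trunc_def power2_eq_square)
          then show ?thesis using False e by (simp add: frac_le)
        qed
        then show "eventually (\<lambda>h. norm ((trunc e (e + h) - trunc e e) / h) \<le> \<bar>h\<bar> / e) (at 0)"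
          unfolding eventually_at_topological using e by (intro exI[of _ "{-e<..}"]) auto
      qed
      then show ?thesis using 2 e by (simp add: DERIV_def trunc'_zero)
    next
      case 3
      have "((\<lambda>s. (s - e)\<^sup>2 / s) has_real_derivative trunc' e s) (at s)"
        using 3 e by (auto intro!: derivative_eq_intros simp: trunc'_def field_simps power2_eq_square max_def)
      then show ?thesis
        by (rule has_field_derivative_transform_within_open[of _ _ _ "{e<..}"]) (use 3 s e in \<open>auto simp: trunc_def\<close>)
    qed
  qed
  show ?thesis
  proof (cases "0 \<le> s")
    case False
    have "((\<lambda>s. - s) has_real_derivative - 1) (at s)" by (auto intro!: derivative_eq_intros)
    from DERIV_chain2[OF pos this] False
    have "((\<lambda>s. trunc e (- s)) has_real_derivative trunc' e (- s) * - 1) (at s)" by simp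
    from DERIV_minus[OF this] show ?thesis by (simp add: trunc_minus trunc'_minus)
  qed (rule pos)
qed

lemma compact_in_disc:
  assumes "compact K" "K \<subseteq> unit_disc"
  obtains \<rho> where "\<rho> < 1" "\<And>x. x \<in> K \<Longrightarrow> norm x \<le> \<rho>"
proof (cases "K = {}")
  case False
  obtain y where "y \<in> K" "\<And>x. x \<in> K \<Longrightarrow> norm x \<le> norm y"
    using continuous_attains_sup[OF assms(1) False continuous_on_norm_id] by blast
  then show ?thesis using assms(2) by (intro that[of "norm y"]) auto
qed (use that[of 0] in auto)

text \<open>\<open>C\<close> and the complement of \<open>K\<close> are open and cover the plane, and the extended function is
  differentiable on each of them.\<close>
lemma c1c_glue:
  assumes C: "open C" "C \<subseteq> unit_disc" and K: "compact K" "K \<subseteq> C"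
    and d: "\<And>x. x \<in> C \<Longrightarrow> (\<Phi> has_derivative (\<lambda>h. \<Psi> x \<bullet> h)) (at x)" and c: "continuous_on C \<Psi>"
    and z: "\<And>x. x \<in> C \<Longrightarrow> x \<notin> K \<Longrightarrow> \<Phi> x = 0"
  shows "c1c (\<lambda>x. if x \<in> C then \<Phi> x else 0) (\<lambda>x. if x \<in> C then \<Psi> x else 0)"
proof -
  let ?f = "\<lambda>x. if x \<in> C then \<Phi> x else 0" and ?g = "\<lambda>x. if x \<in> C then \<Psi> x else 0"
  have oK: "open (- K)" using K(1) by (simp add: compact_imp_closed open_Compl)
  have z': "\<Psi> x = 0" if x: "x \<in> C" "x \<notin> K" for x
  proof -
    have "((\<lambda>y. 0) has_derivative (\<lambda>h. \<Psi> x \<bullet> h)) (at x)"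
      by (rule has_derivative_transform_within_open[OF d[OF x(1)], of "C - K"]) 
        (use C(1) oK x z in \<open>auto simp: Diff_eq intro: open_Int\<close>)
    from has_derivative_unique[OF this has_derivative_const[of 0]] have "\<Psi> x \<bullet> \<Psi> x = 0" by (rule fun_cong)
    then show ?thesis by simp
  qed
  obtain \<rho> where \<rho>: "\<rho> < 1" "\<And>x. x \<in> K \<Longrightarrow> norm x \<le> \<rho>" using compact_in_disc[OF K(1)] K(2) C(2) by blast
  show ?thesis
  proof (rule c1cI)
    show "(?f has_derivative (\<lambda>h. ?g x \<bullet> h)) (at x)" for x
    proof (cases "x \<in> C")
      case True
      show ?thesis
        by (rule has_derivative_transform_within_open[of \<Phi> _ _ _ C]) (use d True C in auto)
    next
      case False
      have "((\<lambda>y. 0) has_derivative (\<lambda>h. ?g x \<bullet> h)) (at x)" using False by simp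
      then show ?thesis
        by (rule has_derivative_transform_within_open[OF _ oK]) (use False K z in auto)
    qed
    have "continuous_on C ?g" by (rule continuous_on_eq[OF c]) auto
    moreover have "continuous_on (- K) ?g" by (rule continuous_on_eq[of _ "\<lambda>x. 0"]) (auto simp: z')
    ultimately have "continuous_on (C \<union> - K) ?g" using C(1) oK by (intro continuous_on_open_Un)
    moreover have "C \<union> - K = UNIV" using K(2) by auto
    ultimately show "continuous_on UNIV ?g" by simp
    show "(1 + \<rho>) / 2 < 1" using \<rho> by simp
    show "?f x = 0" if "(1 + \<rho>) / 2 \<le> norm x" for x
      using \<rho> z[of x] that by (cases "x \<in> K") (force+)
  qed
qed

lemma cont_powr:
  assumes "continuous_on S f" "\<And>x. x \<in> S \<Longrightarrow> 0 \<le> f x" "0 < c"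
  shows "continuous_on S (\<lambda>x. (f x :: real) powr c)"
  by (rule continuous_on_powr'[OF assms(1) continuous_on_const]) (use assms in auto)

lemma henon_weight_cont: "0 \<le> a \<Longrightarrow> continuous_on S (henon_weight a)"
  unfolding henon_weight_def
  by (cases "a = 0") (simp_all add: cont_powr continuous_on_norm continuous_on_id)

lemma henon_weight_nonneg: "0 \<le> henon_weight a x"
  by (simp add: henon_weight_def)

lemma henon_weight_pos: "x \<noteq> 0 \<Longrightarrow> 0 < henon_weight a x"
  by (simp add: henon_weight_def)

lemma potential_cont:
  assumes "1 < p" "0 \<le> a" "continuous_on S u"
  shows "continuous_on S (potential p a u)"
  unfolding potential_def
  by (intro continuous_on_mult henon_weight_cont cont_powr continuous_on_rabs) (use assms in auto)

lemma potential_nonneg: "0 \<le> potential p a u x"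
  by (simp add: potential_def henon_weight_nonneg)

lemma potential_pw: "potential p a u x * u x = henon_weight a x * pw p (u x)"
  by (simp add: potential_def pw_def)

lemma continuous_cball_bounded:
  assumes "continuous_on (cball (0::real^2) 1) f"
  obtains M :: real where "\<And>x. x \<in> unit_disc \<Longrightarrow> \<bar>f x\<bar> \<le> M"
proof -
  have "compact (f ` cball 0 1)" by (intro compact_continuous_image assms) auto
  then obtain M where "\<forall>y\<in>f ` cball 0 1. norm y \<le> M" using compact_imp_bounded bounded_iff by metis
  then show ?thesis using that[of M] by auto
qed

lemma potential_bounded:
  assumes "1 < p" "0 \<le> a" "continuous_on (cball 0 1) u"
  obtains M where "potential p a u \<in> borel_measurable disc"
    "\<And>x. x \<in> unit_disc \<Longrightarrow> 0 \<le> potential p a u x \<and> potential p a u x \<le> M"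
proof -
  have c: "continuous_on (cball 0 1) (potential p a u)" by (rule potential_cont[OF assms])
  obtain M where M: "\<And>x. x \<in> unit_disc \<Longrightarrow> \<bar>potential p a u x\<bar> \<le> M" using continuous_cball_bounded[OF c] by blast
  show ?thesis
    using that[of M] M potential_nonneg meas_disc[OF continuous_on_subset[OF c]] by (force simp: abs_le_iff)
qed

lemma solution_form:
  assumes "1 < p" "0 \<le> a" "henon_solution p a u" "c1c f g"
  shows "qform p (potential p a u) f g = (LINT x|disc. (norm (g x))\<^sup>2 - p * (potential p a u x * (f x)\<^sup>2))"
    and "integrable disc (\<lambda>x. (norm (g x))\<^sup>2 - p * (potential p a u x * (f x)\<^sup>2))"
proof -
  obtain M where "potential p a u \<in> borel_measurable disc"
      "\<And>x. x \<in> unit_disc \<Longrightarrow> 0 \<le> potential p a u x \<and> potential p a u x \<le> M"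
    using potential_bounded[OF assms(1,2) solution_regularity(5)[OF assms(3)]] by blast
  then have W: "potential p a u \<in> borel_measurable disc" "\<And>x. x \<in> unit_disc \<Longrightarrow> \<bar>potential p a u x\<bar> \<le> M"
    by auto
  show "qform p (potential p a u) f g = (LINT x|disc. (norm (g x))\<^sup>2 - p * (potential p a u x * (f x)\<^sup>2))"
    "integrable disc (\<lambda>x. (norm (g x))\<^sup>2 - p * (potential p a u x * (f x)\<^sup>2))"
    by (rule qform_integral[OF W c1c_in_L2(1)[OF assms(4)]], assumption, rule c1c_in_L2(2)[OF assms(4)])+
qed

text \<open>A circle is connected, and it lies in the nodal domain as soon as one of its points does.\<close>
lemma component_radial:
  assumes "radial u" "C \<in> components {x\<in>unit_disc. u x \<noteq> 0}" "x \<in> C" "norm y = norm x"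
  shows "y \<in> C"
proof -
  let ?N = "{x\<in>unit_disc. u x \<noteq> 0}"
  have xN: "x \<in> ?N" using in_components_subset[OF assms(2)] assms(3) by blast
  have "sphere 0 (norm x) \<subseteq> ?N"
  proof
    fix z :: "real^2" assume "z \<in> sphere 0 (norm x)"
    then have "norm z = norm x" by simp
    moreover from this have "z \<in> unit_disc" "u z = u x"
      using xN assms(1) unfolding radial_def by auto
    ultimately show "z \<in> ?N" using xN by simp
  qed
  moreover have "connected (sphere (0::real^2) (norm x))" by (intro connected_sphere) simp
  moreover have "C \<inter> sphere 0 (norm x) \<noteq> {}" using assms(3) by auto
  ultimately have "sphere 0 (norm x) \<subseteq> C" using components_maximal[OF assms(2)] by blast
  then show ?thesis using assms(4) by auto
qed

lemma AE_disc_open_zero: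
  assumes "AE x in disc. x \<notin> S" "open S" "S \<subseteq> unit_disc"
  shows "S = {}"
proof -
  have "AE x in lebesgue. x \<in> unit_disc \<longrightarrow> x \<notin> S" using assms(1) by (subst (asm) AE_restrict_space_iff) auto
  then have "AE x in lebesgue. x \<notin> S" by (rule AE_mp[OF _ AE_I2]) (use assms(3) in auto)
  then have "S \<in> null_sets lebesgue" using AE_iff_null_sets[of S lebesgue] assms(2) by (simp add: borel_open)
  then have "negligible S" using negligible_iff_null_sets by blast
  then show ?thesis using open_not_negligible assms(2) by blast
qed

context
  fixes p a :: real and u :: "real^2 \<Rightarrow> real"
  assumes p: "1 < p" and a: "0 \<le> a" and sol: "henon_solution p a u"
begin

abbreviation (input) nodal :: "(real^2) set" where "nodal \<equiv> {x\<in>unit_disc. u x \<noteq> 0}"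

lemma solution_cont: "continuous_on unit_disc u"
  by (rule continuous_on_subset[OF solution_regularity(5)[OF sol]]) auto

lemma open_nodal: "open nodal"
proof -
  have "open (unit_disc \<inter> u -` (- {0}))" by (rule continuous_open_preimage[OF solution_cont]) auto
  moreover have "nodal = unit_disc \<inter> u -` (- {0})" by auto
  ultimately show ?thesis by metis
qed

text \<open>The compactness statement is what makes truncations have compact support in a nodal set: a
  component is relatively closed, and the level sets of \<open>u\<close> stay away from the unit circle,
  where \<open>u\<close> vanishes.\<close>
lemma nodal_component:
  assumes "C \<in> components nodal"
  shows "open C" "C \<subseteq> unit_disc" "C \<noteq> {}" "\<And>x. x \<in> C \<Longrightarrow> u x \<noteq> 0"
    "\<And>e. 0 < e \<Longrightarrow> compact {x \<in> C. e \<le> \<bar>u x\<bar>}"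
proof -
  show "open C" by (rule open_components[OF open_nodal assms])
  have sub: "C \<subseteq> nodal" by (rule in_components_subset[OF assms])
  then show "C \<subseteq> unit_disc" "\<And>x. x \<in> C \<Longrightarrow> u x \<noteq> 0" by auto
  show "C \<noteq> {}" by (rule in_components_nonempty[OF assms])
  fix e :: real assume e: "0 < e"
  obtain T where T: "closed T" "C = nodal \<inter> T"
    using closedin_component[OF assms] unfolding closedin_closed by blast
  have "closed (cball 0 1 \<inter> u -` {y. e \<le> \<bar>y\<bar>})"
    by (rule continuous_closed_preimage[OF solution_regularity(5)[OF sol]])
      (auto intro!: closed_Collect_le continuous_intros)
  then have "compact (T \<inter> (cball 0 1 \<inter> u -` {y. e \<le> \<bar>y\<bar>}))"
    unfolding compact_eq_bounded_closed
    using bounded_subset[OF bounded_cball[of "0::real^2" 1]] closed_Int[OF T(1)] by blast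
  moreover have "{x \<in> C. e \<le> \<bar>u x\<bar>} = T \<inter> (cball 0 1 \<inter> u -` {y. e \<le> \<bar>y\<bar>})"
  proof -
    have "norm x < 1" if "norm x \<le> 1" "e \<le> \<bar>u x\<bar>" for x
      using that solution_regularity(7)[OF sol, of x] e by (cases "norm x = 1") auto
    then show ?thesis using T(2) e by auto
  qed
  ultimately show "compact {x \<in> C. e \<le> \<bar>u x\<bar>}" by simp
qed

definition trunc_sol :: "real \<Rightarrow> (real^2) set \<Rightarrow> real^2 \<Rightarrow> real" where
  "trunc_sol e C x = (if x \<in> C then trunc e (u x) else 0)"
definition trunc_grad :: "real \<Rightarrow> (real^2) set \<Rightarrow> real^2 \<Rightarrow> real^2" where
  "trunc_grad e C x = (if x \<in> C then trunc' e (u x) *\<^sub>R gradient u x else 0)"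

lemma gradient_cont: "continuous_on unit_disc (gradient u)"
  unfolding gradient_def by (intro continuous_on_vec_lambda solution_regularity(4)[OF sol])

lemma trunc_comp_deriv:
  assumes "0 < e" "x \<in> unit_disc"
  shows "((\<lambda>x. trunc e (u x)) has_derivative (\<lambda>h. (trunc' e (u x) *\<^sub>R gradient u x) \<bullet> h)) (at x)"
  using has_derivative_compose[OF solution_regularity(1)[OF sol assms(2)]
      trunc_deriv[OF assms(1), THEN has_field_derivative_imp_has_derivative]] by simp

lemma trunc'_comp_cont: "0 < e \<Longrightarrow> continuous_on unit_disc (\<lambda>x. trunc' e (u x))"
  by (rule continuous_on_compose2[OF trunc'_cont solution_cont]) auto

lemma trunc_sol_c1c:
  assumes e: "0 < e" and C: "C \<in> components nodal"
  shows "c1c (trunc_sol e C) (trunc_grad e C)"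
  unfolding trunc_sol_def trunc_grad_def
proof (rule c1c_glue[OF nodal_component(1,2)[OF C] nodal_component(5)[OF C e]])
  show "((\<lambda>x. trunc e (u x)) has_derivative (\<lambda>h. (trunc' e (u x) *\<^sub>R gradient u x) \<bullet> h)) (at x)" if "x \<in> C" for x
    using trunc_comp_deriv[OF e] nodal_component(2)[OF C] that by blast
  show "continuous_on C (\<lambda>x. trunc' e (u x) *\<^sub>R gradient u x)"
    by (rule continuous_on_subset[OF _ nodal_component(2)[OF C]])
      (intro continuous_intros trunc'_comp_cont e gradient_cont)
qed (auto simp: trunc_def)

text \<open>The equation tested with the truncated solution: the integrand is the divergence of the
  truncated solution times the gradient of \<open>u\<close>.\<close>
lemma trunc_sol_identity:
  assumes e: "0 < e" and C: "C \<in> components nodal"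
  shows "(LINT x|disc. (if x \<in> C then trunc' e (u x) * (norm (gradient u x))\<^sup>2
            - potential p a u x * u x * trunc e (u x) else 0)) = 0"
    and "integrable disc (\<lambda>x. if x \<in> C then trunc' e (u x) * (norm (gradient u x))\<^sup>2
            - potential p a u x * u x * trunc e (u x) else 0)"
proof -
  let ?Phi = "\<lambda>i x. trunc e (u x) * partial_deriv i u x"
  let ?Psi = "\<lambda>i x. trunc e (u x) *\<^sub>R gradient (partial_deriv i u) x + partial_deriv i u x *\<^sub>R (trunc' e (u x) *\<^sub>R gradient u x)"
  let ?G = "\<lambda>i x. if x \<in> C then ?Psi i x else 0"
  have Cs: "C \<subseteq> unit_disc" by (rule nodal_component(2)[OF C])
  have c: "c1c (\<lambda>x. if x \<in> C then ?Phi i x else 0) (?G i)" for i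
  proof (rule c1c_glue[OF nodal_component(1,2)[OF C] nodal_component(5)[OF C e]])
    show "(?Phi i has_derivative (\<lambda>h. ?Psi i x \<bullet> h)) (at x)" if "x \<in> C" for x
      by (rule has_derivative_eq_rhs[OF has_derivative_mult[OF trunc_comp_deriv[OF e] solution_regularity(2)[OF sol]]])
        (use that Cs in \<open>auto simp: inner_add_left mult.commute\<close>)
    have tc: "continuous_on unit_disc (\<lambda>x. trunc e (u x))"
      by (intro continuous_at_imp_continuous_on ballI has_derivative_continuous[OF trunc_comp_deriv[OF e]])
    have "continuous_on unit_disc (gradient (partial_deriv i u))"
      unfolding gradient_def by (intro continuous_on_vec_lambda solution_regularity(3)[OF sol])
    then have "continuous_on unit_disc (?Psi i)"
      by (intro continuous_intros trunc'_comp_cont tc e gradient_cont solution_regularity(4)[OF sol])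
    then show "continuous_on C (?Psi i)" by (rule continuous_on_subset[OF _ Cs])
  qed (auto simp: trunc_def)
  have gc: "continuous_on UNIV (\<lambda>x. ?G i x $ i)" for i
    using c[of i] unfolding c1c_def by (intro continuous_on_component) blast
  have eq: "(if x \<in> C then trunc' e (u x) * (norm (gradient u x))\<^sup>2 - potential p a u x * u x * trunc e (u x) else 0)
      = ?G 1 x $ 1 + ?G 2 x $ 2" for x
  proof (cases "x \<in> C")
    case True
    have "partial_deriv 1 (partial_deriv 1 u) x + partial_deriv 2 (partial_deriv 2 u) x = - (potential p a u x * u x)"
      using solution_regularity(6)[OF sol] True Cs by (auto simp: potential_pw)
    then have "- (potential p a u x * u x) * trunc e (u x)
        = trunc e (u x) * partial_deriv 1 (partial_deriv 1 u) x + trunc e (u x) * partial_deriv 2 (partial_deriv 2 u) x"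
      by (metis distrib_left mult.commute)
    then show ?thesis unfolding norm2_sq using True by (simp add: power2_eq_square algebra_simps)
  qed simp
  show "integrable disc (\<lambda>x. if x \<in> C then trunc' e (u x) * (norm (gradient u x))\<^sup>2
            - potential p a u x * u x * trunc e (u x) else 0)"
    unfolding eq by (intro Bochner_Integration.integrable_add integrable_disc gc)
  show "(LINT x|disc. (if x \<in> C then trunc' e (u x) * (norm (gradient u x))\<^sup>2
            - potential p a u x * u x * trunc e (u x) else 0)) = 0"
    unfolding eq using int_partial_zero[OF c, of 1 1] int_partial_zero[OF c, of 2 2]
    by (subst Bochner_Integration.integral_add) (auto intro!: integrable_disc gc)
qed

text \<open>Since \<open>0 \<le> trunc' \<le> 1\<close>, the energy of the truncation is at most \<open>\<integral> W u
  (trunc e u)\<close> by the tested equation. Hence the form is at most \<open>(1 - p) \<integral> W u^2\<close>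
  plus an error of order \<open>e\<close>.\<close>
lemma trunc_sol_negative:
  assumes C: "C \<in> components nodal"
  obtains e0 where "0 < e0" "\<And>e. 0 < e \<Longrightarrow> e \<le> e0 \<Longrightarrow> qform p (potential p a u) (trunc_sol e C) (trunc_grad e C) < 0"
proof -
  let ?W = "potential p a u"
  have Cs: "C \<subseteq> unit_disc" and oC: "open C" by (rule nodal_component[OF C])+
  obtain M where W: "?W \<in> borel_measurable disc" "\<And>x. x \<in> unit_disc \<Longrightarrow> 0 \<le> ?W x \<and> ?W x \<le> M"
    using potential_bounded[OF p a solution_regularity(5)[OF sol]] by blast
  have Wb: "\<bar>?W x\<bar> \<le> M" if "x \<in> unit_disc" for x using W(2)[OF that] by auto
  obtain Mu where Mu: "\<And>x. x \<in> unit_disc \<Longrightarrow> \<bar>u x\<bar> \<le> Mu"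
    using continuous_cball_bounded[OF solution_regularity(5)[OF sol]] by blast
  have M0: "0 \<le> M" "0 \<le> Mu" using W(2)[of 0] Mu[of 0] by auto
  have um: "u \<in> borel_measurable disc" by (rule meas_disc[OF solution_cont])
  have Cm: "indicator C \<in> borel_measurable disc"
  proof -
    have "indicator C \<in> borel_measurable (lebesgue :: (real^2) measure)"
      using oC by (intro borel_measurable_indicator) (simp add: borel_open)
    then show ?thesis by (rule measurable_restrict_space1)
  qed
  define A where "A x = ?W x * (indicator C x * (u x)\<^sup>2)" for x
  define B where "B x = ?W x * (indicator C x * \<bar>u x\<bar>)" for x
  have iu2: "integrable disc (\<lambda>x. indicator C x * (u x)\<^sup>2)"
  proof (rule integrable_disc_bounded[of _ "Mu\<^sup>2"])
    show "\<bar>indicator C x * (u x)\<^sup>2\<bar> \<le> Mu\<^sup>2" if "x \<in> unit_disc" for x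
      using power_mono[OF Mu[OF that], of 2] by (auto simp: indicator_def)
  qed (intro borel_measurable_times borel_measurable_power um Cm)
  have iA: "integrable disc A" unfolding A_def by (rule integrable_weight_mult[OF W(1) Wb iu2])
  have iu: "integrable disc (\<lambda>x. indicator C x * \<bar>u x\<bar>)"
  proof (rule integrable_disc_bounded[of _ Mu])
    show "\<bar>indicator C x * \<bar>u x\<bar>\<bar> \<le> Mu" if "x \<in> unit_disc" for x
      using Mu[OF that] M0 by (auto simp: indicator_def)
  qed (intro borel_measurable_times borel_measurable_abs um Cm)
  have iB: "integrable disc B" unfolding B_def by (rule integrable_weight_mult[OF W(1) Wb iu])
  have A0: "0 \<le> A x" for x unfolding A_def using potential_nonneg by simp
  have B0: "0 \<le> B x" for x unfolding B_def using potential_nonneg by simp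
  have Apos: "0 < (LINT x|disc. A x)"
  proof (rule ccontr)
    assume "\<not> 0 < (LINT x|disc. A x)"
    then have "(LINT x|disc. A x) = 0" using A0 by (simp add: antisym Bochner_Integration.integral_nonneg not_less)
    then have "AE x in disc. A x = 0" using integral_nonneg_eq_0_iff_AE[OF iA] A0 by simp
    then have "AE x in disc. x \<notin> C - {0}"
    proof (rule AE_mp, intro AE_I2 impI notI)
      fix x assume x: "A x = 0" "x \<in> C - {0}"
      then have "0 < ?W x" "u x \<noteq> 0"
        using nodal_component(4)[OF C] henon_weight_pos[of x a] by (auto simp: potential_def)
      then show False using x by (simp add: A_def)
    qed
    moreover have "open (C - {0})" using oC by (simp add: open_delete)
    ultimately have "C - {0} = {}" using AE_disc_open_zero[of "C - {0}"] Cs by blast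
    then have "C = {0}" using nodal_component(3)[OF C] by auto
    then show False using oC not_open_singleton by blast
  qed
  define b where "b = (LINT x|disc. B x)"
  have b0: "0 \<le> b" unfolding b_def using B0 by simp
  \<comment> \<open>The error term is \<open>4 p e b\<close>; it has to stay below \<open>(p - 1) \<integral> A\<close>.\<close>
  define e0 where "e0 = (p - 1) * (LINT x|disc. A x) / (4 * p * (b + 1))"
  show ?thesis
  proof (rule that)
    show "0 < e0" using p Apos b0 by (simp add: e0_def)
    fix e :: real assume e: "0 < e" "e \<le> e0"
    have tc: "c1c (trunc_sol e C) (trunc_grad e C)" by (rule trunc_sol_c1c[OF e(1) C])
    let ?I = "\<lambda>x. if x \<in> C then trunc' e (u x) * (norm (gradient u x))\<^sup>2 - ?W x * u x * trunc e (u x) else 0"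
    note I = trunc_sol_identity[OF e(1) C]
    note q = solution_form[OF p a sol tc]
    have "qform p ?W (trunc_sol e C) (trunc_grad e C) \<le> (LINT x|disc. ?I x - (p - 1) * A x + (4 * p * e) * B x)"
      unfolding q(1)
    proof (rule integral_mono[OF q(2)])
      show "integrable disc (\<lambda>x. ?I x - (p - 1) * A x + (4 * p * e) * B x)"
        using I(2) iA iB by (intro Bochner_Integration.integrable_add Bochner_Integration.integrable_diff) auto
      fix x
      show "(norm (trunc_grad e C x))\<^sup>2 - p * (?W x * (trunc_sol e C x)\<^sup>2) \<le> ?I x - (p - 1) * A x + (4 * p * e) * B x"
      proof (cases "x \<in> C")
        case True
        have t: "0 \<le> trunc' e (u x)" "trunc' e (u x) \<le> 1" using trunc'_bounds[OF e(1)] by auto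
        have "(trunc' e (u x))\<^sup>2 \<le> trunc' e (u x)" using t by (simp add: power2_eq_square mult_left_le)
        then have 1: "(norm (trunc_grad e C x))\<^sup>2 \<le> trunc' e (u x) * (norm (gradient u x))\<^sup>2"
          using True t by (simp add: trunc_grad_def power_mult_distrib mult_right_mono)
        have "u x * trunc e (u x) - p * (trunc e (u x))\<^sup>2 \<le> (u x)\<^sup>2 - p * ((u x)\<^sup>2 - 4 * e * \<bar>u x\<bar>)"
          using trunc_bound(2,3)[OF e(1), of "u x"] p by (intro diff_mono mult_left_mono) auto
        then have "?W x * (u x * trunc e (u x) - p * (trunc e (u x))\<^sup>2) \<le> ?W x * ((u x)\<^sup>2 - p * ((u x)\<^sup>2 - 4 * e * \<bar>u x\<bar>))"
          by (rule mult_left_mono[OF _ potential_nonneg])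
        with 1 show ?thesis using True by (simp add: trunc_sol_def A_def B_def algebra_simps)
      next
        case False
        then show ?thesis by (simp add: trunc_grad_def trunc_sol_def A_def B_def)
      qed
    qed
    also have "\<dots> = - ((p - 1) * (LINT x|disc. A x)) + (4 * p * e) * b"
      using I iA iB by (simp add: b_def)
    also have "\<dots> < 0"
    proof -
      have P: "0 < 4 * p * (b + 1)" using p b0 by simp
      then have "e * (4 * p * (b + 1)) \<le> (p - 1) * (LINT x|disc. A x)"
        using e(2) unfolding e0_def by (simp add: pos_le_divide_eq)
      moreover have "(4 * p * e) * b < e * (4 * p * (b + 1))" using p e by (simp add: algebra_simps)
      ultimately show ?thesis by simp
    qed
    finally show "qform p ?W (trunc_sol e C) (trunc_grad e C) < 0" .
  qed
qed

text \<open>The truncations to different nodal sets have disjoint supports, so the form is diagonal on their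
  span.\<close>
lemma radial_morse_index_lower:
  assumes rad: "radial u" and n: "num_nodal_sets u = n" "1 \<le> n"
  shows "enat n \<le> radial_morse_index p a u"
proof -
  let ?W = "potential p a u"
  let ?N = "components nodal"
  have cN: "card ?N = n" using n(1) by (simp add: num_nodal_sets_def)
  have fN: "finite ?N" using cN n(2) card_ge_0_finite by force
  obtain C where C: "bij_betw C {..<n} ?N"
    using ex_bij_betw_nat_finite[OF fN] cN by (auto simp: atLeast0LessThan)
  have CN: "C j \<in> ?N" if "j < n" for j using C that by (auto simp: bij_betw_def)
  have Cdisj: "C i \<inter> C j = {}" if "i < n" "j < n" "i \<noteq> j" for i j
  proof -
    have "C i \<noteq> C j" using C that by (auto simp: bij_betw_def inj_on_def)
    then show ?thesis using components_nonoverlap[OF CN[OF that(1)] CN[OF that(2)]] by simp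
  qed
  have "\<forall>D\<in>?N. \<exists>e0. 0 < e0 \<and> (\<forall>e. 0 < e \<and> e \<le> e0 \<longrightarrow> qform p ?W (trunc_sol e D) (trunc_grad e D) < 0)"
  proof
    fix D assume "D \<in> ?N"
    then show "\<exists>e0. 0 < e0 \<and> (\<forall>e. 0 < e \<and> e \<le> e0 \<longrightarrow> qform p ?W (trunc_sol e D) (trunc_grad e D) < 0)"
      by (rule trunc_sol_negative) blast
  qed
  from bchoice[OF this] obtain E where E': "\<forall>D\<in>?N. 0 < E D \<and> (\<forall>e. 0 < e \<and> e \<le> E D \<longrightarrow> qform p ?W (trunc_sol e D) (trunc_grad e D) < 0)"
    by blast
  have E: "0 < E D" "\<And>e. 0 < e \<Longrightarrow> e \<le> E D \<Longrightarrow> qform p ?W (trunc_sol e D) (trunc_grad e D) < 0" if "D \<in> ?N" for D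
    using E' that by auto
  define e where "e = Min (E ` ?N)"
  have neN: "?N \<noteq> {}"
  proof
    assume "?N = {}"
    with cN n(2) show False by (simp only: card.empty)
  qed
  have e: "0 < e" "\<And>D. D \<in> ?N \<Longrightarrow> e \<le> E D" using E(1) fN neN by (auto simp: e_def)
  let ?f = "\<lambda>j. trunc_sol e (C j)" and ?g = "\<lambda>j. trunc_grad e (C j)"
  have fg: "c1c (?f j) (?g j)" if "j < n" for j by (rule trunc_sol_c1c[OF e(1) CN[OF that]])
  have neg: "qform p ?W (?f j) (?g j) < 0" if "j < n" for j by (rule E(2)[OF CN[OF that] e(1) e(2)[OF CN[OF that]]])
  show ?thesis
    unfolding radial_morse_index_def
  proof (rule neg_def_lower[OF fg])
    fix c :: "nat \<Rightarrow> real"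
    let ?F = "\<lambda>x. \<Sum>j<n. c j * ?f j x" and ?G = "\<lambda>x. \<Sum>j<n. c j *\<^sub>R ?g j x"
    have FG: "c1c ?F ?G" by (rule c1c_sum) (use fg in auto)
    have fr: "?f j x = ?f j y" if "j < n" "x \<in> unit_disc" "y \<in> unit_disc" "norm x = norm y" for j x y
    proof -
      have "x \<in> C j \<longleftrightarrow> y \<in> C j"
        using component_radial[OF rad CN[OF that(1)], of x y] component_radial[OF rad CN[OF that(1)], of y x] that(4) by auto
      moreover have "u x = u y" using rad that(2,3,4) unfolding radial_def by blast
      ultimately show ?thesis by (simp add: trunc_sol_def)
    qed
    have "radial ?F" unfolding radial_def
    proof (intro ballI impI)
      fix x y :: "real^2" assume xy: "x \<in> unit_disc" "y \<in> unit_disc" "norm x = norm y"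
      show "?F x = ?F y" by (rule sum.cong[OF refl]) (simp only: fr[OF _ xy] lessThan_iff)
    qed
    then show "?F \<in> H10_rad" unfolding H10_rad_def using c1c_H10[OF FG] by blast
    assume c: "\<exists>j<n. c j \<noteq> 0"
    have "qform p ?W ?F ?G = (LINT x|disc. (norm (?G x))\<^sup>2 - p * (?W x * (?F x)\<^sup>2))"
      by (rule solution_form(1)[OF p a sol FG])
    also have "\<dots> = (LINT x|disc. (\<Sum>j<n. (c j)\<^sup>2 * ((norm (?g j x))\<^sup>2 - p * (?W x * (?f j x)\<^sup>2))))"
    proof (rule Bochner_Integration.integral_cong[OF refl])
      fix x
      show "(norm (?G x))\<^sup>2 - p * (?W x * (?F x)\<^sup>2) = (\<Sum>j<n. (c j)\<^sup>2 * ((norm (?g j x))\<^sup>2 - p * (?W x * (?f j x)\<^sup>2)))"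
      proof (cases "\<exists>k<n. x \<in> C k")
        case True
        then obtain k where k: "k < n" "x \<in> C k" by blast
        then have z: "?f j x = 0" "?g j x = 0" if "j < n" "j \<noteq> k" for j
          using Cdisj[of j k] that by (auto simp: trunc_sol_def trunc_grad_def)
        have single: "sum h {..<n} = h k" if "\<And>j. j < n \<Longrightarrow> j \<noteq> k \<Longrightarrow> h j = 0" for h :: "nat \<Rightarrow> 'b::comm_monoid_add"
          using k(1) that by (subst sum.remove[of _ k]) auto
        have "?F x = c k * ?f k x" by (rule single) (use z in auto)
        moreover have "?G x = c k *\<^sub>R ?g k x" by (rule single) (use z in auto)
        moreover have "(\<Sum>j<n. (c j)\<^sup>2 * ((norm (?g j x))\<^sup>2 - p * (?W x * (?f j x)\<^sup>2))) =
             (c k)\<^sup>2 * ((norm (?g k x))\<^sup>2 - p * (?W x * (?f k x)\<^sup>2))" by (rule single) (use z in auto)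
        ultimately show ?thesis by (simp add: power_mult_distrib right_diff_distrib mult_ac)
      next
        case False
        then have "?f j x = 0 \<and> ?g j x = 0" if "j < n" for j using that by (auto simp: trunc_sol_def trunc_grad_def)
        then show ?thesis by simp
      qed
    qed
    also have "\<dots> = (\<Sum>j<n. (c j)\<^sup>2 * qform p ?W (?f j) (?g j))"
    proof -
      note q = solution_form[OF p a sol fg]
      show ?thesis
        by (subst Bochner_Integration.integral_sum) (auto intro!: sum.cong simp: q)
    qed
    also have "\<dots> < 0"
    proof -
      obtain k where k: "k < n" "c k \<noteq> 0" using c by blast
      have "(\<Sum>j<n. (c j)\<^sup>2 * qform p ?W (?f j) (?g j)) < (\<Sum>j<n. 0)"
      proof (rule sum_strict_mono_ex1)
        show "\<forall>j\<in>{..<n}. (c j)\<^sup>2 * qform p ?W (?f j) (?g j) \<le> 0"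
        proof
          fix j assume "j \<in> {..<n}"
          then have "qform p ?W (?f j) (?g j) \<le> 0" using neg[of j] by (intro less_imp_le) simp
          then show "(c j)\<^sup>2 * qform p ?W (?f j) (?g j) \<le> 0" by (rule mult_nonneg_nonpos[OF zero_le_power2])
        qed
        show "\<exists>j\<in>{..<n}. (c j)\<^sup>2 * qform p ?W (?f j) (?g j) < 0"
        proof (rule bexI[of _ k])
          show "(c k)\<^sup>2 * qform p ?W (?f k) (?g k) < 0" by (rule mult_pos_neg[OF _ neg[OF k(1)]]) (use k(2) in simp)
        qed (use k(1) in simp)
      qed simp
      then show ?thesis by simp
    qed
    finally show "qform p ?W ?F ?G < 0" .
  qed
qed

end

section \<open>Averaging over rotations\<close>

text \<open>The change-of-variables theorem for vector-valued functions, applied to vectors with one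
  component.\<close>
lemma change_of_variables_real:
  fixes f :: "real^2 \<Rightarrow> real" and g :: "real^2 \<Rightarrow> real^2"
  assumes S: "S \<in> sets lebesgue"
    and der: "\<And>x. x \<in> S \<Longrightarrow> (g has_derivative g' x) (at x within S)" and inj: "inj_on g S"
    and f: "f absolutely_integrable_on (g ` S)"
  shows "(\<lambda>x. \<bar>det (matrix (g' x))\<bar> * f (g x)) absolutely_integrable_on S"
    and "integral S (\<lambda>x. \<bar>det (matrix (g' x))\<bar> * f (g x)) = integral (g ` S) f"
proof -
  have "(\<lambda>x. \<bar>det (matrix (g' x))\<bar> *\<^sub>R vec (f (g x)) :: real^1) absolutely_integrable_on S \<and>
        integral S (\<lambda>x. \<bar>det (matrix (g' x))\<bar> *\<^sub>R vec (f (g x))) = (vec (integral (g ` S) f) :: real^1)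
      \<longleftrightarrow> (\<lambda>x. vec (f x) :: real^1) absolutely_integrable_on (g ` S) \<and>
        integral (g ` S) (\<lambda>x. vec (f x)) = (vec (integral (g ` S) f) :: real^1)"
    by (rule has_absolute_integral_change_of_variables[OF S der inj])
  then have "(\<lambda>x. \<bar>det (matrix (g' x))\<bar> * f (g x)) absolutely_integrable_on S \<and>
      integral S (\<lambda>x. \<bar>det (matrix (g' x))\<bar> * f (g x)) = integral (g ` S) f"
    using f by (simp add: absolutely_integrable_on_1_iff integral_on_1_eq)
  then show "(\<lambda>x. \<bar>det (matrix (g' x))\<bar> * f (g x)) absolutely_integrable_on S"
    "integral S (\<lambda>x. \<bar>det (matrix (g' x))\<bar> * f (g x)) = integral (g ` S) f" by auto
qed

lemma integrable_disc_iff: "integrable disc f \<longleftrightarrow> f absolutely_integrable_on unit_disc"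
  by (simp add: set_integrable_def integrable_restrict_space)

definition rot :: "real \<Rightarrow> real^2 \<Rightarrow> real^2" where
  "rot t x = (cos t * x $ 1 - sin t * x $ 2) *\<^sub>R axis 1 1 + (sin t * x $ 1 + cos t * x $ 2) *\<^sub>R axis 2 1"

lemma rot_nth [simp]: "rot t x $ 1 = cos t * x $ 1 - sin t * x $ 2" "rot t x $ 2 = sin t * x $ 1 + cos t * x $ 2"
  by (simp_all add: rot_def axis_def)

lemma vec2_eq_iff: "(x::real^2) = y \<longleftrightarrow> x $ 1 = y $ 1 \<and> x $ 2 = y $ 2"
  by (simp add: vec_eq_iff forall_2)

lemma inner2: "(x::real^2) \<bullet> y = x $ 1 * y $ 1 + x $ 2 * y $ 2"
  by (simp add: inner_vec_def sum_2)

lemma rot_add: "rot (s + t) x = rot s (rot t x)"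
  by (simp add: vec2_eq_iff cos_add sin_add algebra_simps)

lemma rot_0 [simp]: "rot 0 x = x" by (simp add: vec2_eq_iff)

lemma rot_minus: "rot (- t) (rot t x) = x" "rot t (rot (- t) x) = x"
  by (simp_all flip: rot_add)

lemma rot_periodic: "rot (t + 2 * pi) x = rot t x"
  by (simp add: vec2_eq_iff)

lemma rot_inner: "rot t x \<bullet> y = x \<bullet> rot (- t) y"
  by (simp add: inner2 algebra_simps)

lemma norm_rot [simp]: "norm (rot t x) = norm x"
proof -
  have "rot t x \<bullet> rot t x = x \<bullet> x" by (simp add: rot_inner rot_minus)
  then show ?thesis by (simp add: norm_eq_sqrt_inner)
qed

lemma linear_rot: "linear (rot t)"
  by (rule linearI) (simp_all add: vec2_eq_iff algebra_simps)

lemma rot_has_derivative: "(rot t has_derivative rot t) (at x within S)"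
  by (rule linear_imp_has_derivative[OF linear_rot])

lemma det_rot: "det (matrix (rot t)) = 1"
  by (simp add: det_2 matrix_def axis_def power2_eq_square[symmetric])

lemma rot_image_disc: "rot t ` unit_disc = unit_disc"
proof
  show "rot t ` unit_disc \<subseteq> unit_disc" by auto
  show "unit_disc \<subseteq> rot t ` unit_disc"
  proof
    fix x assume "x \<in> unit_disc"
    then show "x \<in> rot t ` unit_disc" by (intro image_eqI[of _ _ "rot (- t) x"]) (auto simp: rot_minus)
  qed
qed

lemma rot_cont [continuous_intros]:
  fixes S :: "'a::real_normed_vector set"
  assumes "continuous_on S f" "continuous_on S g"
  shows "continuous_on S (\<lambda>z. rot (f z) (g z))"
  unfolding rot_def by (intro continuous_intros assms)

lemma rotation_invariance:
  fixes f :: "real^2 \<Rightarrow> real"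
  assumes "integrable disc f"
  shows "integrable disc (\<lambda>x. f (rot t x))" "(LINT x|disc. f (rot t x)) = (LINT x|disc. f x)"
proof -
  have inj: "inj_on (rot t) unit_disc" by (rule inj_on_inverseI[of _ "rot (- t)"]) (simp add: rot_minus)
  have f: "f absolutely_integrable_on rot t ` unit_disc" using assms by (simp add: rot_image_disc integrable_disc_iff)
  note cv = change_of_variables_real[OF disc_sets rot_has_derivative inj f, unfolded det_rot rot_image_disc]
  show 1: "integrable disc (\<lambda>x. f (rot t x))" using cv(1) by (simp add: integrable_disc_iff)
  show "(LINT x|disc. f (rot t x)) = (LINT x|disc. f x)"
    using cv(2) by (simp add: lebesgue_integral_eq_integral[OF 1] lebesgue_integral_eq_integral[OF assms])
qed

text \<open>The cosine and the sine of the angle are the normalised inner product and determinant of the two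
  vectors.\<close>
lemma exists_rotation:
  assumes "norm x = norm y"
  obtains t where "0 \<le> t" "t < 2 * pi" "y = rot t x"
proof (cases "x = 0")
  case True
  then show ?thesis using assms that[of 0] by simp
next
  case False
  define N where "N = (x $ 1)\<^sup>2 + (x $ 2)\<^sup>2"
  have N: "N \<noteq> 0" using False by (auto simp: N_def vec2_eq_iff sum_power2_eq_zero_iff)
  have Ny: "(y $ 1)\<^sup>2 + (y $ 2)\<^sup>2 = N" using assms by (simp add: N_def norm2_sq[symmetric])
  let ?c = "(x $ 1 * y $ 1 + x $ 2 * y $ 2) / N" and ?s = "(x $ 1 * y $ 2 - x $ 2 * y $ 1) / N"
  have "(x $ 1 * y $ 1 + x $ 2 * y $ 2)\<^sup>2 + (x $ 1 * y $ 2 - x $ 2 * y $ 1)\<^sup>2 = N * ((y $ 1)\<^sup>2 + (y $ 2)\<^sup>2)"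
    by (simp add: N_def power2_eq_square algebra_simps)
  then have "?c\<^sup>2 + ?s\<^sup>2 = 1" using N Ny by (simp add: power_divide add_divide_distrib[symmetric] power2_eq_square[of N])
  then obtain t where t: "0 \<le> t" "t < 2 * pi" "?c = cos t" "?s = sin t" by (rule sincos_total_2pi)
  have "y = rot t x"
  proof -
    have "?c * x $ 1 - ?s * x $ 2 = y $ 1 * N / N" "?s * x $ 1 + ?c * x $ 2 = y $ 2 * N / N"
      unfolding N_def using N
      by (simp_all add: diff_divide_distrib[symmetric] add_divide_distrib[symmetric] power2_eq_square algebra_simps)
    then show ?thesis using N t by (simp add: vec2_eq_iff)
  qed
  then show ?thesis using that t by blast
qed

definition avg :: "(real \<Rightarrow> 'a::euclidean_space) \<Rightarrow> 'a" where
  "avg v = (1 / (2 * pi)) *\<^sub>R integral (cbox 0 (2 * pi)) v"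

lemma avg_const [simp]: "avg (\<lambda>t. c) = c"
  by (simp add: avg_def)

lemma avg_diff:
  assumes "continuous_on (cbox 0 (2 * pi)) v" "continuous_on (cbox 0 (2 * pi)) w"
  shows "avg (\<lambda>t. v t - w t) = avg v - avg w"
  unfolding avg_def integral_diff[OF integrable_continuous[OF assms(1)] integrable_continuous[OF assms(2)]]
  by (rule scaleR_diff_right)

lemma avg_mono:
  fixes v w :: "real \<Rightarrow> real"
  assumes "continuous_on (cbox 0 (2 * pi)) v" "continuous_on (cbox 0 (2 * pi)) w" "\<And>t. v t \<le> w t"
  shows "avg v \<le> avg w"
  unfolding avg_def real_scaleR_def
  by (intro mult_left_mono integral_le[OF integrable_continuous[OF assms(1)] integrable_continuous[OF assms(2)] assms(3)]) simp

text \<open>Jensen's inequality for the square: the mean of \<open>|v - avg v|^2\<close> is nonnegative.\<close>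
lemma avg_norm_sq:
  fixes v :: "real \<Rightarrow> 'a::euclidean_space"
  assumes v: "continuous_on (cbox 0 (2 * pi)) v"
  shows "(norm (avg v))\<^sup>2 \<le> avg (\<lambda>t. (norm (v t))\<^sup>2)"
proof -
  define m where "m = avg v"
  let ?T = "cbox 0 (2 * pi)"
  have vi: "v integrable_on ?T" by (rule integrable_continuous[OF v])
  have I: "integral ?T v = (2 * pi) *\<^sub>R m" by (simp add: m_def avg_def)
  have i1: "(\<lambda>t. (norm (v t))\<^sup>2) integrable_on ?T" "(\<lambda>t. m \<bullet> v t) integrable_on ?T"
    by (intro integrable_continuous continuous_intros v)+
  have im: "integral ?T (\<lambda>t. m \<bullet> v t) = m \<bullet> integral ?T v"
    using integral_linear[OF vi bounded_linear_inner_right[of m]] by (simp add: o_def)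
  have "0 \<le> integral ?T (\<lambda>t. (norm (v t - m))\<^sup>2)"
    by (intro integral_nonneg integrable_continuous continuous_intros v) auto
  also have "(\<lambda>t. (norm (v t - m))\<^sup>2) = (\<lambda>t. ((norm (v t))\<^sup>2 - 2 * (m \<bullet> v t)) + m \<bullet> m)"
    by (simp add: power2_norm_eq_inner inner_diff_left inner_diff_right inner_commute algebra_simps)
  also have "integral ?T \<dots> = (integral ?T (\<lambda>t. (norm (v t))\<^sup>2) - 2 * (m \<bullet> integral ?T v)) + 2 * pi * (m \<bullet> m)"
  proof -
    have "integral ?T (\<lambda>t. ((norm (v t))\<^sup>2 - 2 * (m \<bullet> v t)) + m \<bullet> m)
        = integral ?T (\<lambda>t. (norm (v t))\<^sup>2 - 2 * (m \<bullet> v t)) + integral ?T (\<lambda>t. m \<bullet> m)"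
      by (intro integral_add integrable_continuous continuous_intros v)
    also have "integral ?T (\<lambda>t. (norm (v t))\<^sup>2 - 2 * (m \<bullet> v t)) = integral ?T (\<lambda>t. (norm (v t))\<^sup>2) - integral ?T (\<lambda>t. 2 * (m \<bullet> v t))"
      by (intro integral_diff integrable_continuous continuous_intros v)
    also have "integral ?T (\<lambda>t. 2 * (m \<bullet> v t)) = 2 * (m \<bullet> integral ?T v)"
      unfolding im[symmetric] by (rule integral_mult_right)
    finally show ?thesis by simp
  qed
  also have "\<dots> = integral ?T (\<lambda>t. (norm (v t))\<^sup>2) - 2 * pi * (norm m)\<^sup>2"
    unfolding I by (simp add: power2_norm_eq_inner)
  finally have "2 * pi * (norm m)\<^sup>2 \<le> integral ?T (\<lambda>t. (norm (v t))\<^sup>2)" by simp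
  then show ?thesis unfolding m_def[symmetric]
    by (simp add: avg_def field_simps)
qed

lemma avg_sq: "continuous_on (cbox 0 (2 * pi)) v \<Longrightarrow> (avg v)\<^sup>2 \<le> avg (\<lambda>t. (v t :: real)\<^sup>2)"
  using avg_norm_sq[of v] by simp

lemma avg_shift:
  fixes h :: "real \<Rightarrow> real"
  assumes h: "continuous_on UNIV h" "\<And>t. h (t + 2 * pi) = h t" and s: "0 \<le> s" "s < 2 * pi"
  shows "avg (\<lambda>t. h (t + s)) = avg h"
proof -
  have hi: "h integrable_on {a..b}" for a b
    by (intro integrable_continuous_real continuous_on_subset[OF h(1)]) auto
  have "integral {0..2 * pi} (\<lambda>t. h (t + s)) = integral {s..2 * pi + s} h"
    using integral_shift_Icc_real[of 0 "2 * pi" h s] by (simp add: o_def add.commute)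
  also have "\<dots> = integral {s..2 * pi} h + integral {2 * pi..2 * pi + s} h"
    by (intro Henstock_Kurzweil_Integration.integral_combine[symmetric] hi) (use s in auto)
  also have "integral {2 * pi..2 * pi + s} h = integral {0..s} (\<lambda>t. h (t + 2 * pi))"
    using integral_shift_Icc_real[of 0 s h "2 * pi"] by (simp add: o_def add.commute)
  also have "\<dots> = integral {0..s} h" by (simp add: h(2))
  also have "integral {s..2 * pi} h + integral {0..s} h = integral {0..2 * pi} h"
    by (subst add.commute, intro Henstock_Kurzweil_Integration.integral_combine hi) (use s in auto)
  finally show ?thesis by (simp add: avg_def)
qed

definition radialize :: "(real^2 \<Rightarrow> real) \<Rightarrow> real^2 \<Rightarrow> real" where
  "radialize f x = avg (\<lambda>t. f (rot t x))"
definition radialize_grad :: "(real^2 \<Rightarrow> real^2) \<Rightarrow> real^2 \<Rightarrow> real^2" where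
  "radialize_grad g x = avg (\<lambda>t. rot (- t) (g (rot t x)))"

lemma rot_comp_cont:
  assumes "continuous_on UNIV f"
  shows "continuous_on S (\<lambda>t. f (rot t x))" "continuous_on T (\<lambda>x. f (rot t x))" "continuous_on (T \<times> S) (\<lambda>(x, t). f (rot t x))"
  unfolding split_beta by (intro continuous_on_compose2[OF assms] continuous_intros; auto)+

text \<open>Rotations preserve inner products, so the gradient of \<open>x \<mapsto> f (rot t x)\<close> is the
  gradient of \<open>f\<close> rotated back.\<close>
lemma radialize_c1c:
  assumes f: "c1c f g"
  shows "c1c (radialize f) (radialize_grad g)"
proof -
  have gc: "continuous_on UNIV g" and fd: "\<And>x. (f has_derivative (\<lambda>h. g x \<bullet> h)) (at x)" using f by (auto simp: c1c_def)
  obtain \<rho> where \<rho>: "0 < \<rho>" "\<rho> < 1" "\<And>x. \<rho> \<le> norm x \<Longrightarrow> f x = 0" using c1c_support[OF f] by metis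
  let ?T = "cbox 0 (2 * pi) :: real set"
  have F: "((\<lambda>x. f (rot t x)) has_derivative (\<lambda>h. rot (- t) (g (rot t x)) \<bullet> h)) (at x)" for x t
    using has_derivative_compose[OF rot_has_derivative fd] by (simp add: rot_inner inner_commute)
  have Gc: "continuous_on (UNIV \<times> ?T) (\<lambda>(x, t). rot (- t) (g (rot t x)))"
    unfolding split_beta by (intro continuous_intros continuous_on_compose2[OF gc]) auto
  note L = leibniz_gradient[OF F rot_comp_cont(1)[OF c1c_cont[OF f]] Gc]
  show ?thesis
  proof (rule c1cI[OF _ _ \<rho>(2)])
    show "(radialize f has_derivative (\<lambda>h. radialize_grad g x \<bullet> h)) (at x)" for x
      unfolding radialize_def radialize_grad_def avg_def inner_scaleR_left
      using has_derivative_mult_right[OF L(1), of "1 / (2 * pi)"] by simp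
    show "continuous_on UNIV (radialize_grad g)"
      unfolding radialize_grad_def avg_def by (intro continuous_intros L(2))
    show "radialize f x = 0" if "\<rho> \<le> norm x" for x using \<rho>(3) that by (simp add: radialize_def)
  qed
qed

lemma radialize_radial:
  assumes f: "continuous_on UNIV f" and xy: "norm x = norm y"
  shows "radialize f x = radialize f y"
proof -
  obtain s where s: "0 \<le> s" "s < 2 * pi" "y = rot s x" by (rule exists_rotation[OF xy])
  have "avg (\<lambda>t. f (rot (t + s) x)) = avg (\<lambda>t. f (rot t x))"
    by (rule avg_shift[OF rot_comp_cont(1)[OF f] _ s(1,2)]) (simp add: rot_periodic)
  then show ?thesis by (simp add: radialize_def s(3) rot_add)
qed

lemma avg_lint_swap:
  fixes h :: "real^2 \<Rightarrow> real \<Rightarrow> real"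
  assumes h: "continuous_on UNIV (\<lambda>(x, t). h x t)" and z: "\<And>x t. 1 \<le> norm x \<Longrightarrow> h x t = 0"
  shows "(LINT x|disc. avg (h x)) = avg (\<lambda>t. LINT x|disc. h x t)"
proof -
  let ?K = "cbox (- 1 *\<^sub>R One) (1 *\<^sub>R One) :: (real^2) set" and ?T = "cbox 0 (2 * pi) :: real set"
  have hx: "continuous_on S (\<lambda>x. h x t)" for S t
    by (rule continuous_on_compose2[OF h, of S "\<lambda>x. (x, t)", simplified]) (intro continuous_intros)
  have ic: "continuous_on UNIV (\<lambda>x. integral ?T (h x))"
    by (rule integral_continuous_on_param) (rule continuous_on_subset[OF h], simp)
  have "(LINT x|disc. avg (h x)) = integral ?K (\<lambda>x. avg (h x))"
  proof (rule lint_disc_eq)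
    show "continuous_on UNIV (\<lambda>x. avg (h x))" unfolding avg_def by (rule continuous_on_scaleR[OF continuous_on_const ic])
    show "avg (h x) = 0" if "1 \<le> norm x" for x
    proof -
      have "h x = (\<lambda>t. 0)" using z[OF that] by (intro ext)
      then show ?thesis by simp
    qed
  qed (rule disc_sub, simp)
  also have "\<dots> = (1 / (2 * pi)) * integral ?K (\<lambda>x. integral ?T (h x))"
    unfolding avg_def real_scaleR_def by (rule integral_mult_right)
  also have "integral ?K (\<lambda>x. integral ?T (h x)) = integral ?T (\<lambda>t. integral ?K (\<lambda>x. h x t))"
    by (rule integral_swap_continuous) (rule continuous_on_subset[OF h], simp)
  also have "(\<lambda>t. integral ?K (\<lambda>x. h x t)) = (\<lambda>t. LINT x|disc. h x t)"
    by (intro ext lint_disc_eq[symmetric, OF hx z] disc_sub) simp_all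
  finally show ?thesis by (simp add: avg_def)
qed

text \<open>Jensen's inequality at each point, then exchanging the integrals, then invariance of the
  integral under rotations.\<close>
lemma radialize_energy:
  assumes f: "c1c f g"
  shows "(LINT x|disc. (norm (radialize_grad g x))\<^sup>2) \<le> (LINT x|disc. (norm (g x))\<^sup>2)"
proof -
  have gc: "continuous_on UNIV g" using f by (simp add: c1c_def)
  obtain \<rho> where \<rho>: "0 < \<rho>" "\<rho> < 1" "\<And>x. \<rho> \<le> norm x \<Longrightarrow> g x = 0" using c1c_support[OF f] by metis
  have nc: "continuous_on UNIV (\<lambda>x. (norm (g x))\<^sup>2)" by (intro continuous_intros gc)
  have hc: "continuous_on UNIV (\<lambda>(x, t). (norm (g (rot t x)))\<^sup>2)"
    using rot_comp_cont(3)[OF nc, of UNIV UNIV] by simp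
  have ac: "continuous_on UNIV (\<lambda>x. avg (\<lambda>t. (norm (g (rot t x)))\<^sup>2))"
    unfolding avg_def by (intro continuous_intros integral_continuous_on_param) (rule continuous_on_subset[OF hc], simp)
  have "(LINT x|disc. (norm (radialize_grad g x))\<^sup>2) \<le> (LINT x|disc. avg (\<lambda>t. (norm (g (rot t x)))\<^sup>2))"
  proof (rule integral_mono)
    show "integrable disc (\<lambda>x. (norm (radialize_grad g x))\<^sup>2)"
      using radialize_c1c[OF f] by (intro integrable_disc continuous_intros) (simp add: c1c_def)
    show "integrable disc (\<lambda>x. avg (\<lambda>t. (norm (g (rot t x)))\<^sup>2))" by (rule integrable_disc[OF ac])
    fix x
    have "continuous_on (cbox 0 (2 * pi)) (\<lambda>t. rot (- t) (g (rot t x)))"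
      by (intro continuous_intros rot_comp_cont(1)[OF gc])
    from avg_norm_sq[OF this] show "(norm (radialize_grad g x))\<^sup>2 \<le> avg (\<lambda>t. (norm (g (rot t x)))\<^sup>2)"
      by (simp add: radialize_grad_def)
  qed
  also have "\<dots> = avg (\<lambda>t. LINT x|disc. (norm (g (rot t x)))\<^sup>2)"
    by (rule avg_lint_swap[OF hc]) (use \<rho> in auto)
  also have "(\<lambda>t. LINT x|disc. (norm (g (rot t x)))\<^sup>2) = (\<lambda>t. LINT x|disc. (norm (g x))\<^sup>2)"
    by (rule ext) (rule rotation_invariance(2)[OF integrable_disc[OF nc]])
  finally show ?thesis by simp
qed

text \<open>A radial \<open>w\<close> is invariant under rotations. Hence \<open>f\<close> and its rotations are equally far from
  \<open>w\<close>, and no two of them are farther apart than twice that distance; averaging does not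
  increase the distance.\<close>
lemma radialize_L2:
  assumes f: "c1c f g" and w: "in_L2 w" "radial w"
  shows "(LINT x|disc. (f x - radialize f x)\<^sup>2) \<le> 4 * (LINT x|disc. (w x - f x)\<^sup>2)"
proof -
  have fc: "continuous_on UNIV f" by (rule c1c_cont[OF f])
  obtain \<rho> where \<rho>: "0 < \<rho>" "\<rho> < 1" "\<And>x. \<rho> \<le> norm x \<Longrightarrow> f x = 0" using c1c_support[OF f] by metis
  have hc: "continuous_on UNIV (\<lambda>(x, t). (f x - f (rot t x))\<^sup>2)"
    unfolding split_beta
    by (intro continuous_intros continuous_on_compose2[OF fc]) auto
  have ac: "continuous_on UNIV (\<lambda>x. avg (\<lambda>t. (f x - f (rot t x))\<^sup>2))"
    unfolding avg_def by (intro continuous_intros integral_continuous_on_param) (rule continuous_on_subset[OF hc], simp)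
  have ct: "continuous_on S (\<lambda>t. f (rot t x))" for S x by (rule rot_comp_cont(1)[OF fc])
  have wf: "integrable disc (\<lambda>x. (w x - f x)\<^sup>2)"
    using in_L2_diff[OF w(1) in_L2_continuous[OF fc]] by (simp add: in_L2_def)
  have each: "(LINT x|disc. (f x - f (rot t x))\<^sup>2) \<le> 4 * (LINT x|disc. (w x - f x)\<^sup>2)" for t
  proof -
    note ri = rotation_invariance[OF wf, of t]
    have "(LINT x|disc. (f x - f (rot t x))\<^sup>2) \<le> (LINT x|disc. 2 * (w x - f x)\<^sup>2 + 2 * (w (rot t x) - f (rot t x))\<^sup>2)"
    proof (rule integral_mono)
      show "integrable disc (\<lambda>x. (f x - f (rot t x))\<^sup>2)"
        by (intro integrable_disc continuous_intros fc rot_comp_cont(2)[OF fc])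
      show "integrable disc (\<lambda>x. 2 * (w x - f x)\<^sup>2 + 2 * (w (rot t x) - f (rot t x))\<^sup>2)"
        using wf ri(1) by simp
      fix x assume "x \<in> space disc"
      then have "x \<in> unit_disc" "rot t x \<in> unit_disc" by simp_all
      then have "w (rot t x) = w x" using w(2)[unfolded radial_def, rule_format, of "rot t x" x] by simp
      moreover have "(f x - f (rot t x))\<^sup>2 \<le> 2 * (w x - f x)\<^sup>2 + 2 * (w x - f (rot t x))\<^sup>2"
        using zero_le_power2[of "(w x - f x) + (w x - f (rot t x))"] by (simp add: power2_eq_square algebra_simps)
      ultimately show "(f x - f (rot t x))\<^sup>2 \<le> 2 * (w x - f x)\<^sup>2 + 2 * (w (rot t x) - f (rot t x))\<^sup>2" by simp
    qed
    also have "\<dots> = 4 * (LINT x|disc. (w x - f x)\<^sup>2)" using wf ri by simp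
    finally show ?thesis .
  qed
  have "(LINT x|disc. (f x - radialize f x)\<^sup>2) \<le> (LINT x|disc. avg (\<lambda>t. (f x - f (rot t x))\<^sup>2))"
  proof (rule integral_mono)
    show "integrable disc (\<lambda>x. (f x - radialize f x)\<^sup>2)"
      by (intro integrable_disc continuous_intros fc c1c_cont[OF radialize_c1c[OF f]])
    show "integrable disc (\<lambda>x. avg (\<lambda>t. (f x - f (rot t x))\<^sup>2))" by (rule integrable_disc[OF ac])
    fix x
    have "f x - radialize f x = avg (\<lambda>t. f x - f (rot t x))"
      using avg_diff[OF continuous_on_const ct, of "f x" x] by (simp add: radialize_def)
    then show "(f x - radialize f x)\<^sup>2 \<le> avg (\<lambda>t. (f x - f (rot t x))\<^sup>2)"
      using avg_sq[of "\<lambda>t. f x - f (rot t x)"] ct by (simp add: continuous_intros)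
  qed
  also have "\<dots> = avg (\<lambda>t. LINT x|disc. (f x - f (rot t x))\<^sup>2)"
    by (rule avg_lint_swap[OF hc]) (use \<rho> in auto)
  also have "\<dots> \<le> avg (\<lambda>t. 4 * (LINT x|disc. (w x - f x)\<^sup>2))"
  proof (rule avg_mono[OF _ _ each])
    let ?K = "cbox (- 1 *\<^sub>R One) (1 *\<^sub>R One) :: (real^2) set"
    have "(LINT x|disc. (f x - f (rot t x))\<^sup>2) = integral ?K (\<lambda>x. (f x - f (rot t x))\<^sup>2)" for t
      by (rule lint_disc_eq) (use \<rho> disc_sub[of 1] in \<open>auto intro!: continuous_intros fc rot_comp_cont(2)[OF fc]\<close>)
    moreover have "continuous_on (cbox 0 (2 * pi)) (\<lambda>t. integral ?K (\<lambda>x. (f x - f (rot t x))\<^sup>2))"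
      by (rule integral_continuous_on_param)
        (unfold split_beta, intro continuous_intros continuous_on_compose2[OF fc], auto)
    ultimately show "continuous_on (cbox 0 (2 * pi)) (\<lambda>t. LINT x|disc. (f x - f (rot t x))\<^sup>2)" by simp
  qed (rule continuous_on_const)
  finally show ?thesis by simp
qed

lemma radialize_sum:
  fixes d :: nat
  assumes "\<And>j. j < d \<Longrightarrow> continuous_on UNIV (f j)"
  shows "radialize (\<lambda>x. \<Sum>j<d. c j * f j x) x = (\<Sum>j<d. c j * radialize (f j) x)"
    and "(\<And>j. j < d \<Longrightarrow> continuous_on UNIV (g j)) \<Longrightarrow>
      radialize_grad (\<lambda>x. \<Sum>j<d. c j *\<^sub>R g j x) x = (\<Sum>j<d. c j *\<^sub>R radialize_grad (g j) x)"
proof -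
  let ?T = "cbox 0 (2 * pi) :: real set"
  have "integral ?T (\<lambda>t. \<Sum>j<d. c j * f j (rot t x)) = (\<Sum>j<d. integral ?T (\<lambda>t. c j * f j (rot t x)))"
    by (rule Henstock_Kurzweil_Integration.integral_sum[OF finite_lessThan], rule integrable_continuous)
      (intro continuous_intros rot_comp_cont(1) assms, simp)
  then show "radialize (\<lambda>x. \<Sum>j<d. c j * f j x) x = (\<Sum>j<d. c j * radialize (f j) x)"
    by (simp add: radialize_def avg_def sum_distrib_left sum_divide_distrib)
  assume g: "\<And>j. j < d \<Longrightarrow> continuous_on UNIV (g j)"
  have r: "rot s (\<Sum>j<d. c j *\<^sub>R v j) = (\<Sum>j<d. c j *\<^sub>R rot s (v j))" for s v
    using linear_rot[of s] by (simp add: linear_sum linear_scale)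
  have "integral ?T (\<lambda>t. \<Sum>j<d. c j *\<^sub>R rot (- t) (g j (rot t x))) = (\<Sum>j<d. integral ?T (\<lambda>t. c j *\<^sub>R rot (- t) (g j (rot t x))))"
    by (rule Henstock_Kurzweil_Integration.integral_sum[OF finite_lessThan], rule integrable_continuous)
      (intro continuous_intros rot_comp_cont(1) g, simp)
  then show "radialize_grad (\<lambda>x. \<Sum>j<d. c j *\<^sub>R g j x) x = (\<Sum>j<d. c j *\<^sub>R radialize_grad (g j) x)"
    by (simp add: radialize_grad_def avg_def r scaleR_sum_right mult.commute)
qed

lemma L2_sum_bound:
  fixes d :: nat
  assumes "\<And>j. j < d \<Longrightarrow> in_L2 (y j)"
  shows "(LINT x|disc. (\<Sum>j<d. c j * y j x)\<^sup>2) \<le> (\<Sum>j<d. (c j)\<^sup>2) * (\<Sum>j<d. LINT x|disc. (y j x)\<^sup>2)"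
proof -
  have i: "integrable disc (\<lambda>x. (y j x)\<^sup>2)" if "j < d" for j using in_L2_sq_integrable[OF assms[OF that]] .
  have "(LINT x|disc. (\<Sum>j<d. c j * y j x)\<^sup>2) \<le> (LINT x|disc. (\<Sum>j<d. (c j)\<^sup>2) * (\<Sum>j<d. (y j x)\<^sup>2))"
  proof (rule integral_mono)
    show "integrable disc (\<lambda>x. (\<Sum>j<d. c j * y j x)\<^sup>2)" by (rule in_L2_sq_integrable[OF in_L2_sum]) (use assms in auto)
    show "integrable disc (\<lambda>x. (\<Sum>j<d. (c j)\<^sup>2) * (\<Sum>j<d. (y j x)\<^sup>2))"
      by (intro Bochner_Integration.integrable_mult_right Bochner_Integration.integrable_sum) (use i in auto)
  qed (rule sq_sum_bound)
  also have "\<dots> = (\<Sum>j<d. (c j)\<^sup>2) * (LINT x|disc. (\<Sum>j<d. (y j x)\<^sup>2))" by simp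
  also have "(LINT x|disc. (\<Sum>j<d. (y j x)\<^sup>2)) = (\<Sum>j<d. LINT x|disc. (y j x)\<^sup>2)"
    by (rule Bochner_Integration.integral_sum) (use i in auto)
  finally show ?thesis .
qed

text \<open>Averages over rotations of test functions near the given radial functions. Averaging does not
  increase the Dirichlet energy, and the change of the potential term is controlled by the
  distance of a test function to its average, which is at most twice its distance to the radial
  function that it approximates.\<close>
lemma radial_approx_neg_def:
  assumes V: "neg_def_subspace (henon_form p a u) H10_rad V" and d: "real_fun.dim V = d" "0 < d"
    and p: "0 < p"
    and W: "potential p a u \<in> borel_measurable disc"
       "\<And>x. x \<in> unit_disc \<Longrightarrow> 0 \<le> potential p a u x \<and> potential p a u x \<le> M"
  obtains \<psi> \<xi> where "\<And>j. j < d \<Longrightarrow> c1c (\<psi> j) (\<xi> j)"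
    "\<And>j x y. j < d \<Longrightarrow> norm x = norm y \<Longrightarrow> \<psi> j x = \<psi> j y"
    "\<And>c. \<exists>j<d. c j \<noteq> 0 \<Longrightarrow>
       qform p (potential p a u) (\<lambda>x. \<Sum>j<d. c j * \<psi> j x) (\<lambda>x. \<Sum>j<d. c j *\<^sub>R \<xi> j x) < 0"
proof -
  let ?W = "potential p a u"
  have Wb: "\<bar>?W x\<bar> \<le> M" if "x \<in> unit_disc" for x using W(2)[OF that] by auto
  have M: "0 \<le> M" using W(2)[of 0] by auto
  have V': "neg_def_subspace (henon_form p a u) H10 V" using V by (auto simp: neg_def_subspace_def H10_rad_def)
  obtain w \<eta> where w: "\<And>j. j < d \<Longrightarrow> w j \<in> V" and \<eta>: "0 < \<eta>" and
    ap: "\<And>\<epsilon>. 0 < \<epsilon> \<Longrightarrow> \<exists>\<phi>. (\<forall>j<d. test_function (\<phi> j) \<and> (LINT x|disc. (w j x - \<phi> j x)\<^sup>2) \<le> \<epsilon>) \<and>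
       (\<forall>c. qform p ?W (\<lambda>x. \<Sum>j<d. c j * \<phi> j x) (\<lambda>x. \<Sum>j<d. c j *\<^sub>R gradient (\<phi> j) x)
          \<le> - \<eta> * (\<Sum>j<d. (c j)\<^sup>2))"
    by (rule approx_neg_def[OF V' d p W]) blast+
  have wr: "\<And>j. j < d \<Longrightarrow> radial (w j)" and wL: "\<And>j. j < d \<Longrightarrow> in_L2 (w j)"
    using w V by (auto simp: neg_def_subspace_def H10_rad_def H10_def H1_def)
  \<comment> \<open>Bounds the squared norm of the test functions relative to the coefficient vector, once the error is at most \<open>1 / (2 * d)\<close>.\<close>
  define C where "C = 2 * (\<Sum>j<d. LINT x|disc. (w j x)\<^sup>2) + 1"
  have C: "0 < C" unfolding C_def by (intro add_nonneg_pos mult_nonneg_nonneg sum_nonneg) auto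
  have pM: "0 \<le> p * M" using p M by simp
  define t where "t = \<eta> / (4 * (p * M * C + 1))"
  have pMC: "0 \<le> p * M * C" using pM C by simp
  have t: "0 < t" "p * M * (t * C) \<le> \<eta> / 4"
  proof -
    show "0 < t" using \<eta> pMC by (simp add: t_def)
    have "t * (4 * (p * M * C + 1)) = \<eta>" using pMC by (simp add: t_def)
    then have "4 * (p * M * (t * C)) + 4 * t = \<eta>" by (simp add: algebra_simps)
    with \<open>0 < t\<close> show "p * M * (t * C) \<le> \<eta> / 4" by simp
  qed
  define \<epsilon> where "\<epsilon> = min (1 / (2 * (real d + 1))) (\<eta> / (16 * ((p * M + 1) * (1 + 1 / t)) * (real d + 1)))"
  define K where "K = (p * M + 1) * (1 + 1 / t)"
  have K: "0 < K" "p * M * (1 + 1 / t) \<le> K" using pM t by (auto simp: K_def intro!: mult_pos_pos mult_right_mono add_nonneg_pos)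
  have eps0: "0 < \<epsilon>" using \<eta> K by (simp add: \<epsilon>_def K_def[symmetric])
  have eps1: "2 * (real d * \<epsilon>) \<le> 1"
  proof -
    have "\<epsilon> \<le> 1 / (2 * (real d + 1))" by (simp add: \<epsilon>_def)
    then have "\<epsilon> * (2 * (real d + 1)) \<le> 1" by (subst (asm) pos_le_divide_eq) auto
    then show ?thesis using eps0 by (simp add: algebra_simps)
  qed
  have eps2: "K * (4 * (real d * \<epsilon>)) \<le> \<eta> / 4"
  proof -
    have "\<epsilon> \<le> \<eta> / (16 * K * (real d + 1))" by (simp add: \<epsilon>_def K_def)
    then have "\<epsilon> * (16 * K * (real d + 1)) \<le> \<eta>" using K by (subst (asm) pos_le_divide_eq) auto
    moreover have "0 \<le> K * \<epsilon>" using K eps0 by simp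
    ultimately show ?thesis by (simp add: algebra_simps)
  qed
  obtain \<phi> where \<phi>: "\<And>j. j < d \<Longrightarrow> test_function (\<phi> j)" "\<And>j. j < d \<Longrightarrow> (LINT x|disc. (w j x - \<phi> j x)\<^sup>2) \<le> \<epsilon>"
    "\<And>c. qform p ?W (\<lambda>x. \<Sum>j<d. c j * \<phi> j x) (\<lambda>x. \<Sum>j<d. c j *\<^sub>R gradient (\<phi> j) x) \<le> - \<eta> * (\<Sum>j<d. (c j)\<^sup>2)"
    using ap[OF eps0] by blast
  have \<phi>c: "c1c (\<phi> j) (gradient (\<phi> j))" if "j < d" for j by (rule test_function_c1c[OF \<phi>(1)[OF that]])
  have \<phi>cont: "continuous_on UNIV (\<phi> j)" "continuous_on UNIV (gradient (\<phi> j))" if "j < d" for j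
    using c1c_cont[OF \<phi>c[OF that]] \<phi>c[OF that] by (auto simp: c1c_def)
  show ?thesis
  proof (rule that[of "\<lambda>j. radialize (\<phi> j)" "\<lambda>j. radialize_grad (gradient (\<phi> j))"])
    show "c1c (radialize (\<phi> j)) (radialize_grad (gradient (\<phi> j)))" if "j < d" for j
      by (rule radialize_c1c[OF \<phi>c[OF that]])
    show "radialize (\<phi> j) x = radialize (\<phi> j) y" if "j < d" "norm x = norm y" for j x y
      by (rule radialize_radial[OF \<phi>cont(1)[OF that(1)] that(2)])
    fix c :: "nat \<Rightarrow> real" assume c: "\<exists>j<d. c j \<noteq> 0"
    let ?n = "\<Sum>j<d. (c j)\<^sup>2"
    have n: "0 < ?n"
    proof -
      obtain j where "j < d" "c j \<noteq> 0" using c by blast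
      then show ?thesis by (intro sum_pos2[of _ j]) auto
    qed
    define f where "f x = (\<Sum>j<d. c j * \<phi> j x)" for x
    define g where "g x = (\<Sum>j<d. c j *\<^sub>R gradient (\<phi> j) x)" for x
    define wc where "wc x = (\<Sum>j<d. c j * w j x)" for x
    have fg: "c1c f g" unfolding f_def g_def by (rule c1c_sum) (use \<phi>c in auto)
    have Pfg: "c1c (radialize f) (radialize_grad g)" by (rule radialize_c1c[OF fg])
    have Pf: "(\<Sum>j<d. c j * radialize (\<phi> j) x) = radialize f x" for x
      unfolding f_def by (rule radialize_sum(1)[symmetric]) (rule \<phi>cont)
    have Pg: "(\<Sum>j<d. c j *\<^sub>R radialize_grad (gradient (\<phi> j)) x) = radialize_grad g x" for x
      unfolding g_def by (rule radialize_sum(2)[symmetric]) (rule \<phi>cont, assumption)+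
    have wcL: "in_L2 wc" unfolding wc_def by (rule in_L2_sum) (use wL in auto)
    have wcr: "radial wc" unfolding radial_def wc_def
    proof (intro ballI impI sum.cong refl)
      fix x y :: "real^2" and j assume "x \<in> unit_disc" "y \<in> unit_disc" "norm x = norm y" "j \<in> {..<d}"
      then have "w j x = w j y" using wr[of j] unfolding radial_def by blast
      then show "c j * w j x = c j * w j y" by simp
    qed
    note fL = c1c_in_L2(1)[OF fg] and PfL = c1c_in_L2(1)[OF Pfg]
    have close: "(LINT x|disc. (wc x - f x)\<^sup>2) \<le> ?n * (d * \<epsilon>)"
    proof -
      have "(LINT x|disc. (\<Sum>j<d. c j * (w j x - \<phi> j x))\<^sup>2) \<le> ?n * (\<Sum>j<d. LINT x|disc. (w j x - \<phi> j x)\<^sup>2)"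
        by (rule L2_sum_bound) (intro in_L2_diff wL in_L2_continuous \<phi>cont)
      also have "\<dots> \<le> ?n * (d * \<epsilon>)"
        using sum_bounded_above[of "{..<d}" "\<lambda>j. LINT x|disc. (w j x - \<phi> j x)\<^sup>2" \<epsilon>] \<phi>(2) n
        by (intro mult_left_mono) auto
      finally show ?thesis by (simp add: wc_def f_def right_diff_distrib sum_subtractf)
    qed
    have "(LINT x|disc. (f x - radialize f x)\<^sup>2) \<le> 4 * (LINT x|disc. (wc x - f x)\<^sup>2)"
      by (rule radialize_L2[OF fg wcL wcr])
    also have "\<dots> \<le> 4 * (?n * (d * \<epsilon>))" using close by simp
    finally have fP: "(LINT x|disc. (f x - radialize f x)\<^sup>2) \<le> 4 * (?n * (d * \<epsilon>))" .
    have f2: "(LINT x|disc. (f x)\<^sup>2) \<le> ?n * C"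
    proof -
      have iw: "integrable disc (\<lambda>x. (wc x)\<^sup>2)" "integrable disc (\<lambda>x. (wc x - f x)\<^sup>2)"
        using in_L2_sq_integrable[OF wcL] in_L2_sq_integrable[OF in_L2_diff[OF wcL fL]] by auto
      have "(LINT x|disc. (f x)\<^sup>2) \<le> (LINT x|disc. 2 * (wc x)\<^sup>2 + 2 * (wc x - f x)\<^sup>2)"
      proof (rule integral_mono[OF in_L2_sq_integrable[OF fL]])
        show "integrable disc (\<lambda>x. 2 * (wc x)\<^sup>2 + 2 * (wc x - f x)\<^sup>2)" using iw by simp
        show "(f x)\<^sup>2 \<le> 2 * (wc x)\<^sup>2 + 2 * (wc x - f x)\<^sup>2" for x
          using zero_le_power2[of "wc x + (wc x - f x)"] by (simp add: power2_eq_square algebra_simps)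
      qed
      also have "\<dots> = 2 * (LINT x|disc. (wc x)\<^sup>2) + 2 * (LINT x|disc. (wc x - f x)\<^sup>2)" using iw by simp
      also have "(LINT x|disc. (wc x)\<^sup>2) \<le> ?n * (\<Sum>j<d. LINT x|disc. (w j x)\<^sup>2)"
        unfolding wc_def by (rule L2_sum_bound[OF wL])
      finally have "(LINT x|disc. (f x)\<^sup>2) \<le> 2 * (?n * (\<Sum>j<d. LINT x|disc. (w j x)\<^sup>2)) + 2 * (?n * (d * \<epsilon>))"
        using close by simp
      also have "\<dots> = ?n * (2 * (\<Sum>j<d. LINT x|disc. (w j x)\<^sup>2) + 2 * (d * \<epsilon>))"
        by (simp only: distrib_left mult_ac)
      also have "\<dots> \<le> ?n * C" unfolding C_def using eps1 n by (intro mult_left_mono add_left_mono) auto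
      finally show ?thesis .
    qed
    let ?P = "radialize f"
    have ifP: "integrable disc (\<lambda>x. (f x - ?P x)\<^sup>2)" by (rule in_L2_sq_integrable[OF in_L2_diff[OF fL PfL]])
    have iWf: "integrable disc (\<lambda>x. ?W x * (f x)\<^sup>2)" by (rule integrable_weight_mult[OF W(1) Wb in_L2_sq_integrable[OF fL]])
    have iWP: "integrable disc (\<lambda>x. ?W x * (?P x)\<^sup>2)" by (rule integrable_weight_mult[OF W(1) Wb in_L2_sq_integrable[OF PfL]])
    have "(LINT x|disc. ?W x * (f x)\<^sup>2 - M * (t * (f x)\<^sup>2 + (1 + 1 / t) * (f x - ?P x)\<^sup>2)) \<le> (LINT x|disc. ?W x * (?P x)\<^sup>2)"
    proof (rule integral_mono[OF _ iWP])
      show "integrable disc (\<lambda>x. ?W x * (f x)\<^sup>2 - M * (t * (f x)\<^sup>2 + (1 + 1 / t) * (f x - ?P x)\<^sup>2))"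
        using iWf ifP in_L2_sq_integrable[OF fL] by simp
      fix x assume "x \<in> space disc"
      then have x: "x \<in> unit_disc" by simp
      let ?Z = "t * (f x)\<^sup>2 + (1 + 1 / t) * (f x - ?P x)\<^sup>2"
      have Z: "0 \<le> ?Z" using t by simp
      have "- (?P x)\<^sup>2 \<le> - (f x)\<^sup>2 + ?Z" using sq_perturb(2)[OF t(1) order_refl order_refl, of "?P x" "f x"] by simp
      then have "?W x * (- (?P x)\<^sup>2) \<le> ?W x * (- (f x)\<^sup>2 + ?Z)" by (rule mult_left_mono[OF _ potential_nonneg])
      moreover have "?W x * ?Z \<le> M * ?Z" using W(2)[OF x] Z by (intro mult_right_mono) auto
      ultimately show "?W x * (f x)\<^sup>2 - M * ?Z \<le> ?W x * (?P x)\<^sup>2" unfolding distrib_left by linarith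
    qed
    also have "(LINT x|disc. ?W x * (f x)\<^sup>2 - M * (t * (f x)\<^sup>2 + (1 + 1 / t) * (f x - ?P x)\<^sup>2))
        = (LINT x|disc. ?W x * (f x)\<^sup>2) - M * (t * (LINT x|disc. (f x)\<^sup>2) + (1 + 1 / t) * (LINT x|disc. (f x - ?P x)\<^sup>2))"
      using iWf ifP in_L2_sq_integrable[OF fL] by simp
    finally have "p * ((LINT x|disc. ?W x * (f x)\<^sup>2) - M * (t * (LINT x|disc. (f x)\<^sup>2) + (1 + 1 / t) * (LINT x|disc. (f x - ?P x)\<^sup>2)))
       \<le> p * (LINT x|disc. ?W x * (?P x)\<^sup>2)" using p by (intro mult_left_mono) auto
    then have "qform p ?W ?P (radialize_grad g) \<le> qform p ?W f g
        + (p * M * (t * (LINT x|disc. (f x)\<^sup>2)) + p * M * (1 + 1 / t) * (LINT x|disc. (f x - ?P x)\<^sup>2))"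
      using radialize_energy[OF fg] unfolding qform_def by (simp add: algebra_simps)
    also have "qform p ?W f g \<le> - \<eta> * ?n" unfolding f_def g_def by (rule \<phi>(3))
    also have "p * M * (t * (LINT x|disc. (f x)\<^sup>2)) \<le> p * M * (t * (?n * C))"
      using f2 t pM by (intro mult_left_mono) auto
    also have "\<dots> = ?n * (p * M * (t * C))" by (simp only: mult_ac)
    also have "\<dots> \<le> ?n * (\<eta> / 4)" using t(2) n by (intro mult_left_mono) auto
    also have "p * M * (1 + 1 / t) * (LINT x|disc. (f x - ?P x)\<^sup>2) \<le> K * (4 * (?n * (d * \<epsilon>)))"
      using K fP by (intro mult_mono) auto
    also have "\<dots> = ?n * (K * (4 * (d * \<epsilon>)))" by (simp only: mult_ac)
    also have "\<dots> \<le> ?n * (\<eta> / 4)" using eps2 n by (intro mult_left_mono) auto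
    also have "- \<eta> * ?n + (?n * (\<eta> / 4) + ?n * (\<eta> / 4)) < 0" using n \<eta> by (simp add: field_simps)
    finally show "qform p ?W (\<lambda>x. \<Sum>j<d. c j * radialize (\<phi> j) x) (\<lambda>x. \<Sum>j<d. c j *\<^sub>R radialize_grad (gradient (\<phi> j)) x) < 0"
      unfolding Pf Pg by simp
  qed
qed

section \<open>Upper bound for the radial Morse index\<close>

text \<open>Gaussian elimination: every equation uses up at most one unknown, the pivot \<open>k\<close>.\<close>
lemma nontrivial_solution:
  fixes A :: "'i \<Rightarrow> 'j \<Rightarrow> real"
  assumes "finite I" "finite J" "card I < card J"
  shows "\<exists>c. (\<exists>j\<in>J. c j \<noteq> 0) \<and> (\<forall>i\<in>I. (\<Sum>j\<in>J. c j * A i j) = 0)"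
  using assms
proof (induction I arbitrary: J A rule: finite_induct)
  case empty
  then obtain k where "k \<in> J" by fastforce
  then show ?case by (intro exI[of _ "\<lambda>j. 1"]) auto
next
  case (insert i I)
  show ?case
  proof (cases "\<forall>j\<in>J. A i j = 0")
    case True
    obtain c where "\<exists>j\<in>J. c j \<noteq> 0" "\<forall>i\<in>I. (\<Sum>j\<in>J. c j * A i j) = 0"
      using insert.IH[of J A] insert.prems insert.hyps by auto
    then show ?thesis using True by (intro exI[of _ c]) auto
  next
    case False
    then obtain k where k: "k \<in> J" "A i k \<noteq> 0" by blast
    let ?J = "J - {k}"
    have "card I < card ?J" using insert.prems insert.hyps k by simp
    then obtain c where c: "\<exists>j\<in>?J. c j \<noteq> 0" "\<And>l. l \<in> I \<Longrightarrow> (\<Sum>j\<in>?J. c j * (A l j - A l k * A i j / A i k)) = 0"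
      using insert.IH[of ?J "\<lambda>l j. A l j - A l k * A i j / A i k"] insert.prems by auto
    define s where "s = (\<Sum>j\<in>?J. c j * A i j)"
    define c' where "c' j = (if j = k then - s / A i k else c j)" for j
    have split: "(\<Sum>j\<in>J. c' j * A l j) = - s / A i k * A l k + (\<Sum>j\<in>?J. c j * A l j)" for l
      using insert.prems k by (subst sum.remove[of _ k]) (auto simp: c'_def intro!: sum.cong)
    show ?thesis
    proof (intro exI[of _ c'] conjI ballI)
      show "\<exists>j\<in>J. c' j \<noteq> 0" using c(1) by (auto simp: c'_def)
      fix l assume l: "l \<in> insert i I"
      show "(\<Sum>j\<in>J. c' j * A l j) = 0"
      proof (cases "l = i")
        case True
        then show ?thesis using k by (simp add: split s_def)
      next
        case False
        then have "(\<Sum>j\<in>?J. c j * A l j - A l k / A i k * (c j * A i j)) = 0"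
          using c(2)[of l] l by (simp add: right_diff_distrib mult_ac)
        then have "(\<Sum>j\<in>?J. c j * A l j) - A l k / A i k * s = 0"
          by (simp add: sum_subtractf sum_distrib_left s_def)
        then show ?thesis by (simp add: split mult_ac)
      qed
    qed
  qed
qed

text \<open>The gradient of \<open>x \<mapsto> |x|^a x_i\<close>. With \<open>a = k - 1\<close> these are the components of the
  radial map \<open>|x|^(k-1) x\<close>; they also occur in the linearised equation. At the origin the second
  summand vanishes because of the factors \<open>x\<close>.\<close>
definition wid_grad :: "real \<Rightarrow> 2 \<Rightarrow> real^2 \<Rightarrow> real^2" where
  "wid_grad a i x = henon_weight a x *\<^sub>R axis i 1 + (a * (norm x powr (a - 2)) * x $ i) *\<^sub>R x"

lemma norm_powr_deriv:
  assumes "x \<noteq> (0::real^2)"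
  shows "((\<lambda>x. norm x powr a) has_derivative (\<lambda>h. ((a * norm x powr (a - 2)) *\<^sub>R x) \<bullet> h)) (at x)"
proof -
  have n: "0 < norm x" using assms by simp
  have "((\<lambda>r. r powr a) has_derivative (\<lambda>t. (a * norm x powr (a - 1)) * t)) (at (norm x))"
    using has_real_derivative_powr[OF n, of a] unfolding has_field_derivative_def by simp
  from has_derivative_compose[OF has_derivative_norm[OF assms] this]
  have d: "((\<lambda>x. norm x powr a) has_derivative (\<lambda>h. (a * norm x powr (a - 1)) * (h \<bullet> sgn x))) (at x)" .
  have "norm x powr (a - 1) = norm x powr (a - 2) * norm x"
    using n powr_add[of "norm x" "a - 2" 1] by simp
  then have "(\<lambda>h. (a * norm x powr (a - 1)) * (h \<bullet> sgn x)) = (\<lambda>h. ((a * norm x powr (a - 2)) *\<^sub>R x) \<bullet> h)"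
    using n by (auto simp: fun_eq_iff sgn_div_norm inner_commute)
  with d show ?thesis by simp
qed

lemma henon_weight_deriv:
  assumes "x \<noteq> 0"
  shows "(henon_weight a has_derivative (\<lambda>h. ((a * norm x powr (a - 2)) *\<^sub>R x) \<bullet> h)) (at x)"
proof (cases "a = 0")
  case True
  then have "henon_weight a = (\<lambda>x. 1)" by (auto simp: henon_weight_def)
  then show ?thesis using True by simp
next
  case False
  then have "henon_weight a = (\<lambda>x. norm x powr a)" by (auto simp: henon_weight_def)
  then show ?thesis using norm_powr_deriv[OF assms] by simp
qed

lemma wid_deriv:
  assumes a: "0 \<le> a"
  shows "((\<lambda>x. henon_weight a x * x $ i) has_derivative (\<lambda>h. wid_grad a i x \<bullet> h)) (at x)"
proof (cases "x = 0")
  case False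
  have c: "((\<lambda>x. x $ i) has_derivative (\<lambda>h. h $ i)) (at x)"
    by (rule bounded_linear_imp_has_derivative[OF bounded_linear_vec_nth])
  show ?thesis
    by (rule has_derivative_eq_rhs[OF has_derivative_mult[OF henon_weight_deriv[OF False] c]])
      (auto simp: wid_grad_def inner_add_left inner_axis' algebra_simps)
next
  case True
  show ?thesis
  proof (cases "a = 0")
    case True
    then have "(\<lambda>x. henon_weight a x * x $ i) = (\<lambda>x. x $ i)" by (auto simp: henon_weight_def)
    moreover have "(\<lambda>h. wid_grad a i x \<bullet> h) = (\<lambda>h. h $ i)" using True by (auto simp: wid_grad_def inner_axis' henon_weight_def)
    ultimately show ?thesis by (simp add: bounded_linear_imp_has_derivative[OF bounded_linear_vec_nth])
  next
    case False
    then have ap: "0 < a" using a by simp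
    have "((\<lambda>h::real^2. norm h powr a) \<longlongrightarrow> norm (0::real^2) powr a) (at 0)"
      by (rule tendsto_powr2[OF tendsto_norm[OF tendsto_ident_at] tendsto_const]) (use ap in auto)
    then have n0: "((\<lambda>h::real^2. norm h powr a) \<longlongrightarrow> 0) (at 0)" by simp
    \<comment> \<open>For \<open>a > 0\<close> the map is of higher than first order at the origin.\<close>
    have "((\<lambda>h::real^2. norm (henon_weight a h * h $ i) / norm h) \<longlongrightarrow> 0) (at 0)"
    proof (rule Lim_null_comparison[OF _ n0])
      have "norm (norm (henon_weight a h * h $ i) / norm h) \<le> norm h powr a" for h :: "real^2"
      proof (cases "h = 0")
        case False
        then have "norm h powr a * \<bar>h $ i\<bar> / norm h \<le> norm h powr a * norm h / norm h"
          by (intro divide_right_mono mult_left_mono component_le_norm_cart) auto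
        then show ?thesis using False ap by (simp add: henon_weight_def abs_mult)
      qed simp
      then show "eventually (\<lambda>h. norm (norm (henon_weight a h * h $ i) / norm h) \<le> norm h powr a) (at 0)" by simp
    qed
    then have "((\<lambda>x. henon_weight a x * x $ i) has_derivative (\<lambda>h. 0)) (at 0)"
      unfolding has_derivative_at by (simp add: bounded_linear_zero)
    then show ?thesis using \<open>x = 0\<close> ap by (simp add: wid_grad_def henon_weight_def)
  qed
qed

lemma wid_grad_cont:
  assumes a: "0 \<le> a"
  shows "continuous_on UNIV (wid_grad a i)"
proof (cases "a = 0")
  case True
  then have "wid_grad a i = (\<lambda>x. axis i 1)" by (auto simp: wid_grad_def henon_weight_def)
  then show ?thesis by simp
next
  case False
  then have ap: "0 < a" using a by simp
  let ?v = "\<lambda>x::real^2. (a * (norm x powr (a - 2)) * x $ i) *\<^sub>R x"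
  have "continuous (at x) ?v" for x
  proof (cases "x = 0")
    case True
    have "((\<lambda>h::real^2. a * norm h powr a) \<longlongrightarrow> a * norm (0::real^2) powr a) (at 0)"
      by (rule tendsto_mult[OF tendsto_const tendsto_powr2[OF tendsto_norm[OF tendsto_ident_at] tendsto_const]]) (use ap in auto)
    then have n0: "((\<lambda>h::real^2. a * norm h powr a) \<longlongrightarrow> 0) (at 0)" by simp
    have "(?v \<longlongrightarrow> 0) (at 0)"
    proof (rule Lim_null_comparison[OF _ n0])
      have "norm (?v h) \<le> a * norm h powr a" for h :: "real^2"
      proof (cases "h = 0")
        case False
        then have "norm h powr a = norm h powr (a - 2) * (norm h * norm h)"
          using powr_add[of "norm h" "a - 2" 2] by (simp add: powr_numeral power2_eq_square)
        moreover have "\<bar>h $ i\<bar> * norm h \<le> norm h * norm h" by (intro mult_right_mono component_le_norm_cart) auto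
        ultimately show ?thesis using ap by (simp add: abs_mult mult.assoc mult_left_mono)
      qed simp
      then show "eventually (\<lambda>h. norm (?v h) \<le> a * norm h powr a) (at 0)" by simp
    qed
    then show ?thesis using True by (simp add: continuous_at)
  next
    case False
    then show ?thesis by (intro continuous_intros) auto
  qed
  then have v: "continuous_on UNIV ?v" by (intro continuous_at_imp_continuous_on) auto
  show ?thesis unfolding wid_grad_def
    by (rule continuous_on_add[OF continuous_on_scaleR[OF henon_weight_cont[OF a] continuous_on_const] v])
qed

lemma wid_div: "0 \<le> a \<Longrightarrow> wid_grad a 1 x $ 1 + wid_grad a 2 x $ 2 = (2 + a) * henon_weight a x"
proof (cases "x = 0 \<or> a = 0")
  case False
  have "norm x powr a = norm x powr (a - 2) * (norm x)\<^sup>2"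
    using False powr_add[of "norm x" "a - 2" 2] by (simp add: powr_numeral)
  then have "(2 + a) * norm x powr a = 2 * norm x powr a + a * (norm x powr (a - 2) * ((x $ 1)\<^sup>2 + (x $ 2)\<^sup>2))"
    by (simp add: norm2_sq distrib_right)
  then show ?thesis using False
    by (simp add: wid_grad_def henon_weight_def axis_def power2_eq_square algebra_simps)
qed (auto simp: wid_grad_def henon_weight_def axis_def)

context
  fixes p a :: real and u :: "real^2 \<Rightarrow> real"
  assumes p: "1 < p" and a: "0 \<le> a" and sol: "henon_solution p a u" and rad: "radial u" and u0: "u 0 \<noteq> 0"
begin

definition scal :: real where "scal = (2 + a) / (p - 1)"

text \<open>The derivative at \<open>t = 1\<close> of \<open>t^c u(t x)\<close> with \<open>c = scal\<close>, the scaling that leaves the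
  equation invariant; therefore it solves the linearised equation (\<open>lin_div\<close>).\<close>
definition lin_sol :: "real^2 \<Rightarrow> real" where
  "lin_sol x = x \<bullet> gradient u x + scal * u x"
text \<open>The gradient of \<open>lin_sol\<close>, with the second derivatives of \<open>u\<close> eliminated by the equation. In
  this form it contains only the first derivatives of \<open>u\<close>, so that \<open>lin_sol\<close> is of class
  \<open>C^2\<close> like \<open>u\<close> itself.\<close>
definition lin_grad :: "real^2 \<Rightarrow> real^2" where
  "lin_grad x = scal *\<^sub>R gradient u x - (henon_weight a x * pw p (u x)) *\<^sub>R x"

lemma scal_pos: "0 < scal" and scal_eq: "scal + (2 + a) = p * scal"
  using p a by (auto simp: scal_def field_simps)

lemma profile0: "profile u 0 \<noteq> 0" using u0 by (simp add: profile_def)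

lemma lin_sol_radial:
  assumes "x \<in> unit_disc"
  shows "lin_sol x = norm x * profile' u (norm x) + scal * profile u (norm x)"
proof (cases "x = 0")
  case True
  then show ?thesis using gradient_zero[OF sol rad] by (simp add: lin_sol_def profile_def)
next
  case False
  have "x \<bullet> gradient u x = norm x * profile' u (norm x)"
    using gradient_radial[OF sol rad assms False] False
    by (simp add: power2_norm_eq_inner[symmetric] power2_eq_square)
  then show ?thesis using radial_profile[OF sol rad assms] by (simp add: lin_sol_def)
qed

text \<open>Away from the origin, \<open>z = r u' + c u\<close> in the radial variable and the equation gives \<open>z' = c
  u' - r^(1+a) |u|^(p-1) u\<close>. At the origin the product rule suffices, since the gradient of \<open>u\<close>
  vanishes there.\<close>
lemma lin_sol_deriv:
  assumes x: "x \<in> unit_disc"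
  shows "(lin_sol has_derivative (\<lambda>h. lin_grad x \<bullet> h)) (at x)"
proof (cases "x = 0")
  case True
  have c: "((\<lambda>x. x $ i) has_derivative (\<lambda>h. h $ i)) (at x)" for i :: 2
    by (rule bounded_linear_imp_has_derivative[OF bounded_linear_vec_nth])
  have "lin_sol = (\<lambda>x. (x $ 1 * partial_deriv 1 u x + x $ 2 * partial_deriv 2 u x) + scal * u x)"
    by (auto simp: lin_sol_def inner2)
  moreover have "((\<lambda>x. (x $ 1 * partial_deriv 1 u x + x $ 2 * partial_deriv 2 u x) + scal * u x) has_derivative
      (\<lambda>h. ((x $ 1 * (gradient (partial_deriv 1 u) x \<bullet> h) + h $ 1 * partial_deriv 1 u x)
         + (x $ 2 * (gradient (partial_deriv 2 u) x \<bullet> h) + h $ 2 * partial_deriv 2 u x)) + scal * (gradient u x \<bullet> h))) (at x)"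
    by (intro has_derivative_add has_derivative_mult has_derivative_mult_right c
        solution_regularity(1)[OF sol x] solution_regularity(2)[OF sol x])
  moreover have "partial_deriv i u 0 = 0" for i using gradient_zero[OF sol rad] by (metis gradient_nth zero_index)
  ultimately show ?thesis using True gradient_zero[OF sol rad] by (simp add: lin_grad_def)
next
  case False
  let ?r = "norm x"
  let ?U = "profile u" and ?U1 = "profile' u"
  have r: "0 < ?r" "?r < 1" using x False by auto
  have "((\<lambda>r. r * ?U1 r + scal * ?U r) has_real_derivative
     ((1 * ?U1 ?r + (- ?U1 ?r / ?r - ?r powr a * pw p (?U ?r)) * ?r) + scal * ?U1 ?r)) (at ?r)"
    by (intro DERIV_add DERIV_mult DERIV_cmult DERIV_ident profile_ode[OF sol rad r] profile_deriv[OF sol rad]) (use r in auto)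
  then have "((\<lambda>r. r * ?U1 r + scal * ?U r) has_derivative (\<lambda>t. (scal * ?U1 ?r - ?r * (?r powr a * pw p (?U ?r))) * t)) (at ?r)"
    unfolding has_field_derivative_def by (rule has_derivative_eq_rhs) (use r in \<open>auto simp: fun_eq_iff algebra_simps\<close>)
  from has_derivative_compose[OF has_derivative_norm[OF False] this]
  have "((\<lambda>y. norm y * ?U1 (norm y) + scal * ?U (norm y)) has_derivative
      (\<lambda>h. (scal * ?U1 ?r - ?r * (?r powr a * pw p (?U ?r))) * (h \<bullet> sgn x))) (at x)" .
  then have d: "(lin_sol has_derivative (\<lambda>h. (scal * ?U1 ?r - ?r * (?r powr a * pw p (?U ?r))) * (h \<bullet> sgn x))) (at x)"
    by (rule has_derivative_transform_within_open[of _ _ _ _ unit_disc]) (use x lin_sol_radial in auto)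
  have hw: "henon_weight a x = ?r powr a" using henon_weight_axis r by blast
  have "(scal * ?U1 ?r - ?r * (?r powr a * pw p (?U ?r))) * (h \<bullet> sgn x) = lin_grad x \<bullet> h" for h
    unfolding lin_grad_def gradient_radial[OF sol rad x False] hw radial_profile[OF sol rad x]
    using r by (simp add: sgn_div_norm inner_diff_left inner_diff_right inner_commute field_simps)
  with d show ?thesis by simp
qed

definition lin_hess :: "2 \<Rightarrow> real^2 \<Rightarrow> real^2" where
  "lin_hess i x = scal *\<^sub>R gradient (partial_deriv i u) x -
     (pw p (u x) *\<^sub>R wid_grad a i x + (henon_weight a x * x $ i * (p * \<bar>u x\<bar> powr (p - 1))) *\<^sub>R gradient u x)"

lemma lin_grad_deriv:
  assumes x: "x \<in> unit_disc"
  shows "((\<lambda>x. lin_grad x $ i) has_derivative (\<lambda>h. lin_hess i x \<bullet> h)) (at x)"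
proof -
  have pu: "((\<lambda>x. pw p (u x)) has_derivative (\<lambda>h. (p * \<bar>u x\<bar> powr (p - 1)) * (gradient u x \<bullet> h))) (at x)"
    using has_derivative_compose[OF solution_regularity(1)[OF sol x] pw_deriv[OF p, THEN has_field_derivative_imp_has_derivative]] .
  have "((\<lambda>x. scal * partial_deriv i u x - pw p (u x) * (henon_weight a x * x $ i)) has_derivative
     (\<lambda>h. scal * (gradient (partial_deriv i u) x \<bullet> h) - (pw p (u x) * (wid_grad a i x \<bullet> h)
        + (p * \<bar>u x\<bar> powr (p - 1)) * (gradient u x \<bullet> h) * (henon_weight a x * x $ i)))) (at x)"
    by (intro has_derivative_diff has_derivative_mult_right has_derivative_mult pu wid_deriv a solution_regularity(2)[OF sol x])
  moreover have "(\<lambda>x. lin_grad x $ i) = (\<lambda>x. scal * partial_deriv i u x - pw p (u x) * (henon_weight a x * x $ i))"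
    by (auto simp: lin_grad_def)
  ultimately show ?thesis
    by (simp add: lin_hess_def inner_diff_left inner_add_left mult_ac)
qed

lemma sol_cont: "continuous_on unit_disc u" "continuous_on unit_disc (gradient u)"
  "continuous_on unit_disc (gradient (partial_deriv i u))"
proof -
  show "continuous_on unit_disc u" by (rule continuous_on_subset[OF solution_regularity(5)[OF sol]]) auto
  show "continuous_on unit_disc (gradient u)"
    unfolding gradient_def by (intro continuous_on_vec_lambda solution_regularity(4)[OF sol])
  show "continuous_on unit_disc (gradient (partial_deriv i u))"
    unfolding gradient_def by (intro continuous_on_vec_lambda solution_regularity(3)[OF sol])
qed

lemma pw_comp_cont: "continuous_on unit_disc (\<lambda>x. pw p (u x))"
  unfolding pw_def by (intro continuous_on_mult cont_powr continuous_on_rabs sol_cont(1)) (use p in auto)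

lemma lin_cont: "continuous_on unit_disc lin_sol" "continuous_on unit_disc lin_grad" "continuous_on unit_disc (lin_hess i)"
proof -
  show "continuous_on unit_disc lin_sol" unfolding lin_sol_def by (intro continuous_intros sol_cont)
  show "continuous_on unit_disc lin_grad" unfolding lin_grad_def
    by (intro continuous_intros sol_cont henon_weight_cont a pw_comp_cont)
  have up: "continuous_on unit_disc (\<lambda>x. \<bar>u x\<bar> powr (p - 1))"
    by (intro cont_powr continuous_on_rabs sol_cont(1)) (use p in auto)
  show "continuous_on unit_disc (lin_hess i)" unfolding lin_hess_def
    by (intro continuous_on_diff continuous_on_add continuous_on_scaleR continuous_on_mult continuous_on_const
        continuous_on_component[OF continuous_on_id] up sol_cont henon_weight_cont a pw_comp_cont
        continuous_on_subset[OF wid_grad_cont[OF a] subset_UNIV])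
qed

lemma lin_div:
  assumes x: "x \<in> unit_disc"
  shows "lin_hess 1 x $ 1 + lin_hess 2 x $ 2 = - p * potential p a u x * lin_sol x"
proof -
  have "lin_hess 1 x $ 1 + lin_hess 2 x $ 2 =
      scal * (partial_deriv 1 (partial_deriv 1 u) x + partial_deriv 2 (partial_deriv 2 u) x)
      - pw p (u x) * (wid_grad a 1 x $ 1 + wid_grad a 2 x $ 2)
      - henon_weight a x * (p * \<bar>u x\<bar> powr (p - 1)) * (x \<bullet> gradient u x)"
    by (simp add: lin_hess_def inner2 algebra_simps)
  also have "\<dots> = - (scal + (2 + a)) * (henon_weight a x * pw p (u x)) - p * potential p a u x * (x \<bullet> gradient u x)"
    unfolding solution_regularity(6)[OF sol x] wid_div[OF a] by (simp add: potential_def algebra_simps)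
  also have "\<dots> = - p * potential p a u x * lin_sol x"
    unfolding scal_eq potential_pw[symmetric] by (simp add: lin_sol_def algebra_simps)
  finally show ?thesis .
qed

text \<open>The difference of the two sides is \<open>|g - (F/z) G|^2\<close>.\<close>
lemma picone_pointwise:
  fixes z W F p' :: real and g G :: "real^2"
  assumes "z \<noteq> 0" "D = - p' * W * z"
  shows "2 * (F / z) * (g \<bullet> G) - (F\<^sup>2 / z\<^sup>2) * (G \<bullet> G) + F\<^sup>2 / z * D \<le> (norm g)\<^sup>2 - p' * (W * F\<^sup>2)"
proof -
  have "0 \<le> (norm (g - (F / z) *\<^sub>R G))\<^sup>2" by simp
  also have "\<dots> = (norm g)\<^sup>2 - 2 * (F / z) * (g \<bullet> G) + (F\<^sup>2 / z\<^sup>2) * (G \<bullet> G)"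
    unfolding power2_norm_eq_inner
    by (simp add: inner_diff_left inner_diff_right inner_commute power_divide power2_eq_square)
  moreover have "F\<^sup>2 / z * D = - p' * (W * F\<^sup>2)" using assms by simp
  ultimately show ?thesis by linarith
qed

text \<open>Picone's identity: the integrand dominates the divergence of \<open>(F^2 / z) grad z\<close> with \<open>F\<close> the
  truncation of \<open>\<psi>\<close>. The truncation makes \<open>F\<close> vanish near the zeros of \<open>z\<close>, so this
  field is of class \<open>C^1\<close> with compact support although it is a quotient.\<close>
lemma trunc_form_nonneg:
  assumes f: "c1c \<psi> \<xi>" and z: "\<And>x. x \<in> unit_disc \<Longrightarrow> lin_sol x = 0 \<Longrightarrow> \<psi> x = 0" and e: "0 < e"
  shows "0 \<le> qform p (potential p a u) (\<lambda>x. trunc e (\<psi> x)) (\<lambda>x. trunc' e (\<psi> x) *\<^sub>R \<xi> x)"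
    and "c1c (\<lambda>x. trunc e (\<psi> x)) (\<lambda>x. trunc' e (\<psi> x) *\<^sub>R \<xi> x)"
proof -
  let ?W = "potential p a u"
  define F where "F x = trunc e (\<psi> x)" for x
  define g where "g x = trunc' e (\<psi> x) *\<^sub>R \<xi> x" for x
  have \<xi>c: "continuous_on UNIV \<xi>" and \<psi>d: "\<And>x. (\<psi> has_derivative (\<lambda>h. \<xi> x \<bullet> h)) (at x)" using f by (auto simp: c1c_def)
  have \<psi>c: "continuous_on UNIV \<psi>" by (rule c1c_cont[OF f])
  obtain \<rho> where \<rho>: "0 < \<rho>" "\<rho> < 1" "\<And>x. \<rho> \<le> norm x \<Longrightarrow> \<psi> x = 0" using c1c_support[OF f] by metis
  have Fd: "(F has_derivative (\<lambda>h. g x \<bullet> h)) (at x)" for x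
    unfolding F_def g_def
    using has_derivative_compose[OF \<psi>d trunc_deriv[OF e, THEN has_field_derivative_imp_has_derivative]] by simp
  have gc: "continuous_on UNIV g" unfolding g_def
    by (intro continuous_intros \<xi>c continuous_on_compose2[OF trunc'_cont[OF e] \<psi>c]) auto
  have Fc: "continuous_on UNIV F" by (intro continuous_at_imp_continuous_on ballI has_derivative_continuous[OF Fd])
  have Fg: "c1c F g" by (rule c1cI[OF Fd gc \<rho>(2)]) (use \<rho> e in \<open>auto simp: F_def trunc_def\<close>)
  then show "c1c (\<lambda>x. trunc e (\<psi> x)) (\<lambda>x. trunc' e (\<psi> x) *\<^sub>R \<xi> x)" by (simp add: F_def[abs_def] g_def[abs_def])
  define S where "S = {x \<in> unit_disc. lin_sol x \<noteq> 0}"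
  have "S = unit_disc \<inter> lin_sol -` (- {0})" by (auto simp: S_def)
  then have oS: "open S" using continuous_open_preimage[OF lin_cont(1) open_ball] by (simp add: open_Compl)
  have Ss: "S \<subseteq> unit_disc" by (auto simp: S_def)
  let ?K = "{x. e \<le> \<bar>\<psi> x\<bar>}"
  have K: "compact ?K"
  proof -
    have "?K \<subseteq> cball 0 1"
    proof
      fix x assume "x \<in> ?K"
      then have "\<psi> x \<noteq> 0" using e by auto
      then have "\<not> \<rho> \<le> norm x" using \<rho>(3) by blast
      then show "x \<in> cball 0 1" using \<rho>(2) by simp
    qed
    moreover have "closed ?K" by (intro closed_Collect_le continuous_intros \<psi>c)
    ultimately show ?thesis unfolding compact_eq_bounded_closed using bounded_subset[OF bounded_cball] by blast
  qed
  have KS: "?K \<subseteq> S"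
  proof
    fix x assume "x \<in> ?K"
    then have n: "\<psi> x \<noteq> 0" using e by auto
    then have "\<not> \<rho> \<le> norm x" using \<rho>(3) by blast
    then have "x \<in> unit_disc" using \<rho>(2) by simp
    then show "x \<in> S" using z n by (auto simp: S_def)
  qed
  have F0: "F x = 0" "g x = 0" if "x \<notin> ?K" for x
    using that e by (auto simp: F_def g_def trunc_def trunc'_zero)
  let ?Phi = "\<lambda>i x. ((F x)\<^sup>2 / lin_sol x) * lin_grad x $ i"
  let ?Psi = "\<lambda>i x. ((F x)\<^sup>2 / lin_sol x) *\<^sub>R lin_hess i x + (lin_grad x $ i) *\<^sub>R
      ((2 * (F x / lin_sol x)) *\<^sub>R g x - ((F x)\<^sup>2 / (lin_sol x)\<^sup>2) *\<^sub>R lin_grad x)"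
  let ?G = "\<lambda>i x. if x \<in> S then ?Psi i x else 0"
  have c: "c1c (\<lambda>x. if x \<in> S then ?Phi i x else 0) (?G i)" for i
  proof (rule c1c_glue[OF oS Ss K KS])
    fix x assume x: "x \<in> S"
    then have xB: "x \<in> unit_disc" and nz: "lin_sol x \<noteq> 0" by (auto simp: S_def)
    have alg: "((y * s + s * y) * z - (y * y) * t) / (z * z) = 2 * (y / z) * s - y\<^sup>2 / z\<^sup>2 * t" if "z \<noteq> 0" for y s z t :: real
      using that by (simp add: field_simps power2_eq_square)
    have F2: "((\<lambda>x. F x * F x) has_derivative (\<lambda>h. F x * (g x \<bullet> h) + (g x \<bullet> h) * F x)) (at x)"
      by (rule has_derivative_mult[OF Fd Fd])
    have "((\<lambda>x. (F x * F x) / lin_sol x) has_derivative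
        (\<lambda>h. ((2 * (F x / lin_sol x)) *\<^sub>R g x - ((F x)\<^sup>2 / (lin_sol x)\<^sup>2) *\<^sub>R lin_grad x) \<bullet> h)) (at x)"
      by (rule has_derivative_eq_rhs[OF has_derivative_divide'[OF F2 lin_sol_deriv[OF xB] nz]])
        (simp only: inner_diff_left inner_scaleR_left alg[OF nz])
    then have q: "((\<lambda>x. (F x)\<^sup>2 / lin_sol x) has_derivative
        (\<lambda>h. ((2 * (F x / lin_sol x)) *\<^sub>R g x - ((F x)\<^sup>2 / (lin_sol x)\<^sup>2) *\<^sub>R lin_grad x) \<bullet> h)) (at x)"
      by (simp only: power2_eq_square)
    show "(?Phi i has_derivative (\<lambda>h. ?Psi i x \<bullet> h)) (at x)"
      by (rule has_derivative_eq_rhs[OF has_derivative_mult[OF q lin_grad_deriv[OF xB]]])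
        (simp add: inner_add_left mult.commute)
  next
    note [continuous_intros] = continuous_on_subset[OF lin_cont(1) Ss] continuous_on_subset[OF lin_cont(2) Ss]
      continuous_on_subset[OF lin_cont(3) Ss] continuous_on_subset[OF Fc subset_UNIV] continuous_on_subset[OF gc subset_UNIV]
    show "continuous_on S (?Psi i)" by (intro continuous_intros) (auto simp: S_def)
  next
    show "?Phi i x = 0" if "x \<notin> ?K" for x using F0(1)[OF that] by simp
  qed
  have Gc: "continuous_on UNIV (\<lambda>x. ?G i x $ i)" for i
    using c[of i] unfolding c1c_def by (intro continuous_on_component) blast
  have le: "?G 1 x $ 1 + ?G 2 x $ 2 \<le> (norm (g x))\<^sup>2 - p * (?W x * (F x)\<^sup>2)" for x
  proof (cases "x \<in> S")
    case True
    then have xB: "x \<in> unit_disc" and nz: "lin_sol x \<noteq> 0" by (auto simp: S_def)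
    have "?G 1 x $ 1 + ?G 2 x $ 2 = 2 * (F x / lin_sol x) * (g x \<bullet> lin_grad x) - ((F x)\<^sup>2 / (lin_sol x)\<^sup>2) * (lin_grad x \<bullet> lin_grad x)
        + (F x)\<^sup>2 / lin_sol x * (lin_hess 1 x $ 1 + lin_hess 2 x $ 2)"
      using True by (simp add: inner2 algebra_simps)
    with picone_pointwise[OF nz lin_div[OF xB]] show ?thesis by simp
  next
    case False
    then have "x \<notin> ?K" using KS by blast
    then show ?thesis using F0 False by simp
  qed
  note q = solution_form[OF p a sol Fg]
  have "0 = (LINT x|disc. ?G 1 x $ 1 + ?G 2 x $ 2)"
    using int_partial_zero[OF c, of 1 1] int_partial_zero[OF c, of 2 2]
    by (subst Bochner_Integration.integral_add[OF integrable_disc[OF Gc] integrable_disc[OF Gc]]) simp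
  also have "\<dots> \<le> qform p ?W F g" unfolding q(1)
    by (rule integral_mono[OF Bochner_Integration.integrable_add[OF integrable_disc[OF Gc] integrable_disc[OF Gc]] q(2) le])
  finally show "0 \<le> qform p ?W (\<lambda>x. trunc e (\<psi> x)) (\<lambda>x. trunc' e (\<psi> x) *\<^sub>R \<xi> x)"
    by (simp add: F_def[abs_def] g_def[abs_def])
qed

text \<open>Truncation at height \<open>e\<close> does not increase the Dirichlet energy and changes the potential term
  by \<open>O(e)\<close>; let \<open>e\<close> tend to \<open>0\<close>.\<close>
lemma form_nonneg:
  assumes f: "c1c \<psi> \<xi>" and z: "\<And>x. x \<in> unit_disc \<Longrightarrow> lin_sol x = 0 \<Longrightarrow> \<psi> x = 0"
  shows "0 \<le> qform p (potential p a u) \<psi> \<xi>"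
proof -
  let ?W = "potential p a u"
  obtain M where W: "?W \<in> borel_measurable disc" "\<And>x. x \<in> unit_disc \<Longrightarrow> 0 \<le> ?W x \<and> ?W x \<le> M"
    using potential_bounded[OF p a solution_regularity(5)[OF sol]] by blast
  have Wb: "\<bar>?W x\<bar> \<le> M" if "x \<in> unit_disc" for x using W(2)[OF that] by auto
  note L = c1c_in_L2[OF f]
  define B where "B = (LINT x|disc. ?W x * \<bar>\<psi> x\<bar>)"
  have iB: "integrable disc (\<lambda>x. ?W x * \<bar>\<psi> x\<bar>)"
    by (rule integrable_weight_mult[OF W(1) Wb]) (auto intro!: integrable_disc continuous_intros c1c_cont[OF f])
  have B0: "0 \<le> B" unfolding B_def using potential_nonneg by simp
  have main: "- (4 * p * e) * B \<le> qform p ?W \<psi> \<xi>" if e: "0 < e" for e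
  proof -
    let ?F = "\<lambda>x. trunc e (\<psi> x)" and ?g = "\<lambda>x. trunc' e (\<psi> x) *\<^sub>R \<xi> x"
    note T = trunc_form_nonneg[OF f z e]
    note FL = c1c_in_L2(1)[OF T(2)] and gL = c1c_in_L2(2)[OF T(2)]
    have "(LINT x|disc. (norm (?g x))\<^sup>2) \<le> (LINT x|disc. (norm (\<xi> x))\<^sup>2)"
    proof (rule integral_mono[OF int_sq_norm_integrable[OF gL] int_sq_norm_integrable[OF L(2)]])
      fix x
      have "\<bar>trunc' e (\<psi> x)\<bar> * norm (\<xi> x) \<le> 1 * norm (\<xi> x)" using trunc'_bounds[OF e] by (intro mult_right_mono) auto
      then show "(norm (?g x))\<^sup>2 \<le> (norm (\<xi> x))\<^sup>2" by (intro power_mono) auto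
    qed
    moreover have "(LINT x|disc. ?W x * (\<psi> x)\<^sup>2) \<le> (LINT x|disc. ?W x * (?F x)\<^sup>2 + (4 * e) * (?W x * \<bar>\<psi> x\<bar>))"
    proof (rule integral_mono)
      have iF: "integrable disc (\<lambda>x. ?W x * (?F x)\<^sup>2)" by (rule integrable_weight_mult[OF W(1) Wb in_L2_sq_integrable[OF FL]])
      then show "integrable disc (\<lambda>x. ?W x * (?F x)\<^sup>2 + (4 * e) * (?W x * \<bar>\<psi> x\<bar>))" using iB by simp
      show "integrable disc (\<lambda>x. ?W x * (\<psi> x)\<^sup>2)" by (rule integrable_weight_mult[OF W(1) Wb in_L2_sq_integrable[OF L(1)]])
      fix x
      have "(\<psi> x)\<^sup>2 \<le> (?F x)\<^sup>2 + 4 * e * \<bar>\<psi> x\<bar>" using trunc_bound(3)[OF e, of "\<psi> x"] by simp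
      then have "?W x * (\<psi> x)\<^sup>2 \<le> ?W x * ((?F x)\<^sup>2 + 4 * e * \<bar>\<psi> x\<bar>)" by (rule mult_left_mono[OF _ potential_nonneg])
      then show "?W x * (\<psi> x)\<^sup>2 \<le> ?W x * (?F x)\<^sup>2 + (4 * e) * (?W x * \<bar>\<psi> x\<bar>)" by (simp add: algebra_simps)
    qed
    moreover have "(LINT x|disc. ?W x * (?F x)\<^sup>2 + (4 * e) * (?W x * \<bar>\<psi> x\<bar>)) = (LINT x|disc. ?W x * (?F x)\<^sup>2) + (4 * e) * B"
    proof -
      have iF: "integrable disc (\<lambda>x. ?W x * (?F x)\<^sup>2)" by (rule integrable_weight_mult[OF W(1) Wb in_L2_sq_integrable[OF FL]])
      then show ?thesis using iB by (simp add: B_def)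
    qed
    ultimately have "(LINT x|disc. ?W x * (\<psi> x)\<^sup>2) \<le> (LINT x|disc. ?W x * (?F x)\<^sup>2) + (4 * e) * B" by simp
    then have "p * (LINT x|disc. ?W x * (\<psi> x)\<^sup>2) \<le> p * ((LINT x|disc. ?W x * (?F x)\<^sup>2) + (4 * e) * B)"
      using p by (intro mult_left_mono) auto
    with T(1) \<open>(LINT x|disc. (norm (?g x))\<^sup>2) \<le> (LINT x|disc. (norm (\<xi> x))\<^sup>2)\<close>
    show ?thesis unfolding qform_def by (simp add: algebra_simps)
  qed
  show ?thesis
  proof (rule ccontr)
    assume "\<not> ?thesis"
    then have neg: "qform p ?W \<psi> \<xi> < 0" by simp
    define e where "e = - qform p ?W \<psi> \<xi> / (4 * p * (B + 1))"
    have P: "0 < 4 * p * (B + 1)" using p B0 by simp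
    have "0 < e" using neg P by (simp add: e_def divide_neg_pos)
    have "e * (4 * p * (B + 1)) = - qform p ?W \<psi> \<xi>"
      by (simp only: e_def times_divide_eq_left nonzero_mult_div_cancel_right[OF less_imp_neq[OF P, symmetric]])
    moreover have "e * (4 * p * (B + 1)) = (4 * p * e) * B + 4 * p * e" by (simp add: algebra_simps)
    moreover have "0 < 4 * p * e" using p \<open>0 < e\<close> by simp
    moreover have "- (4 * p * e * B) \<le> qform p ?W \<psi> \<xi>" using main[OF \<open>0 < e\<close>] by simp
    ultimately show False by linarith
  qed
qed

definition lin_zeros :: "real set" where
  "lin_zeros = {r. 0 < r \<and> r < 1 \<and> r * profile' u r + scal * profile u r = 0}"

text \<open>At a common zero of \<open>u\<close> and \<open>r u' + c u\<close> the derivative vanishes too.\<close>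
lemma profile_nz:
  assumes "r \<in> lin_zeros"
  shows "profile u r \<noteq> 0"
proof
  assume 0: "profile u r = 0"
  then have "profile' u r = 0" "0 < r" "r < 1" using assms by (auto simp: lin_zeros_def)
  then show False
    using emden_backward[OF p a order_refl profile_emden[OF sol rad] _ _ 0] profile0 by blast
qed

text \<open>The derivative of \<open>r u' / u\<close> is \<open>- r^(1+a) |u|^(p-1) - r (u' / u)^2\<close>.\<close>
lemma log_derivative_decreasing:
  assumes r: "0 < r" "r < s" "s < 1" and nz: "\<And>t. r \<le> t \<Longrightarrow> t \<le> s \<Longrightarrow> profile u t \<noteq> 0"
  shows "s * profile' u s / profile u s < r * profile' u r / profile u r"
proof (rule DERIV_neg_imp_decreasing[OF r(2)])
  fix t assume t: "r \<le> t" "t \<le> s"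
  let ?U = "profile u t" and ?U1 = "profile' u t"
  have t': "0 < t" "t < 1" "?U \<noteq> 0" using t r nz by auto
  let ?D = "((1 * ?U1 + (- ?U1 / t - t powr a * pw p ?U) * t) * ?U - t * ?U1 * ?U1) / (?U * ?U)"
  have "((\<lambda>t. t * profile' u t / profile u t) has_real_derivative ?D) (at t)"
    by (intro DERIV_divide DERIV_mult DERIV_ident profile_ode[OF sol rad] profile_deriv[OF sol rad]) (use t' in auto)
  moreover have "?D < 0"
  proof -
    have sq: "0 < ?U * ?U" using not_real_square_gt_zero t'(3) by blast
    have "(1 * ?U1 + (- ?U1 / t - t powr a * pw p ?U) * t) * ?U - t * ?U1 * ?U1
        = - (t * (t powr a * (\<bar>?U\<bar> powr (p - 1) * (?U * ?U)))) - t * (?U1 * ?U1)"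
      using t' by (simp add: pw_def field_simps)
    moreover have "0 < t * (t powr a * (\<bar>?U\<bar> powr (p - 1) * (?U * ?U)))"
      by (rule mult_pos_pos[OF t'(1) mult_pos_pos[OF _ mult_pos_pos[OF _ sq]]]) (use t' in auto)
    moreover have "0 \<le> t * (?U1 * ?U1)" using t' by simp
    ultimately show ?thesis using sq by (intro divide_neg_pos) linarith+
  qed
  ultimately show "\<exists>y. ((\<lambda>t. t * profile' u t / profile u t) has_real_derivative y) (at t) \<and> y < 0" by blast
qed

text \<open>A zero is a point where \<open>r u' / u = - c\<close>. Two zeros in the same nodal set would contradict
  strict monotonicity of \<open>r u' / u\<close>, so sending a zero to the nodal set of a point on its circle
  is injective.\<close>
lemma card_lin_zeros:
  assumes n: "num_nodal_sets u = n" "1 \<le> n"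
  shows "finite lin_zeros" "card lin_zeros \<le> n"
proof -
  let ?N = "{x\<in>unit_disc. u x \<noteq> 0}"
  have cN: "card (components ?N) = n" using n(1) by (simp add: num_nodal_sets_def)
  have fN: "finite (components ?N)" using cN n(2) card_ge_0_finite by force
  let ?e = "\<lambda>r. r *\<^sub>R axis 1 1 :: real^2"
  let ?C = "\<lambda>r. connected_component_set ?N (?e r)"
  have eN: "?e r \<in> ?N" if "r \<in> lin_zeros" for r
    using profile_nz[OF that] that by (auto simp: lin_zeros_def profile_def)
  have sub: "?C ` lin_zeros \<subseteq> components ?N"
    using eN by (auto simp: components_def)
  have step: False if rs: "r \<in> lin_zeros" "s \<in> lin_zeros" "r < s" "?C r = ?C s" for r s
  proof -
    have C: "connected (?C r)" "?C r \<subseteq> ?N" by (simp_all add: connected_component_subset)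
    have "?e r \<in> ?C r" using eN[OF rs(1)] by (simp add: connected_component_refl_eq)
    moreover have "?e s \<in> ?C r" using eN[OF rs(2)] unfolding rs(4) by (simp add: connected_component_refl_eq)
    moreover have r0: "0 < r" "s < 1" using rs by (auto simp: lin_zeros_def)
    moreover have "r = norm (?e r)" "s = norm (?e s)" using r0 rs(3) by simp_all
    ultimately have im: "r \<in> norm ` ?C r" "s \<in> norm ` ?C r" by (blast intro: image_eqI)+
    have "connected (norm ` ?C r)" by (intro connected_continuous_image continuous_intros C)
    then have "t \<in> norm ` ?C r" if "r \<le> t" "t \<le> s" for t
      using im that by (auto simp: is_interval_connected_1[symmetric] is_interval_1)
    then have "profile u t \<noteq> 0" if t: "r \<le> t" "t \<le> s" for t
    proof -
      obtain x where "x \<in> ?N" "t = norm x" using \<open>\<And>t. r \<le> t \<Longrightarrow> t \<le> s \<Longrightarrow> t \<in> norm ` ?C r\<close>[OF t] C(2) by blast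
      then show ?thesis using radial_profile[OF sol rad, of x] by auto
    qed
    from log_derivative_decreasing[OF r0(1) rs(3) r0(2) this]
    have "s * profile' u s / profile u s < r * profile' u r / profile u r" by blast
    moreover have "t * profile' u t / profile u t = - scal" if "t \<in> lin_zeros" for t
      using that profile_nz[OF that] by (simp add: lin_zeros_def divide_eq_eq)
    ultimately show False using rs by simp
  qed
  have "inj_on ?C lin_zeros"
  proof (rule inj_onI, rule ccontr)
    fix r s assume "r \<in> lin_zeros" "s \<in> lin_zeros" "?C r = ?C s" "r \<noteq> s"
    then show False using step[of r s] step[of s r] by fastforce
  qed
  then show "finite lin_zeros" "card lin_zeros \<le> n"
    using sub fN cN finite_imageD[of ?C lin_zeros] finite_subset[OF sub fN] card_image[of ?C lin_zeros] card_mono[OF fN sub]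
    by auto
qed

text \<open>In a negative definite space of dimension greater than \<open>n\<close>, some nonzero function vanishes on
  all circles where the solution of the linearised equation vanishes.\<close>
lemma radial_morse_index_upper:
  assumes n: "num_nodal_sets u = n" "1 \<le> n"
  shows "radial_morse_index p a u \<le> enat n"
  unfolding radial_morse_index_def max_neg_dim_def
proof (rule SUP_least)
  let ?W = "potential p a u"
  fix V assume "V \<in> {V. neg_def_subspace (henon_form p a u) H10_rad V}"
  then have V: "neg_def_subspace (henon_form p a u) H10_rad V" by simp
  define d where "d = real_fun.dim V"
  have "d \<le> n"
  proof (rule ccontr)
    assume "\<not> d \<le> n"
    then have dn: "n < d" by simp
    obtain M where W: "?W \<in> borel_measurable disc" "\<And>x. x \<in> unit_disc \<Longrightarrow> 0 \<le> ?W x \<and> ?W x \<le> M"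
      using potential_bounded[OF p a solution_regularity(5)[OF sol]] by blast
    have d0: "0 < d" and p0: "0 < p" using dn p by auto
    obtain \<psi> \<xi> where \<psi>: "\<And>j. j < d \<Longrightarrow> c1c (\<psi> j) (\<xi> j)" "\<And>j x y. j < d \<Longrightarrow> norm x = norm y \<Longrightarrow> \<psi> j x = \<psi> j y"
      "\<And>c. \<exists>j<d. c j \<noteq> 0 \<Longrightarrow> qform p ?W (\<lambda>x. \<Sum>j<d. c j * \<psi> j x) (\<lambda>x. \<Sum>j<d. c j *\<^sub>R \<xi> j x) < 0"
      by (rule radial_approx_neg_def[OF V d_def[symmetric] d0 p0 W]) blast+
    have "card lin_zeros < card {..<d}" using card_lin_zeros(2)[OF n] dn by simp
    from nontrivial_solution[OF card_lin_zeros(1)[OF n] finite_lessThan this, of "\<lambda>r j. \<psi> j (r *\<^sub>R axis 1 1)"]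
    obtain c where c': "(\<exists>j\<in>{..<d}. c j \<noteq> 0) \<and> (\<forall>r\<in>lin_zeros. (\<Sum>j<d. c j * \<psi> j (r *\<^sub>R axis 1 1)) = 0)"
      by (rule exE)
    then have c: "\<exists>j\<in>{..<d}. c j \<noteq> 0" "\<And>r. r \<in> lin_zeros \<Longrightarrow> (\<Sum>j<d. c j * \<psi> j (r *\<^sub>R axis 1 1)) = 0"
      by simp_all
    have "0 \<le> qform p ?W (\<lambda>x. \<Sum>j<d. c j * \<psi> j x) (\<lambda>x. \<Sum>j<d. c j *\<^sub>R \<xi> j x)"
    proof (rule form_nonneg)
      show "c1c (\<lambda>x. \<Sum>j<d. c j * \<psi> j x) (\<lambda>x. \<Sum>j<d. c j *\<^sub>R \<xi> j x)"
        by (rule c1c_sum) (simp_all only: \<psi>(1) lessThan_iff finite_lessThan)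
      fix x assume x: "x \<in> unit_disc" "lin_sol x = 0"
      have "x \<noteq> 0" using x(2) u0 scal_pos gradient_zero[OF sol rad] by (auto simp: lin_sol_def)
      then have "norm x \<in> lin_zeros" using x lin_sol_radial[OF x(1)] by (auto simp: lin_zeros_def)
      from c(2)[OF this] have "(\<Sum>j<d. c j * \<psi> j (norm x *\<^sub>R axis 1 1)) = 0" .
      moreover have "\<psi> j (norm x *\<^sub>R axis 1 1) = \<psi> j x" if "j < d" for j by (rule \<psi>(2)[OF that]) simp
      ultimately show "(\<Sum>j<d. c j * \<psi> j x) = 0" by simp
    qed
    moreover have "\<exists>j<d. c j \<noteq> 0" using c(1) by auto
    ultimately show False using \<psi>(3)[of c] by simp
  qed
  then show "enat (real_fun.dim V) \<le> enat n" by (simp add: d_def)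
qed

end

section \<open>Uniqueness of radial solutions with a given number of nodal sets\<close>

lemma emden_mono: "emden p a R U U1 \<Longrightarrow> S \<le> R \<Longrightarrow> emden p a S U U1"
  unfolding emden_def by (auto intro: continuous_on_subset)

lemma emden_zero: "emden p a R (\<lambda>_. 0) (\<lambda>_. 0)"
  by (simp add: emden_def pw_def)

text \<open>Otherwise the solution has the same initial data as the zero solution.\<close>
lemma origin_nonzero:
  assumes p: "1 < p" and a: "0 \<le> a" and sol: "henon_solution p a u" and rad: "radial u"
    and n: "1 \<le> num_nodal_sets u"
  shows "u 0 \<noteq> 0"
proof
  assume "u 0 = 0"
  then have P0: "profile u 0 = 0" by (simp add: profile_def)
  have "profile u s = 0" if "0 < s" "s < 1" for s
    by (rule emden_unique[OF p a order_refl profile_emden[OF sol rad] emden_zero P0 that])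
  then have "profile u s = 0" if "0 \<le> s" "s < 1" for s using that P0 by (cases "s = 0") auto
  then have "{x\<in>unit_disc. u x \<noteq> 0} = {}" using radial_profile[OF sol rad] by auto
  then have "num_nodal_sets u = 0" unfolding num_nodal_sets_def by (simp only: components_empty card.empty)
  then show False using n by simp
qed

text \<open>The chain rule; the substitution \<open>s = m r^k\<close> multiplies \<open>r d/dr\<close> by \<open>k\<close>, which is why the
  exponents are related by \<open>b + 2 = k (a + 2)\<close>, and the factor \<open>K\<close> balances the constants.\<close>
lemma emden_transform:
  assumes p: "1 < p" and a: "0 \<le> a" and k: "1 \<le> k" and m: "0 < m" and R: "0 < R" "R \<le> 1" "m * R powr k \<le> 1"
    and U: "emden p a 1 U U1" and K: "\<bar>K\<bar> powr (p - 1) = k\<^sup>2 * m powr (2 + a)" and b: "b + 2 = k * (a + 2)"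
  shows "emden p b R (\<lambda>r. K * U (m * r powr k)) (\<lambda>r. K * m * k * r powr (k - 1) * U1 (m * r powr k))"
  unfolding emden_def
proof (intro conjI allI impI)
  let ?s = "\<lambda>r. m * r powr k"
  let ?Y = "\<lambda>r. K * U (?s r)" and ?Y1 = "\<lambda>r. K * m * k * r powr (k - 1) * U1 (?s r)"
  have s1: "0 \<le> ?s r \<and> ?s r < 1" if "0 \<le> r" "r < R" for r
  proof -
    have "r powr k < R powr k" using that k by (intro powr_less_mono2) auto
    then have "m * r powr k < m * R powr k" using m by simp
    then have "m * r powr k < 1" using R(3) by linarith
    then show ?thesis using m by simp
  qed
  fix r assume r: "0 < r \<and> r < R"
  have s: "0 < ?s r" "?s r < 1" using r m s1[of r] by auto
  have ds: "(?s has_real_derivative m * (k * r powr (k - 1))) (at r)"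
    using r by (auto intro!: derivative_eq_intros)
  have dU: "(U has_real_derivative U1 (?s r)) (at (?s r))"
    "(U1 has_real_derivative (- U1 (?s r) / ?s r - ?s r powr a * pw p (U (?s r)))) (at (?s r))"
    using U s by (auto simp: emden_def)
  show "(?Y has_real_derivative ?Y1 r) (at r)"
    using DERIV_cmult[OF DERIV_chain2[OF dU(1) ds], of K] by (simp add: mult_ac)
  have dp: "((\<lambda>r. r powr (k - 1)) has_real_derivative (k - 1) * r powr (k - 2)) (at r)"
    using r has_real_derivative_powr[of r "k - 1"] by simp
  have "(?Y1 has_real_derivative
      K * m * k * ((k - 1) * r powr (k - 2) * U1 (?s r)
       + (- U1 (?s r) / ?s r - ?s r powr a * pw p (U (?s r))) * (m * (k * r powr (k - 1))) * r powr (k - 1))) (at r)"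
    using DERIV_cmult[OF DERIV_mult[OF dp DERIV_chain2[OF dU(2) ds]], of "K * m * k"] by (simp add: mult_ac)
  moreover have "K * m * k * ((k - 1) * r powr (k - 2) * U1 (?s r)
       + (- U1 (?s r) / ?s r - ?s r powr a * pw p (U (?s r))) * (m * (k * r powr (k - 1))) * r powr (k - 1))
     = - ?Y1 r / r - r powr b * pw p (?Y r)"
  proof -
    let ?V = "U1 (?s r)" and ?q = "pw p (U (?s r))"
    have e1: "r powr (k - 1) = r powr (k - 2) * r" using r powr_add[of r "k - 2" 1] by simp
    have e2: "r powr k = r powr (k - 2) * r\<^sup>2" using r powr_add[of r "k - 2" 2] by (simp add: powr_numeral)
    have pos: "0 < r powr (k - 2)" using r by simp
    have A: "?V / ?s r * (m * (k * r powr (k - 1))) * r powr (k - 1) = k * r powr (k - 2) * ?V"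
      unfolding e1 e2 using m r pos by (simp add: field_simps power2_eq_square)
    have "?s r powr a * (r powr (k - 1) * r powr (k - 1)) = m powr a * (r powr (k * a) * r powr (2 * k - 2))"
      using m r by (simp add: powr_mult powr_powr powr_add[symmetric])
    also have "r powr (k * a) * r powr (2 * k - 2) = r powr b"
    proof -
      have "k * a + (2 * k - 2) = b" using b by (simp add: algebra_simps)
      then show ?thesis by (simp add: powr_add[symmetric])
    qed
    finally have B: "?s r powr a * (r powr (k - 1) * r powr (k - 1)) = m powr a * r powr b" .
    have C: "pw p (?Y r) = K * (k\<^sup>2 * m powr (2 + a)) * ?q"
      unfolding K[symmetric] by (simp add: pw_def abs_mult powr_mult)
    have D: "m powr (2 + a) = m * m * m powr a" using m by (simp add: powr_add powr_numeral power2_eq_square)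
    have alg: "K * m * k * ((k - 1) * P * V + (- Y - S * Q) * (m * (k * T)) * T)
        = K * m * k * ((k - 1) * P * V - Y * (m * (k * T)) * T - m * k * (S * (T * T)) * Q)" for P V Y S Q T :: real
      by (simp add: algebra_simps)
    have "K * m * k * ((k - 1) * r powr (k - 2) * ?V + (- ?V / ?s r - ?s r powr a * ?q) * (m * (k * r powr (k - 1))) * r powr (k - 1))
       = K * m * k * ((k - 1) * r powr (k - 2) * ?V - ?V / ?s r * (m * (k * r powr (k - 1))) * r powr (k - 1)
          - m * k * (?s r powr a * (r powr (k - 1) * r powr (k - 1))) * ?q)"
      using alg[of "r powr (k - 2)" ?V "?V / ?s r" "?s r powr a" ?q "r powr (k - 1)"] by (simp only: minus_divide_left)
    also have "\<dots> = K * m * k * (- (r powr (k - 2) * ?V) - m * k * (m powr a * r powr b) * ?q)"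
      unfolding A B by (simp add: algebra_simps)
    also have "\<dots> = - ?Y1 r / r - r powr b * pw p (?Y r)"
      unfolding C D e1 using r by (simp add: field_simps power2_eq_square)
    finally show ?thesis .
  qed
  ultimately show "(?Y1 has_real_derivative (- ?Y1 r / r - r powr b * pw p (?Y r))) (at r)" by (rule DERIV_cong)
next
  have s1: "0 \<le> m * r powr k \<and> m * r powr k < 1" if "0 \<le> r" "r < R" for r
  proof -
    have "r powr k < R powr k" using that k by (intro powr_less_mono2) auto
    then have "m * r powr k < m * R powr k" using m by simp
    then have "m * r powr k < 1" using R(3) by linarith
    then show ?thesis using m by simp
  qed
  have sc: "continuous_on {0..<R} (\<lambda>r. m * r powr k)"
    by (intro continuous_on_mult continuous_on_const cont_powr continuous_on_id) (use k in auto)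
  have "continuous_on {0..<1} U" using U by (simp add: emden_def)
  then have "continuous_on {0..<R} (\<lambda>r. U (m * r powr k))"
    by (rule continuous_on_compose2[OF _ sc]) (use s1 in auto)
  then show "continuous_on {0..<R} (\<lambda>r. K * U (m * r powr k))" by (intro continuous_on_mult continuous_on_const)
next
  have U1: "(U1 \<longlongrightarrow> 0) (at_right 0)" using U by (simp add: emden_def)
  have "((\<lambda>r. m * r powr k) \<longlongrightarrow> m * 0 powr k) (at_right 0)"
    by (rule tendsto_mult[OF tendsto_const tendsto_powr2[OF tendsto_ident_at tendsto_const]])
      (use k in \<open>auto simp: eventually_at_right_less eventually_at_filter\<close>)
  then have "filterlim (\<lambda>r. m * r powr k) (at_right 0) (at_right 0)"
    unfolding filterlim_at using m by (auto simp: eventually_at_filter)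
  from filterlim_compose[OF U1 this] have "((\<lambda>r. U1 (m * r powr k)) \<longlongrightarrow> 0) (at_right 0)" .
  then have "((\<lambda>r. \<bar>K * m * k\<bar> * \<bar>U1 (m * r powr k)\<bar>) \<longlongrightarrow> \<bar>K * m * k\<bar> * \<bar>0\<bar>) (at_right 0)"
    by (intro tendsto_intros)
  then have lim: "((\<lambda>r. \<bar>K * m * k\<bar> * \<bar>U1 (m * r powr k)\<bar>) \<longlongrightarrow> 0) (at_right 0)" by simp
  show "((\<lambda>r. K * m * k * r powr (k - 1) * U1 (m * r powr k)) \<longlongrightarrow> 0) (at_right 0)"
  proof (rule Lim_null_comparison[OF _ lim])
    have "norm (K * m * k * r powr (k - 1) * U1 (m * r powr k)) \<le> \<bar>K * m * k\<bar> * \<bar>U1 (m * r powr k)\<bar>" if "0 < r" "r < 1" for r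
    proof -
      have "r powr (k - 1) \<le> 1" using that k powr_mono2[of "k - 1" r 1] by simp
      then have "\<bar>K * m * k\<bar> * r powr (k - 1) * \<bar>U1 (m * r powr k)\<bar> \<le> \<bar>K * m * k\<bar> * 1 * \<bar>U1 (m * r powr k)\<bar>"
        by (intro mult_right_mono mult_left_mono) auto
      then show ?thesis by (simp add: abs_mult)
    qed
    then show "eventually (\<lambda>r. norm (K * m * k * r powr (k - 1) * U1 (m * r powr k)) \<le> \<bar>K * m * k\<bar> * \<bar>U1 (m * r powr k)\<bar>) (at_right 0)"
      unfolding eventually_at_right_field by (intro exI[of _ 1]) auto
  qed
qed

text \<open>The radial map that sends the circle of radius \<open>r\<close> to the circle of radius \<open>c r^k\<close> and keeps
  directions.\<close>
definition radmap :: "real \<Rightarrow> real \<Rightarrow> real^2 \<Rightarrow> real^2" where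
  "radmap c k x = (c * norm x powr k) *\<^sub>R sgn x"

lemma norm_radmap: "0 \<le> c \<Longrightarrow> norm (radmap c k x) = c * norm x powr k"
  by (cases "x = 0") (auto simp: radmap_def norm_sgn)

lemma sgn_radmap: "0 < c \<Longrightarrow> sgn (radmap c k x) = sgn x"
proof (cases "x = 0")
  case False
  assume "0 < c"
  then have "0 < c * norm x powr k" using False by simp
  then show ?thesis using False unfolding radmap_def by (simp only: sgn_scaleR sgn_pos) (simp add: sgn_div_norm)
qed (simp add: radmap_def)

lemma norm_scaleR_sgn: "norm x *\<^sub>R sgn x = (x :: real^2)"
  by (cases "x = 0") (simp_all add: sgn_div_norm)

lemma radmap_cont: "0 < k \<Longrightarrow> continuous_on S (radmap c k)"
proof -
  assume k: "0 < k"
  have "continuous (at x) (radmap c k)" for x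
  proof (cases "x = 0")
    case True
    have "((\<lambda>h::real^2. \<bar>c\<bar> * norm h powr k) \<longlongrightarrow> \<bar>c\<bar> * norm (0::real^2) powr k) (at 0)"
      by (rule tendsto_mult[OF tendsto_const tendsto_powr2[OF tendsto_norm[OF tendsto_ident_at] tendsto_const]]) (use k in auto)
    then have n0: "((\<lambda>h::real^2. \<bar>c\<bar> * norm h powr k) \<longlongrightarrow> 0) (at 0)" by simp
    have "(radmap c k \<longlongrightarrow> 0) (at 0)"
      by (rule Lim_null_comparison[OF _ n0]) (auto simp: radmap_def norm_sgn abs_mult)
    then show ?thesis using True by (simp add: continuous_at radmap_def)
  next
    case False
    then show ?thesis unfolding radmap_def sgn_div_norm by (intro continuous_intros) auto
  qed
  then show ?thesis by (intro continuous_at_imp_continuous_on) auto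
qed

lemma radmap_inverse:
  assumes "0 < c" "0 < k"
  shows "radmap ((1 / c) powr (1 / k)) (1 / k) (radmap c k x) = x" (is ?A)
    and "radmap c k (radmap ((1 / c) powr (1 / k)) (1 / k) x) = x" (is ?B)
proof -
  show ?A
  proof -
    have "(1 / c) powr (1 / k) * (c * norm x powr k) powr (1 / k) = norm x"
      using assms by (simp add: powr_mult powr_powr powr_divide)
    then show ?thesis using assms
      by (simp add: radmap_def[of _ "1 / k"] norm_radmap sgn_radmap norm_scaleR_sgn)
  qed
  show ?B
  proof -
    have "c * ((1 / c) powr (1 / k) * norm x powr (1 / k)) powr k = norm x"
      using assms by (simp add: powr_mult powr_powr)
    then show ?thesis using assms
      by (simp add: radmap_def[of c] norm_radmap sgn_radmap norm_scaleR_sgn)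
  qed
qed

lemma radmap_nth: "radmap 1 k x $ i = henon_weight (k - 1) x * x $ i"
proof (cases "x = 0")
  case False
  then have "norm x powr k = norm x powr (k - 1) * norm x" using powr_add[of "norm x" "k - 1" 1] by simp
  then show ?thesis using False by (simp add: radmap_def sgn_div_norm henon_weight_def)
qed (simp add: radmap_def)

text \<open>If \<open>u\<close> is a rescaled restriction of \<open>v\<close> to the disc of radius \<open>m < 1\<close>, then \<open>v\<close> vanishes
  on the circle of radius \<open>m\<close>. Therefore the nodal sets of \<open>u\<close> correspond to different nodal
  sets of \<open>v\<close> inside that disc. There is a further one outside, because \<open>v\<close> cannot vanish
  identically on an annulus.\<close>
lemma nodal_sets_less:
  assumes p: "1 < p" and a: "0 \<le> a" and b: "0 \<le> b"
    and u: "henon_solution p b u" "radial u" and v: "henon_solution p a v" "radial v" and v0: "v 0 \<noteq> 0"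
    and m: "0 < m" "m < 1" and k: "0 < k" and K: "K \<noteq> 0"
    and uv: "\<And>r. 0 \<le> r \<Longrightarrow> r < 1 \<Longrightarrow> profile u r = K * profile v (m * r powr k)"
    and n: "num_nodal_sets u = n" "num_nodal_sets v = n" "1 \<le> n"
  shows False
proof -
  let ?N = "\<lambda>u. {x\<in>unit_disc. u x \<noteq> 0}"
  let ?P = "radmap m k" and ?P' = "radmap ((1 / m) powr (1 / k)) (1 / k)"
  have cN: "card (components (?N u)) = n" "card (components (?N v)) = n" using n by (simp_all add: num_nodal_sets_def)
  have fN: "finite (components (?N v))" using cN(2) n(3) card_ge_0_finite by force
  have lt: "m * r powr k < m" if "0 \<le> r" "r < 1" for r
    using that m k powr_less_mono2[of k r 1] by simp
  have uPv: "u x = K * v (?P x)" if "x \<in> unit_disc" for x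
  proof -
    have "norm x < 1" using that by simp
    then have "m * norm x powr k < m" by (intro lt) auto
    then have "m * norm x powr k < 1" using m by linarith
    then have "norm (?P x) < 1" using m by (simp add: norm_radmap)
    then have "v (?P x) = profile v (norm (?P x))" using radial_profile[OF v] by simp
    then show ?thesis using radial_profile[OF u that] uv[of "norm x"] that m by (simp add: norm_radmap)
  qed
  have vm: "profile v m = 0"
  proof -
    have "((\<lambda>r. profile u r) \<longlongrightarrow> profile u 1) (at 1 within {0..1})"
      using profile_cont[OF u] by (auto simp: continuous_on_def)
    moreover have "profile u 1 = 0" using solution_regularity(7)[OF u(1), of "axis 1 1"] by (simp add: profile_def)
    ultimately have "(profile u \<longlongrightarrow> 0) (at 1 within {0..1})" by simp
    then have 1: "(profile u \<longlongrightarrow> 0) (at 1 within {0..<1})" by (rule tendsto_within_subset) auto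
    have "continuous_on {0..1} (\<lambda>r. K * profile v (m * r powr k))"
    proof (intro continuous_on_mult continuous_on_const continuous_on_compose2[OF profile_cont[OF v]] cont_powr continuous_on_id)
      show "(\<lambda>r. m * r powr k) ` {0..1} \<subseteq> {0..1}"
      proof
        fix y assume "y \<in> (\<lambda>r. m * r powr k) ` {0..1}"
        then obtain r where r: "0 \<le> r" "r \<le> 1" "y = m * r powr k" by auto
        have "r powr k \<le> 1" using r k powr_mono2[of k r 1] by simp
        then have "m * r powr k \<le> 1 * 1" using m by (intro mult_mono) auto
        then show "y \<in> {0..1}" using r m by simp
      qed
    qed (use k in auto)
    then have "((\<lambda>r. K * profile v (m * r powr k)) \<longlongrightarrow> K * profile v (m * 1 powr k)) (at 1 within {0..1})"
      unfolding continuous_on_def by (rule bspec) simp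
    then have "((\<lambda>r. K * profile v (m * r powr k)) \<longlongrightarrow> K * profile v m) (at 1 within {0..1})" by simp
    then have "((\<lambda>r. K * profile v (m * r powr k)) \<longlongrightarrow> K * profile v m) (at 1 within {0..<1})"
      by (rule tendsto_within_subset) auto
    moreover have "eventually (\<lambda>r. K * profile v (m * r powr k) = profile u r) (at 1 within {0..<1})"
      using uv by (auto simp: eventually_at_filter)
    ultimately have 2: "(profile u \<longlongrightarrow> K * profile v m) (at 1 within {0..<1})" by (rule Lim_transform_eventually)
    have "at (1::real) within {0..<1} \<noteq> bot"
      unfolding at_within_eq_bot_iff by (simp add: Diff_triv)
    from tendsto_unique[OF this 1 2] K show ?thesis by simp
  qed
  have small: "D \<subseteq> ball 0 m" if D: "D \<in> components (?N v)" "x \<in> D" "norm x < m" for D x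
  proof
    fix y assume y: "y \<in> D"
    have con: "connected (norm ` D)" by (intro connected_continuous_image continuous_intros in_components_connected[OF D(1)])
    show "y \<in> ball 0 m"
    proof (rule ccontr)
      assume "y \<notin> ball 0 m"
      then have "m \<le> norm y" by simp
      then have "m \<in> norm ` D"
        using con D(2,3) y by (auto simp: is_interval_connected_1[symmetric] is_interval_1 less_imp_le)
      then obtain z where "z \<in> D" "norm z = m" by auto
      moreover have "D \<subseteq> ?N v" by (rule in_components_subset[OF D(1)])
      ultimately show False using radial_profile[OF v, of z] vm by auto
    qed
  qed
  have PN: "?P x \<in> ?N v" "norm (?P x) < m" if "x \<in> ?N u" for x
  proof -
    have x: "norm x < 1" "u x \<noteq> 0" using that by auto
    show "norm (?P x) < m" using lt[of "norm x"] x m by (simp add: norm_radmap)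
    then show "?P x \<in> ?N v" using uPv[of x] x m by auto
  qed
  have P'N: "?P' y \<in> ?N u" if "y \<in> ?N v" "norm y < m" for y
  proof -
    have "norm (?P' y) = (norm y / m) powr (1 / k)" using m by (simp add: norm_radmap powr_divide)
    also have "\<dots> < 1 powr (1 / k)" using that m k by (intro powr_less_mono2) auto
    finally have "?P' y \<in> unit_disc" by simp
    with uPv[OF this] that K show ?thesis by (simp add: radmap_inverse[OF m(1) k])
  qed
  have "\<forall>C\<in>components (?N u). \<exists>D. D \<in> components (?N v) \<and> ?P ` C \<subseteq> D"
  proof
    fix C assume C: "C \<in> components (?N u)"
    have "?P ` C \<subseteq> ?N v" using PN(1) in_components_subset[OF C] by blast
    moreover have "connected (?P ` C)" by (intro connected_continuous_image radmap_cont k in_components_connected[OF C])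
    ultimately show "\<exists>D. D \<in> components (?N v) \<and> ?P ` C \<subseteq> D"
      using exists_component_superset[of "?P ` C" "?N v"] PN(1) in_components_subset[OF C] in_components_nonempty[OF C] by blast
  qed
  from bchoice[OF this] obtain T where T: "\<And>C. C \<in> components (?N u) \<Longrightarrow> T C \<in> components (?N v) \<and> ?P ` C \<subseteq> T C" by blast
  have Tsmall: "T C \<subseteq> ball 0 m" if C: "C \<in> components (?N u)" for C
  proof -
    obtain x where x: "x \<in> C" using in_components_nonempty[OF C] by blast
    then have "?P x \<in> T C" "x \<in> ?N u" using T[OF C] in_components_subset[OF C] by auto
    then show ?thesis using small[of "T C" "?P x"] T[OF C] PN(2) by blast
  qed
  have inj: "inj_on T (components (?N u))"
  proof (rule inj_onI)
    fix C1 C2 assume C: "C1 \<in> components (?N u)" "C2 \<in> components (?N u)" "T C1 = T C2"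
    let ?E = "?P' ` T C1"
    have sub: "T C1 \<subseteq> ?N v" using T[OF C(1)] in_components_subset by blast
    have "connected ?E" using T[OF C(1)] k by (intro connected_continuous_image radmap_cont in_components_connected) auto
    moreover have "?E \<subseteq> ?N u" using P'N sub Tsmall[OF C(1)] by force
    moreover have "C' \<inter> ?E \<noteq> {}" if C': "C' \<in> components (?N u)" "T C' = T C1" for C'
    proof -
      obtain x where x: "x \<in> C'" using in_components_nonempty[OF C'(1)] by blast
      then have "?P x \<in> T C1" using T[OF C'(1)] C'(2) by auto
      then have "?P' (?P x) \<in> ?E" by blast
      then have "x \<in> ?E" by (simp add: radmap_inverse[OF m(1) k])
      then show ?thesis using x by blast
    qed
    ultimately have "?E \<subseteq> C1" "?E \<subseteq> C2"
      using components_maximal[OF C(1), of ?E] components_maximal[OF C(2), of ?E] C by auto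
    moreover have "?E \<noteq> {}" using T[OF C(1)] in_components_nonempty by blast
    ultimately have "C1 \<inter> C2 \<noteq> {}" by blast
    then show "C1 = C2" using components_nonoverlap[OF C(1,2)] by blast
  qed
  obtain s where s: "m < s" "s < 1" "profile v s \<noteq> 0"
  proof (rule ccontr)
    assume "\<not> thesis"
    then have z: "profile v s = 0" if "m < s" "s < 1" for s using that \<open>\<And>s. m < s \<Longrightarrow> s < 1 \<Longrightarrow> profile v s \<noteq> 0 \<Longrightarrow> thesis\<close> by blast
    define s where "s = (m + 1) / 2"
    have s: "m < s" "s < 1" "0 < s" using m by (auto simp: s_def)
    have "((\<lambda>_. 0) has_real_derivative profile' v s) (at s)"
      by (rule has_field_derivative_transform_within_open[OF profile_deriv[OF v, of s], of "{m<..<1}"]) (use s z in auto)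
    then have "profile' v s = 0" using DERIV_unique DERIV_const by blast
    then have "profile v 0 = 0"
      using emden_backward[OF p a order_refl profile_emden[OF v] s(3,2) z[OF s(1,2)]] by blast
    then show False using v0 by (simp add: profile_def)
  qed
  let ?y = "s *\<^sub>R axis 1 1 :: real^2"
  let ?D = "connected_component_set (?N v) ?y"
  have y: "?y \<in> ?N v" using s m by (simp add: profile_def)
  then have D: "?D \<in> components (?N v)" "?y \<in> ?D" by (auto simp: components_def connected_component_refl_eq)
  have "?D \<notin> T ` components (?N u)"
  proof
    assume "?D \<in> T ` components (?N u)"
    then have "?D \<subseteq> ball 0 m" using Tsmall by auto
    then have "?y \<in> ball 0 m" using D(2) by blast
    then show False using s m by simp
  qed
  then have "T ` components (?N u) \<subset> components (?N v)" using T D(1) by blast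
  from psubset_card_mono[OF fN this] show False using card_image[OF inj] cN by simp
qed

text \<open>The constant \<open>K\<close> is determined by the values at the origin, and then the scaling factor \<open>m\<close>
  by the equation. Both cases \<open>m < 1\<close> and \<open>m > 1\<close> contradict the equality of the numbers of
  nodal sets; in the second case the roles of the two solutions are exchanged.\<close>
lemma radial_solutions_related:
  assumes p: "1 < p" and a: "0 \<le> a" and ab: "a \<le> b"
    and u: "henon_solution p a u" "radial u" "num_nodal_sets u = n"
    and v: "henon_solution p b v" "radial v" "num_nodal_sets v = n" and n: "1 \<le> n"
    and k: "k = (b + 2) / (a + 2)"
  obtains K where "\<bar>K\<bar> powr (p - 1) = k\<^sup>2" "\<And>x. x \<in> unit_disc \<Longrightarrow> v x = K * u (radmap 1 k x)"
proof -
  have b: "0 \<le> b" using a ab by simp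
  have k1: "1 \<le> k" and bk: "b + 2 = k * (a + 2)" using a ab by (auto simp: k field_simps)
  have u0: "u 0 \<noteq> 0" by (rule origin_nonzero[OF p a u(1,2)]) (use u n in simp)
  have v0: "v 0 \<noteq> 0" by (rule origin_nonzero[OF p b v(1,2)]) (use v n in simp)
  define K where "K = v 0 / u 0"
  have K0: "K \<noteq> 0" using u0 v0 by (simp add: K_def)
  define q where "q = \<bar>K\<bar> powr (p - 1) / k\<^sup>2"
  have q: "0 < q" using K0 k1 by (simp add: q_def)
  define m where "m = q powr (1 / (2 + a))"
  have m: "0 < m" using q by (simp add: m_def)
  have Km: "\<bar>K\<bar> powr (p - 1) = k\<^sup>2 * m powr (2 + a)"
    using q a k1 by (simp add: m_def powr_powr q_def)
  have eq: "profile v r = K * profile u (m * r powr k)"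
    if R: "0 < R" "R \<le> 1" "m * R powr k \<le> 1" and r: "0 \<le> r" "r < R" for R r
  proof (cases "r = 0")
    case True
    then show ?thesis using u0 k1 by (simp add: profile_def K_def)
  next
    case False
    have E: "emden p b R (\<lambda>r. K * profile u (m * r powr k)) (\<lambda>r. K * m * k * r powr (k - 1) * profile' u (m * r powr k))"
      by (rule emden_transform[OF p a k1 m R profile_emden[OF u(1,2)] Km bk])
    have E': "emden p b R (profile v) (profile' v)" by (rule emden_mono[OF profile_emden[OF v(1,2)] R(2)])
    show ?thesis
      by (rule emden_unique[OF p b R(2) E' E]) (use False r u0 k1 in \<open>auto simp: profile_def K_def\<close>)
  qed
  have "m = 1"
  proof (rule ccontr)
    assume "m \<noteq> 1"
    then consider "m < 1" | "1 < m" by linarith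
    then show False
    proof cases
      case 1
      have h: "profile v r = K * profile u (m * r powr k)" if "0 \<le> r" "r < 1" for r
        by (rule eq[of 1]) (use 1 that in auto)
      show False
        by (rule nodal_sets_less[OF p a b v(1,2) u(1,2) u0 m 1 _ K0 h v(3) u(3) n]) (use k1 in auto)
    next
      case 2
      \<comment> \<open>The radius of the disc that the map sends onto the unit disc.\<close>
      define R where "R = (1 / m) powr (1 / k)"
      have R: "0 < R" "R < 1" "m * R powr k \<le> 1"
      proof -
        show "0 < R" using 2 by (simp add: R_def)
        have "(1 / m) powr (1 / k) < 1 powr (1 / k)" using 2 k1 by (intro powr_less_mono2) auto
        then show "R < 1" by (simp add: R_def)
        show "m * R powr k \<le> 1" using 2 k1 by (simp add: R_def powr_powr)
      qed
      have h: "profile u r = (1 / K) * profile v (R * r powr (1 / k))" if r: "0 \<le> r" "r < 1" for r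
      proof -
        have "r powr (1 / k) < 1 powr (1 / k)" using r k1 by (intro powr_less_mono2) auto
        then have "R * r powr (1 / k) < R" using R by simp
        then have "profile v (R * r powr (1 / k)) = K * profile u (m * (R * r powr (1 / k)) powr k)"
          using R by (intro eq[of R]) auto
        also have "m * (R * r powr (1 / k)) powr k = r"
          using 2 k1 r by (simp add: R_def powr_mult powr_powr)
        finally show ?thesis using K0 by simp
      qed
      show False
        by (rule nodal_sets_less[OF p b a u(1,2) v(1,2) v0 R(1,2) _ _ h u(3) v(3) n]) (use k1 K0 in auto)
    qed
  qed
  show ?thesis
  proof (rule that)
    show "\<bar>K\<bar> powr (p - 1) = k\<^sup>2" using Km \<open>m = 1\<close> by simp
    fix x assume x: "x \<in> unit_disc"
    have "norm x powr k < 1 powr k" if "norm x < 1" using that k1 by (intro powr_less_mono2) auto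
    then have "radmap 1 k x \<in> unit_disc" using x by (simp add: norm_radmap)
    then show "v x = K * u (radmap 1 k x)"
      using eq[of 1 "norm x"] x \<open>m = 1\<close> radial_profile[OF v(1,2) x] radial_profile[OF u(1,2), of "radmap 1 k x"]
      by (simp add: norm_radmap)
  qed
qed

section \<open>Comparison of the Morse indices\<close>

text \<open>The gradient of \<open>f \<circ> radmap 1 k\<close> if \<open>g\<close> is the gradient of \<open>f\<close>.\<close>
definition pull :: "real \<Rightarrow> (real^2 \<Rightarrow> real^2) \<Rightarrow> real^2 \<Rightarrow> real^2" where
  "pull k g x = g (radmap 1 k x) $ 1 *\<^sub>R wid_grad (k - 1) 1 x + g (radmap 1 k x) $ 2 *\<^sub>R wid_grad (k - 1) 2 x"

definition radmap_deriv :: "real \<Rightarrow> real^2 \<Rightarrow> real^2 \<Rightarrow> real^2" where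
  "radmap_deriv k x h = (wid_grad (k - 1) 1 x \<bullet> h) *\<^sub>R axis 1 1 + (wid_grad (k - 1) 2 x \<bullet> h) *\<^sub>R axis 2 1"

lemma radmap_has_derivative:
  assumes "1 \<le> k"
  shows "(radmap 1 k has_derivative radmap_deriv k x) (at x)"
proof -
  have "radmap 1 k = (\<lambda>y. (henon_weight (k - 1) y * y $ 1) *\<^sub>R axis 1 1 + (henon_weight (k - 1) y * y $ 2) *\<^sub>R axis 2 1)"
    by (rule ext) (simp add: vec2_eq_iff radmap_nth axis_def)
  moreover have "((\<lambda>y. (henon_weight (k - 1) y * y $ 1) *\<^sub>R axis 1 1 + (henon_weight (k - 1) y * y $ 2) *\<^sub>R axis 2 1 :: real^2)
     has_derivative radmap_deriv k x) (at x)"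
    unfolding radmap_deriv_def using assms
    by (intro has_derivative_add has_derivative_scaleR_left wid_deriv) auto
  ultimately show ?thesis by simp
qed

lemma radmap_disc: "1 \<le> k \<Longrightarrow> x \<in> unit_disc \<Longrightarrow> radmap 1 k x \<in> unit_disc"
  using powr_less_mono2[of k "norm x" 1] by (simp add: norm_radmap)

lemma pull_c1c:
  assumes k: "1 \<le> k" and f: "c1c f g"
  shows "c1c (\<lambda>x. f (radmap 1 k x)) (pull k g)"
proof -
  have gc: "continuous_on UNIV g" and fd: "\<And>x. (f has_derivative (\<lambda>h. g x \<bullet> h)) (at x)" using f by (auto simp: c1c_def)
  obtain \<rho> where \<rho>: "0 < \<rho>" "\<rho> < 1" "\<And>x. \<rho> \<le> norm x \<Longrightarrow> f x = 0" using c1c_support[OF f] by metis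
  have rc: "continuous_on UNIV (radmap 1 k)" by (rule radmap_cont) (use k in simp)
  show ?thesis
  proof (rule c1cI)
    show "((\<lambda>x. f (radmap 1 k x)) has_derivative (\<lambda>h. pull k g x \<bullet> h)) (at x)" for x
      by (rule has_derivative_eq_rhs[OF has_derivative_compose[OF radmap_has_derivative[OF k] fd]])
        (simp add: fun_eq_iff pull_def radmap_deriv_def inner_add_left inner_add_right inner_axis mult.commute)
    have "continuous_on UNIV (\<lambda>x. g (radmap 1 k x))" by (rule continuous_on_compose2[OF gc rc]) auto
    then show "continuous_on UNIV (pull k g)" unfolding pull_def
      using k by (intro continuous_on_add continuous_on_scaleR continuous_on_component wid_grad_cont) auto
    have "\<rho> powr (1 / k) < 1 powr (1 / k)" using \<rho> k by (intro powr_less_mono2) auto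
    then show "\<rho> powr (1 / k) < 1" by simp
    show "f (radmap 1 k x) = 0" if "\<rho> powr (1 / k) \<le> norm x" for x
    proof (rule \<rho>(3))
      have "(\<rho> powr (1 / k)) powr k \<le> norm x powr k" using that k by (intro powr_mono2) auto
      then show "\<rho> \<le> norm (radmap 1 k x)" using \<rho> k by (simp add: powr_powr norm_radmap)
    qed
  qed
qed

context
  fixes k H b :: real and x :: "real^2"
  assumes k: "1 \<le> k" and x: "x \<noteq> 0"
  defines "H \<equiv> henon_weight (k - 1) x" and "b \<equiv> (k - 1) * norm x powr (k - 1 - 2)"
begin

lemma H_pos: "0 < H" unfolding H_def by (rule henon_weight_pos[OF x])

lemma b_nonneg: "0 \<le> b" using k by (simp add: b_def)

lemma b_norm: "b * (norm x)\<^sup>2 = (k - 1) * H"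
proof -
  have "norm x powr (k - 1) = norm x powr (k - 1 - 2) * (norm x)\<^sup>2"
    using x powr_add[of "norm x" "k - 1 - 2" 2] by (simp add: powr_numeral)
  then show ?thesis using x by (simp add: b_def H_def henon_weight_def)
qed

lemma wid_grad_eq: "wid_grad (k - 1) i x = H *\<^sub>R axis i 1 + (b * x $ i) *\<^sub>R x"
  by (simp add: wid_grad_def H_def b_def)

text \<open>The radial derivative is \<open>k\<close> times the tangential one, and the latter is \<open>H = |x|^(k-1)\<close>.\<close>
lemma det_radmap: "det (matrix (radmap_deriv k x)) = k * H\<^sup>2"
proof -
  have "det (matrix (radmap_deriv k x)) = (H + b * x $ 1 * x $ 1) * (H + b * x $ 2 * x $ 2) - (b * x $ 1 * x $ 2) * (b * x $ 2 * x $ 1)"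
    by (simp add: det_2 matrix_def radmap_deriv_def wid_grad_eq inner_add_left inner_axis inner_axis_axis)
      (simp add: axis_def)
  also have "\<dots> = H * H + H * (b * (norm x)\<^sup>2)"
    unfolding norm2_sq by (simp add: power2_eq_square algebra_simps)
  finally show ?thesis unfolding b_norm by (simp add: power2_eq_square algebra_simps)
qed

text \<open>The radial part of the gradient is multiplied by \<open>k H\<close> and the tangential part by \<open>H\<close>; the
  bound uses \<open>k H\<close> for both. This is where \<open>k \<ge> 1\<close> enters the comparison of the Morse
  indices.\<close>
lemma norm_pull: "(norm (pull k g x))\<^sup>2 \<le> k * (k * H\<^sup>2) * (norm (g (radmap 1 k x)))\<^sup>2"
proof -
  let ?G = "g (radmap 1 k x)"
  have e: "pull k g x = H *\<^sub>R ?G + (b * (?G \<bullet> x)) *\<^sub>R x"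
    by (simp add: pull_def wid_grad_eq vec2_eq_iff inner2 axis_def algebra_simps)
  have CS: "(?G \<bullet> x)\<^sup>2 \<le> (norm ?G)\<^sup>2 * (norm x)\<^sup>2"
    using Cauchy_Schwarz_ineq[of ?G x] by (simp add: power2_norm_eq_inner)
  have "(norm (pull k g x))\<^sup>2 = H\<^sup>2 * (norm ?G)\<^sup>2 + (2 * H * b + b * (b * (norm x)\<^sup>2)) * (?G \<bullet> x)\<^sup>2"
    unfolding e power2_norm_eq_inner
    by (simp add: inner_add_left inner_add_right inner_commute power2_eq_square algebra_simps)
  also have "\<dots> = H\<^sup>2 * (norm ?G)\<^sup>2 + ((k + 1) * H * b) * (?G \<bullet> x)\<^sup>2"
    unfolding b_norm by (simp add: algebra_simps)
  also have "\<dots> \<le> H\<^sup>2 * (norm ?G)\<^sup>2 + ((k + 1) * H * b) * ((norm ?G)\<^sup>2 * (norm x)\<^sup>2)"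
    using CS H_pos b_nonneg k by (intro add_left_mono mult_left_mono) auto
  also have "\<dots> = H\<^sup>2 * (norm ?G)\<^sup>2 + (k + 1) * H * (norm ?G)\<^sup>2 * (b * (norm x)\<^sup>2)"
    by (simp add: algebra_simps)
  also have "\<dots> = k * (k * H\<^sup>2) * (norm ?G)\<^sup>2"
    unfolding b_norm by (simp add: power2_eq_square algebra_simps)
  finally show ?thesis .
qed

end

lemma radmap_punctured:
  assumes k: "1 \<le> k"
  shows "inj_on (radmap 1 k) S" "radmap 1 k ` (unit_disc - {0}) = unit_disc - {0}"
proof -
  have k0: "0 < k" using k by simp
  note inv = radmap_inverse[OF zero_less_one k0]
  show "inj_on (radmap 1 k) S" by (rule inj_on_inverseI) (rule inv(1))
  show "radmap 1 k ` (unit_disc - {0}) = unit_disc - {0}"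
  proof
    show "radmap 1 k ` (unit_disc - {0}) \<subseteq> unit_disc - {0}"
    proof
      fix y assume "y \<in> radmap 1 k ` (unit_disc - {0})"
      then obtain x where x': "x \<in> unit_disc - {0}" "y = radmap 1 k x" by blast
      then have x: "x \<in> unit_disc" "x \<noteq> 0" "y = radmap 1 k x" by simp_all
      have "norm y \<noteq> 0" using x by (simp add: norm_radmap)
      then show "y \<in> unit_disc - {0}" using radmap_disc[OF k x(1)] x(3) by auto
    qed
    show "unit_disc - {0} \<subseteq> radmap 1 k ` (unit_disc - {0})"
    proof
      fix y assume y: "y \<in> unit_disc - {0::real^2}"
      let ?x = "radmap ((1 / 1) powr (1 / k)) (1 / k) y"
      have "norm ?x = norm y powr (1 / k)" by (simp add: norm_radmap)
      moreover have "norm y powr (1 / k) < 1 powr (1 / k)" using y k by (intro powr_less_mono2) auto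
      moreover have "norm y powr (1 / k) \<noteq> 0" using y by simp
      ultimately have "?x \<in> unit_disc - {0}" by auto
      then show "y \<in> radmap 1 k ` (unit_disc - {0})" 
        by (intro image_eqI[of y "radmap 1 k" ?x, OF inv(2)[symmetric]])
    qed
  qed
qed

lemma lint_disc_punctured:
  assumes "integrable disc (F :: real^2 \<Rightarrow> real)"
  shows "F absolutely_integrable_on (unit_disc - {0})" "(LINT x|disc. F x) = integral (unit_disc - {0}) F"
proof -
  have "F absolutely_integrable_on unit_disc" using assms by (simp add: integrable_disc_iff)
  then show "F absolutely_integrable_on (unit_disc - {0})" by (rule set_integrable_subset) auto
  have "(LINT x|disc. F x) = integral unit_disc F" by (rule lebesgue_integral_eq_integral[OF assms]) simp
  also have "\<dots> = integral (unit_disc - {0}) F"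
    by (rule integral_spike_set; rule negligible_subset[of "{0}"]) auto
  finally show "(LINT x|disc. F x) = integral (unit_disc - {0}) F" .
qed

text \<open>Pointwise, the pulled-back integrand is at most \<open>k\<close> times the Jacobian times the original
  integrand, with equality in the potential term; then change variables. The origin is removed
  because the Jacobian and the weights degenerate there.\<close>
lemma pull_form_le:
  assumes p: "1 < p" and a: "0 \<le> a" and b: "0 \<le> b" and k: "1 \<le> k" and bk: "b + 2 = k * (a + 2)"
    and u: "henon_solution p a u" and v: "henon_solution p b v"
    and K: "\<bar>K\<bar> powr (p - 1) = k\<^sup>2" and vu: "\<And>x. x \<in> unit_disc \<Longrightarrow> v x = K * u (radmap 1 k x)"
    and f: "c1c f g"
  shows "qform p (potential p b v) (\<lambda>x. f (radmap 1 k x)) (pull k g) \<le> k * qform p (potential p a u) f g"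
proof -
  let ?S = "unit_disc - {0} :: (real^2) set"
  have pc: "c1c (\<lambda>x. f (radmap 1 k x)) (pull k g)" by (rule pull_c1c[OF k f])
  define I where "I x = (norm (g x))\<^sup>2 - p * (potential p a u x * (f x)\<^sup>2)" for x
  define J where "J x = (norm (pull k g x))\<^sup>2 - p * (potential p b v x * (f (radmap 1 k x))\<^sup>2)" for x
  have iI: "integrable disc I" "qform p (potential p a u) f g = (LINT x|disc. I x)"
    unfolding I_def using solution_form[OF p a u f] by auto
  have iJ: "integrable disc J" "qform p (potential p b v) (\<lambda>x. f (radmap 1 k x)) (pull k g) = (LINT x|disc. J x)"
    unfolding J_def using solution_form[OF p b v pc] by auto
  let ?d = "\<lambda>x. \<bar>det (matrix (radmap_deriv k x))\<bar>"
  have S: "?S \<in> sets lebesgue" by simp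
  have der: "(radmap 1 k has_derivative radmap_deriv k x) (at x within ?S)" for x
    by (rule has_derivative_at_withinI[OF radmap_has_derivative[OF k]])
  have Ia: "I absolutely_integrable_on (radmap 1 k ` ?S)"
    unfolding radmap_punctured(2)[OF k] by (rule lint_disc_punctured(1)[OF iI(1)])
  note cv = change_of_variables_real[OF S der radmap_punctured(1)[OF k] Ia, unfolded radmap_punctured(2)[OF k]]
  have pt: "J x \<le> k * (?d x * I (radmap 1 k x))" if x: "x \<in> ?S" for x
  proof -
    have x0: "x \<noteq> 0" "x \<in> unit_disc" using x by auto
    let ?H = "henon_weight (k - 1) x" and ?y = "radmap 1 k x"
    have d: "?d x = k * ?H\<^sup>2" using det_radmap[OF k x0(1)] k by simp
    have H: "?H = norm x powr (k - 1)" using henon_weight_axis x0(1) by (metis zero_less_norm_iff)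
    have ny: "norm ?y = norm x powr k" by (simp add: norm_radmap)
    then have wy: "henon_weight a ?y = norm x powr (k * a)"
      using henon_weight_axis[of ?y "norm x powr k" a] x0(1) by (simp add: powr_powr)
    have wx: "henon_weight b x = norm x powr b" using henon_weight_axis x0(1) by (metis zero_less_norm_iff)
    have "norm x powr (k - 1) * norm x powr (k - 1) * norm x powr (k * a) = norm x powr b"
    proof -
      have "(k - 1) + (k - 1) + k * a = b" using bk by (simp add: algebra_simps)
      then show ?thesis by (simp only: powr_add[symmetric])
    qed
    then have "potential p b v x = k * (k * ?H\<^sup>2) * potential p a u ?y"
      unfolding potential_def vu[OF x0(2)] wx wy H abs_mult powr_mult K power2_eq_square
      by (simp add: mult_ac)
    then have e: "p * (potential p b v x * (f ?y)\<^sup>2) = k * (k * ?H\<^sup>2) * (p * (potential p a u ?y * (f ?y)\<^sup>2))"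
      by simp
    have "k * (k * ?H\<^sup>2 * I ?y) = k * (k * ?H\<^sup>2) * (norm (g ?y))\<^sup>2 - k * (k * ?H\<^sup>2) * (p * (potential p a u ?y * (f ?y)\<^sup>2))"
      unfolding I_def by (simp add: algebra_simps)
    then show ?thesis using norm_pull[OF k x0(1), of g] e unfolding J_def d by linarith
  qed
  have "(LINT x|disc. J x) = integral ?S J" by (rule lint_disc_punctured(2)[OF iJ(1)])
  also have "\<dots> \<le> integral ?S (\<lambda>x. k * (?d x * I (radmap 1 k x)))"
  proof (rule integral_le[OF _ _ pt])
    show "J integrable_on ?S" using lint_disc_punctured(1)[OF iJ(1)] set_lebesgue_integral_eq_integral(1) by blast
    have "(\<lambda>x. ?d x * I (radmap 1 k x)) integrable_on ?S" using cv(1) set_lebesgue_integral_eq_integral(1) by blast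
    from integrable_cmul[OF this, of k] show "(\<lambda>x. k * (?d x * I (radmap 1 k x))) integrable_on ?S" by simp
  qed
  also have "\<dots> = k * integral ?S (\<lambda>x. ?d x * I (radmap 1 k x))" by (rule integral_mult_right)
  also have "integral ?S (\<lambda>x. ?d x * I (radmap 1 k x)) = (LINT x|disc. I x)"
    unfolding cv(2) by (rule lint_disc_punctured(2)[OF iI(1), symmetric])
  finally show ?thesis by (simp add: iI(2) iJ(2))
qed

text \<open>The pull-back of the approximating test functions is negative definite for the second solution.\<close>
lemma morse_index_mono:
  assumes p: "1 < p" and a: "0 \<le> a" and b: "0 \<le> b" and k: "1 \<le> k" and bk: "b + 2 = k * (a + 2)"
    and u: "henon_solution p a u" and v: "henon_solution p b v"
    and K: "\<bar>K\<bar> powr (p - 1) = k\<^sup>2" and vu: "\<And>x. x \<in> unit_disc \<Longrightarrow> v x = K * u (radmap 1 k x)"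
  shows "morse_index p a u \<le> morse_index p b v"
  unfolding morse_index_def max_neg_dim_def[of "henon_form p a u"]
proof (rule SUP_least)
  fix V assume "V \<in> {V. neg_def_subspace (henon_form p a u) H10 V}"
  then have V: "neg_def_subspace (henon_form p a u) H10 V" by simp
  define d where "d = real_fun.dim V"
  show "enat (real_fun.dim V) \<le> max_neg_dim (henon_form p b v) H10"
  proof (cases "d = 0")
    case True
    then show ?thesis by (simp add: d_def zero_enat_def[symmetric])
  next
    case False
    then have d0: "0 < d" by simp
    have p0: "0 < p" using p by simp
    obtain M where W: "potential p a u \<in> borel_measurable disc"
        "\<And>x. x \<in> unit_disc \<Longrightarrow> 0 \<le> potential p a u x \<and> potential p a u x \<le> M"
      using potential_bounded[OF p a solution_regularity(5)[OF u]] by blast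
    obtain w \<eta> where "\<And>j. j < d \<Longrightarrow> w j \<in> V" and \<eta>: "0 < \<eta>" and
      ap: "\<And>\<epsilon>. 0 < \<epsilon> \<Longrightarrow> \<exists>\<phi>. (\<forall>j<d. test_function (\<phi> j) \<and> (LINT x|disc. (w j x - \<phi> j x)\<^sup>2) \<le> \<epsilon>) \<and>
       (\<forall>c. qform p (potential p a u) (\<lambda>x. \<Sum>j<d. c j * \<phi> j x) (\<lambda>x. \<Sum>j<d. c j *\<^sub>R gradient (\<phi> j) x)
          \<le> - \<eta> * (\<Sum>j<d. (c j)\<^sup>2))"
      by (rule approx_neg_def[OF V d_def[symmetric] d0 p0 W]) blast+
    obtain \<phi> where \<phi>: "\<And>j. j < d \<Longrightarrow> test_function (\<phi> j)"
      "\<And>c. qform p (potential p a u) (\<lambda>x. \<Sum>j<d. c j * \<phi> j x) (\<lambda>x. \<Sum>j<d. c j *\<^sub>R gradient (\<phi> j) x) \<le> - \<eta> * (\<Sum>j<d. (c j)\<^sup>2)"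
      using ap[OF zero_less_one] by blast
    have \<phi>c: "c1c (\<phi> j) (gradient (\<phi> j))" if "j < d" for j by (rule test_function_c1c[OF \<phi>(1)[OF that]])
    let ?f = "\<lambda>j x. \<phi> j (radmap 1 k x)" and ?g = "\<lambda>j. pull k (gradient (\<phi> j))"
    have fg: "c1c (?f j) (?g j)" if "j < d" for j by (rule pull_c1c[OF k \<phi>c[OF that]])
    have "enat d \<le> max_neg_dim (henon_form p b v) H10"
    proof (rule neg_def_lower[OF fg])
      fix c :: "nat \<Rightarrow> real"
      show "(\<lambda>x. \<Sum>j<d. c j * ?f j x) \<in> H10"
        by (rule c1c_H10[OF c1c_sum]) (use fg in auto)
      let ?F = "\<lambda>x. \<Sum>j<d. c j * \<phi> j x" and ?G = "\<lambda>x. \<Sum>j<d. c j *\<^sub>R gradient (\<phi> j) x"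
      have FG: "c1c ?F ?G" by (rule c1c_sum) (use \<phi>c in auto)
      have pg: "(\<lambda>x. \<Sum>j<d. c j *\<^sub>R ?g j x) = pull k ?G"
        by (rule ext) (simp add: pull_def scaleR_sum_left sum.distrib scaleR_add_right)
      assume "\<exists>j<d. c j \<noteq> 0"
      then obtain i where "i < d" "c i \<noteq> 0" by blast
      then have n: "0 < (\<Sum>j<d. (c j)\<^sup>2)" by (intro sum_pos2[of _ i]) auto
      have "qform p (potential p b v) (\<lambda>x. ?F (radmap 1 k x)) (pull k ?G) \<le> k * qform p (potential p a u) ?F ?G"
        by (rule pull_form_le[OF p a b k bk u v K vu FG])
      also have "\<dots> < 0"
      proof (rule mult_pos_neg)
        have "- \<eta> * (\<Sum>j<d. (c j)\<^sup>2) < 0" using \<eta> n by simp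
        with \<phi>(2)[of c] show "qform p (potential p a u) ?F ?G < 0" by (rule le_less_trans)
      qed (use k in simp)
      finally show "qform p (potential p b v) (\<lambda>x. \<Sum>j<d. c j * ?f j x) (\<lambda>x. \<Sum>j<d. c j *\<^sub>R ?g j x) < 0"
        unfolding pg .
    qed
    then show ?thesis by (simp add: d_def)
  qed
qed

lemma radial_morse_index_eq:
  assumes p: "1 < p" and a: "0 \<le> a" and u: "henon_solution p a u" "radial u" "num_nodal_sets u = n" and n: "1 \<le> n"
  shows "radial_morse_index p a u = enat n"
proof (rule antisym)
  have "u 0 \<noteq> 0" by (rule origin_nonzero[OF p a u(1,2)]) (use u(3) n in simp)
  then show "radial_morse_index p a u \<le> enat n" by (rule radial_morse_index_upper[OF p a u(1,2) _ u(3) n])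
  show "enat n \<le> radial_morse_index p a u" by (rule radial_morse_index_lower[OF p a u(1) u(2,3) n])
qed

theorem theorem1p2:
  fixes p \<alpha> \<beta> :: real and n :: nat and u\<^sub>\<alpha> u\<^sub>\<beta> :: "real^2 \<Rightarrow> real"
  assumes "p > 1" and "0 \<le> \<alpha>" and "\<alpha> \<le> \<beta>" and "n \<ge> 1"
    and "henon_solution p \<alpha> u\<^sub>\<alpha>" and "radial u\<^sub>\<alpha>" and "num_nodal_sets u\<^sub>\<alpha> = n"
    and "henon_solution p \<beta> u\<^sub>\<beta>" and "radial u\<^sub>\<beta>" and "num_nodal_sets u\<^sub>\<beta> = n"
  shows "morse_index p \<alpha> u\<^sub>\<alpha> \<le> morse_index p \<beta> u\<^sub>\<beta> \<and>
         radial_morse_index p \<alpha> u\<^sub>\<alpha> = radial_morse_index p \<beta> u\<^sub>\<beta> \<and>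
         radial_morse_index p \<beta> u\<^sub>\<beta> = enat n"
proof -
  have \<beta>: "0 \<le> \<beta>" using assms(2,3) by simp
  define k where "k = (\<beta> + 2) / (\<alpha> + 2)"
  have k: "1 \<le> k" "\<beta> + 2 = k * (\<alpha> + 2)" using assms(2,3) by (auto simp: k_def field_simps)
  obtain K where K: "\<bar>K\<bar> powr (p - 1) = k\<^sup>2" "\<And>x. x \<in> unit_disc \<Longrightarrow> u\<^sub>\<beta> x = K * u\<^sub>\<alpha> (radmap 1 k x)"
    by (rule radial_solutions_related[OF assms(1-3) assms(5-10) assms(4) k_def]) blast
  have "morse_index p \<alpha> u\<^sub>\<alpha> \<le> morse_index p \<beta> u\<^sub>\<beta>"
    by (rule morse_index_mono[OF assms(1,2) \<beta> k assms(5,8) K])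
  then show ?thesis
    using radial_morse_index_eq[OF assms(1,2) assms(5-7) assms(4)]
      radial_morse_index_eq[OF assms(1) \<beta> assms(8-10) assms(4)] by simp
qed

end
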